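(* Let $m,n\in\mathbb{N}_0$, $\Theta\in(0,\pi/2)$, $\ell=\cos\Theta$ and $\ell'=\sqrt{1-\ell^2}$. Let $S_\Theta=\{e^{i\theta}:\theta\in[-2\Theta,2\Theta]\}$ and $T_\Theta=\{e^{i\theta}:\theta\in[-\Theta,\Theta]\cup[\pi-\Theta,\pi+\Theta]\}$. (i) The problem of minimizing $$\max_{z\in S_\Theta}\left|\arg\left(\frac{r(z)}{\sqrt z}\right)\right|$$ over all $r\in\mathcal{R}_{n,n}$ satisfying $|r(z)|=1$ for all $|z|=1$ has a unique solution, namely $$r(z)=r_n(z;\Theta)=\prod_{j=1}^n\frac{1+a_jz}{z+a_j},$$ where $$a_j=\left(\frac{\ell\,\mathrm{sn}\left(\frac{2j-1}{2n+1}K(\ell'),\ell'\right)+\mathrm{dn}\left(\frac{2j-1}{2n+1}K(\ell'),\ell'\right)}{\mathrm{cn}\left(\frac{2j-1}{2n+1}K(\ell'),\ell'\right)}\right)^{2(-1)^{j+n}}.$$ (ii) The problem of minimizing $$\max_{z\in T_\Theta}\left|\arg\left(\frac{r(z)}{\mathrm{sign}(z)}\right)\right|$$ over all $r\in\mathcal{R}_{m,m}$ satisfying $|r(z)|=1$ for all $|z|=1$ has exactly two solutions: the function $$s(z)=s_m(z;\Theta)=i^{1-m}\prod_{j=1}^m\frac{z-ib_j}{1+ib_jz}$$ and its reciprocal $1/s(z)$, where $$b_j=(-1)^{mj}\left(\frac{\ell\,\mathrm{sn}\left(\frac{2j-1}{m}K(\ell'),\ell'\right)+\mathrm{dn}\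left(\frac{2j-1}{m}K(\ell'),\ell'\right)}{\mathrm{cn}\left(\frac{2j-1}{m}K(\ell'),\ell'\right)}\right)^{(-1)^j}.$$
   Context: $\mathbb{N}_0=\{0,1,2,\dots\}$. $\mathcal{R}_{m,n}$ is the set of rational functions $p/q$ with complex coefficients, $p,q$ polynomials of degree at most $m$ and $n$ respectively. $\sqrt z$ is the principal branch of the square root, $\mathrm{sign}(z)=z/\sqrt{z^2}$ (so $\mathrm{sign}(z)=1$ if $\operatorname{Re}z>0$ and $-1$ if $\operatorname{Re}z<0$), and $\arg$ is the principal argument. $\mathrm{sn}(\cdot,k),\mathrm{cn}(\cdot,k),\mathrm{dn}(\cdot,k)$ are Jacobi's elliptic functions with modulus $k$ (not parameter $k^2$), and $K(k)=\int_0^{\pi/2}(1-k^2\sin^2\theta)^{-1/2}\,d\theta$ is the complete elliptic integral of the first kind. Empty products equal $1$. Convention for $b_j$: when $m=2k+1$ is odd and $j=k+1$, one has $\mathrm{cn}(\frac{2j-1}{m}K(\ell'),\ell')=\mathrm{cn}(K(\ell'),\ell')=0$, so that $b_j=0$ if $k$ is even (exponent $-1$) and $b_j=\infty$ if $k$ is odd (exponent $+1$); in the case $b_j=\infty$ the factor $\frac{z-ib_j}{1+ib_jz}$ is understood as its limit $-1/z$. *)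

theory Defs
  imports
    "HOL-Analysis.Analysis"
    "HOL-Computational_Algebra.Computational_Algebra"
    "HOL-Computational_Algebra.Field_as_Ring"
begin

text \<open>
  Rational functions are elements of the field \<open>complex poly fract\<close>. A function is evaluated
  through its numerator and denominator in lowest terms, so removable singularities do not
  matter; at a genuine pole the value is the junk value \<open>x / 0 = 0\<close>, which is never unimodular.
\<close>

definition ratfun_eval :: "complex poly fract \<Rightarrow> complex \<Rightarrow> complex" where
  "ratfun_eval r z = (case quot_of_fract r of (p, q) \<Rightarrow> poly p z / poly q z)"

definition ratfuns :: "nat \<Rightarrow> nat \<Rightarrow> complex poly fract set" where
  "ratfuns m n = {Fract p q | p q. q \<noteq> 0 \<and> degree p \<le> m \<and> degree q \<le> n}"

definition unimodular_on_circle :: "complex poly fract \<Rightarrow> bool" where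
  "unimodular_on_circle r \<longleftrightarrow> (\<forall>z. norm z = 1 \<longrightarrow> norm (ratfun_eval r z) = 1)"

definition csign :: "complex \<Rightarrow> complex" where
  "csign z = z / csqrt (z\<^sup>2)"


text \<open>
  Jacobi's functions with modulus \<open>k\<close>, \<open>\<bar>k\<bar> < 1\<close>, at real arguments: the amplitude is the inverse
  of the incomplete elliptic integral of the first kind \<open>\<phi> \<mapsto> elliptic_F k \<phi>\<close>, which is then an
  increasing bijection of the real line.
\<close>

definition elliptic_F :: "real \<Rightarrow> real \<Rightarrow> real" where
  "elliptic_F k \<phi> =
    (if 0 \<le> \<phi> then integral {0..\<phi>} (\<lambda>\<theta>. 1 / sqrt (1 - k\<^sup>2 * (sin \<theta>)\<^sup>2))
     else - integral {\<phi>..0} (\<lambda>\<theta>. 1 / sqrt (1 - k\<^sup>2 * (sin \<theta>)\<^sup>2)))"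

definition elliptic_K :: "real \<Rightarrow> real" where
  "elliptic_K k = integral {0..pi/2} (\<lambda>\<theta>. 1 / sqrt (1 - k\<^sup>2 * (sin \<theta>)\<^sup>2))"

definition jacobi_am :: "real \<Rightarrow> real \<Rightarrow> real" where
  "jacobi_am u k = (THE \<phi>. elliptic_F k \<phi> = u)"

definition jacobi_sn :: "real \<Rightarrow> real \<Rightarrow> real" where
  "jacobi_sn u k = sin (jacobi_am u k)"

definition jacobi_cn :: "real \<Rightarrow> real \<Rightarrow> real" where
  "jacobi_cn u k = cos (jacobi_am u k)"

definition jacobi_dn :: "real \<Rightarrow> real \<Rightarrow> real" where
  "jacobi_dn u k = sqrt (1 - k\<^sup>2 * (jacobi_sn u k)\<^sup>2)"


definition S_arc :: "real \<Rightarrow> complex set" where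
  "S_arc \<Theta> = cis ` {- 2 * \<Theta> .. 2 * \<Theta>}"

definition T_arc :: "real \<Rightarrow> complex set" where
  "T_arc \<Theta> = cis ` ({- \<Theta> .. \<Theta>} \<union> {pi - \<Theta> .. pi + \<Theta>})"

text \<open>
  The suprema below are over nonempty sets bounded by \<open>pi\<close>. For \<open>r\<close> unimodular on the circle
  and \<open>0 < \<Theta> < pi/2\<close> they are maxima: \<open>\<bar>Arg w\<bar>\<close> is continuous on the unit circle, including at
  \<open>-1\<close>, and \<open>csqrt\<close> and \<open>csign\<close> are continuous on the compact sets \<open>S_arc \<Theta>\<close> and \<open>T_arc \<Theta>\<close>.
\<close>

definition sqrt_phase_error :: "real \<Rightarrow> complex poly fract \<Rightarrow> real" where
  "sqrt_phase_error \<Theta> r = (SUP z\<in>S_arc \<Theta>. \<bar>Arg (ratfun_eval r z / csqrt z)\<bar>)"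

definition sign_phase_error :: "real \<Rightarrow> complex poly fract \<Rightarrow> real" where
  "sign_phase_error \<Theta> r = (SUP z\<in>T_arc \<Theta>. \<bar>Arg (ratfun_eval r z / csign z)\<bar>)"


definition elliptic_quot :: "real \<Rightarrow> real \<Rightarrow> real" where
  "elliptic_quot \<Theta> t =
    (let l = cos \<Theta>; l' = sqrt (1 - l\<^sup>2); u = t * elliptic_K l'
     in (l * jacobi_sn u l' + jacobi_dn u l') / jacobi_cn u l')"

definition a_coeff :: "nat \<Rightarrow> real \<Rightarrow> nat \<Rightarrow> real" where
  "a_coeff n \<Theta> j =
    elliptic_quot \<Theta> ((2 * real j - 1) / (2 * real n + 1)) powi (2 * (-1) ^ (j + n))"

definition r_opt :: "nat \<Rightarrow> real \<Rightarrow> complex poly fract" where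
  "r_opt n \<Theta> =
    (\<Prod>j = 1..n. Fract [:1, of_real (a_coeff n \<Theta> j):] [:of_real (a_coeff n \<Theta> j), 1:])"

text \<open>
  For \<open>m = 2 k + 1\<close> and \<open>j = k + 1\<close> the denominator \<open>jacobi_cn\<close> vanishes, and the coefficient
  is \<open>0\<close> (even \<open>k\<close>, exponent \<open>-1\<close>) or infinite (odd \<open>k\<close>, exponent \<open>1\<close>). For an infinite
  coefficient \<open>b\<close> the factor \<open>(z - i b) / (1 + i b z)\<close> stands for its limit \<open>-1 / z\<close>.
\<close>

definition b_coeff :: "nat \<Rightarrow> real \<Rightarrow> nat \<Rightarrow> ereal" where
  "b_coeff m \<Theta> j =
    (if m = 2 * j - 1 then (if odd j then 0 else \<infinity>)
     else ereal ((-1) ^ (m * j) * elliptic_quot \<Theta> ((2 * real j - 1) / real m) powi ((-1) ^ j)))"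

definition s_factor :: "ereal \<Rightarrow> complex poly fract" where
  "s_factor b =
    (if \<bar>b\<bar> = \<infinity> then Fract [:-1:] [:0, 1:]
     else Fract [:- \<i> * of_real (real_of_ereal b), 1:] [:1, \<i> * of_real (real_of_ereal b):])"

definition s_opt :: "nat \<Rightarrow> real \<Rightarrow> complex poly fract" where
  "s_opt m \<Theta> = to_fract [:\<i> powi (1 - int m):] * (\<Prod>j = 1..m. s_factor (b_coeff m \<Theta> j))"

end

theory Submission
  imports Defs
begin

text \<open>
  Both problems are solved by a single Blaschke-type product on the unit circle, and
  everything rests on two facts about it: its phase error equioscillates as often as its
  degree permits, and nothing else can have an error that small.

  Equioscillation. Put \<open>k = sin \<Theta>\<close> and parametrize the right arc of \<open>T_arc \<Theta>\<close> by
  \<open>z(t) = cis (angle t) = dn t + \<i> k sn t\<close>, \<open>-K \<le> t \<le> K\<close>. The quotient \<open>elliptic_quot\<close> at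
  \<open>u / K\<close> is \<open>tan (am (u + K) / 2)\<close>, so the factors of \<open>s_opt\<close> are the Blaschke factors with
  zero \<open>\<i> tan (\<phi> / 2)\<close> where \<open>\<phi>\<close> is the amplitude of some \<open>\<sigma>\<close>. By the addition theorems the
  phase velocity of such a factor along \<open>z(t)\<close> splits as \<open>D (t - \<sigma>) - D (t + \<sigma> - 2 K)\<close> with
  the single function \<open>D = (dn + k cn) / 2\<close> (\<open>dn_cn_product\<close>, \<open>blaschke_factor_phase\<close>). The
  points \<open>\<sigma>\<close> and \<open>2 K - \<sigma>\<close> belonging to the \<open>m\<close> factors together form all points of a grid of
  mesh \<open>2 K / m\<close> modulo \<open>4 K\<close>, and they enter with alternating signs. Hence the phase
  \<open>phase_err m\<close> of the product is a full-period alternating sum of translates of one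
  increasing function. For \<open>m > 0\<close> it therefore lies strictly between \<open>- pi / 2\<close> and \<open>pi / 2\<close>,
  and it changes sign under translation by \<open>2 K / m\<close>. It is also even about \<open>K\<close>. If its
  modulus exceeded \<open>\<bar>phase_err m K\<bar>\<close> somewhere, these symmetries would make it take some value
  more than \<open>m\<close> times on the right arc (\<open>abs_le_of_shift_antiperiodic\<close>), which a quotient of
  degree \<open>m\<close> cannot do. So the error takes its extreme values with alternating signs at
  \<open>m + 1\<close> points of the right arc, and, by the symmetry \<open>z \<mapsto> - cnj z\<close>, at \<open>m + 1\<close> points of
  the left arc.

  Optimality and uniqueness. A unimodular rational function of degree \<open>m\<close> is \<open>p / q\<close> with
  \<open>p(z) = c z^m cnj (q(z))\<close> on the circle. For two of them, \<open>z^(-m) (p' q - p q')\<close> is a real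
  trigonometric function up to a constant factor, with the sign of the sine of half the phase
  difference. If the competitor is not worse, this function alternates weakly in sign at
  \<open>2 m + 2\<close> points. The divided difference of \<open>p' q - p q'\<close>, of degree at most \<open>2 m\<close>, at these
  points is zero and is a sum of terms of one sign, so the polynomial vanishes at all of them
  and is zero (\<open>alternation_imp_zero\<close>). This treats weak alternation, with its possible double
  zeros, like strict alternation. Half a phase difference is only determined up to sign on
  each arc. With equal signs on both arcs of \<open>T_arc \<Theta>\<close> the competitor equals \<open>s_opt m \<Theta>\<close>; with
  opposite signs the same argument against the reciprocal applies. That is where the second
  solution comes from, and why it is absent on the single arc \<open>S_arc \<Theta>\<close>.

  The square root problem is contained in the sign problem of odd degree: its solution of
  degree \<open>2 n + 1\<close> has opposite zeros apart from the middle one, and pairing them shows that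
  it is \<open>z / r(z\<^sup>2)\<close> with \<open>r = r_opt n \<Theta>\<close>, or the reciprocal of that, according to the parity
  of \<open>n\<close> (\<open>sqrt_quotient\<close>). So the error of \<open>r_opt n \<Theta>\<close> equioscillates at \<open>2 n + 2\<close> points.
\<close>

section \<open>Alternation on the unit circle\<close>

text \<open>
  The sum is the coefficient of degree \<open>card I - 1\<close> of the Lagrange interpolant of \<open>f\<close> at the
  points \<open>z i\<close>, and the interpolant is \<open>f\<close> itself.
\<close>

lemma divided_difference_zero:
  fixes f :: "complex poly" and z :: "'i \<Rightarrow> complex"
  assumes "finite I" "inj_on z I" "degree f + 1 < card I"
  shows "(\<Sum>i\<in>I. poly f (z i) / (\<Prod>j\<in>I-{i}. z i - z j)) = 0"
proof -
  define D where "D = (\<lambda>i. \<Prod>j\<in>I-{i}. z i - z j)"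
  define B where "B = (\<lambda>i. \<Prod>j\<in>I-{i}. [:- z j, 1:])"
  define L where "L = (\<Sum>i\<in>I. smult (poly f (z i) / D i) (B i))"
  have D: "D i \<noteq> 0" if "i \<in> I" for i
    using assms(1,2) that by (auto simp: D_def inj_on_def)
  have B_deg: "degree (B i) = card I - 1" if "i \<in> I" for i
    using that assms(1) by (simp add: B_def degree_prod_eq_sum_degree)
  have B_monic: "coeff (B i) (card I - 1) = 1" if "i \<in> I" for i
    using lead_coeff_prod[of "\<lambda>j. [:- z j, 1:]" "I - {i}"]
    unfolding B_deg[OF that, symmetric] by (simp add: B_def)
  have B_eval: "poly (B i) (z l) = (if l = i then D i else 0)" if "i \<in> I" "l \<in> I" for i l
    using that assms(1) by (auto simp: B_def D_def poly_prod)
  have L_eval: "poly L (z l) = poly f (z l)" if "l \<in> I" for l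
  proof -
    have "poly L (z l) = (\<Sum>i\<in>I. if i = l then poly f (z l) else 0)"
      unfolding L_def poly_sum poly_smult
      using that D by (intro sum.cong) (auto simp: B_eval)
    then show ?thesis using that assms(1) by simp
  qed
  have "degree L \<le> card I - 1"
    unfolding L_def by (intro degree_sum_le assms(1)) (metis B_deg degree_smult_le)
  moreover have "card (z ` I) = card I"
    by (rule card_image) fact
  ultimately have "L = f"
    using assms(3) L_eval by (intro poly_eqI_degree[of "z ` I"]) auto
  moreover have "coeff f (card I - 1) = 0"
    using assms(3) by (intro coeff_eq_0) auto
  ultimately have "0 = coeff L (card I - 1)" by simp
  also have "\<dots> = (\<Sum>i\<in>I. poly f (z i) / D i)"
    unfolding L_def coeff_sum by (intro sum.cong) (auto simp: B_monic simp del: One_nat_def)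
  finally show ?thesis by (simp add: D_def)
qed

lemma cis_diff_eq: "cis x - cis y = 2 * \<i> * cis ((x + y) / 2) * of_real (sin ((x - y) / 2))"
proof -
  have 1: "2 * \<i> * of_real (sin u) = cis u - cis (- u)" for u
    by (simp add: complex_eq_iff)
  have "2 * \<i> * cis ((x + y) / 2) * of_real (sin ((x - y) / 2))
      = cis ((x + y) / 2) * (cis ((x - y) / 2) - cis (- ((x - y) / 2)))"
    unfolding 1 [symmetric] by simp
  also have "\<dots> = cis x - cis y"
    by (simp add: right_diff_distrib cis_mult) (simp add: field_simps)
  finally show ?thesis by simp
qed

lemma cis_sum: "cis (\<Sum>x\<in>A. f x) = (\<Prod>x\<in>A. cis (f x))"
  by (induction A rule: infinite_finite_induct) (auto simp: cis_mult [symmetric])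

text \<open>
  On the circle the factors \<open>cis (\<theta> i) - cis (\<theta> j)\<close> are sines up to phases, and for \<open>2 m + 2\<close>
  points the phases of the products combine to \<open>cis (\<theta> i) ^ m\<close> times a constant. This is the
  phase that a real trigonometric polynomial of degree \<open>m\<close> carries when written as a
  polynomial in \<open>cis\<close>, so the divided difference becomes a real relation.
\<close>

lemma circle_divided_difference:
  fixes f :: "complex poly" and \<theta> y :: "nat \<Rightarrow> real" and m :: nat
  defines "I \<equiv> {..2 * m + 1}"
  assumes "degree f \<le> 2 * m" "C \<noteq> 0"
    and "inj_on (\<lambda>i. cis (\<theta> i)) I"
    and "\<And>i. i \<in> I \<Longrightarrow> poly f (cis (\<theta> i)) = C * cis (\<theta> i) ^ m * of_real (y i)"
  shows "(\<Sum>i\<in>I. y i / (\<Prod>j\<in>I-{i}. sin ((\<theta> i - \<theta> j) / 2))) = 0"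
proof -
  define S where "S = (\<Sum>j\<in>I. \<theta> j)"
  define P where "P = (\<lambda>i. \<Prod>j\<in>I-{i}. sin ((\<theta> i - \<theta> j) / 2))"
  define c where "c = (2 * \<i>) ^ (2 * m + 1) * cis (S / 2)"
  have cI: "card I = 2 * m + 2" by (simp add: I_def)
  have prod: "(\<Prod>j\<in>I-{i}. cis (\<theta> i) - cis (\<theta> j)) = c * cis (\<theta> i) ^ m * of_real (P i)"
    if "i \<in> I" for i
  proof -
    have card: "card (I - {i}) = 2 * m + 1"
      using that cI by (simp add: I_def)
    have "(\<Sum>j\<in>I-{i}. (\<theta> i + \<theta> j) / 2) = (real (2 * m + 1) * \<theta> i + (S - \<theta> i)) / 2"
      using that card unfolding S_def
      by (simp add: sum_divide_distrib [symmetric] sum.distrib sum_diff1 I_def)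
    also have "\<dots> = S / 2 + real m * \<theta> i" by (simp add: algebra_simps)
    finally have "cis (\<Sum>j\<in>I-{i}. (\<theta> i + \<theta> j) / 2) = cis (S / 2) * cis (\<theta> i) ^ m"
      using Complex.DeMoivre[of "\<theta> i" m] cis_mult[of "S / 2" "real m * \<theta> i"] by simp
    then show ?thesis
      unfolding cis_diff_eq P_def of_real_prod c_def
      by (simp add: prod.distrib cis_sum card mult_ac)
  qed
  have "(\<Sum>i\<in>I. poly f (cis (\<theta> i)) / (\<Prod>j\<in>I-{i}. cis (\<theta> i) - cis (\<theta> j))) = 0"
    using assms(2) by (intro divided_difference_zero assms(4)) (auto simp: I_def)
  moreover have "poly f (cis (\<theta> i)) / (\<Prod>j\<in>I-{i}. cis (\<theta> i) - cis (\<theta> j))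
      = C / c * of_real (y i / P i)" if "i \<in> I" for i
    unfolding assms(5)[OF that] prod[OF that] by simp
  ultimately have "(\<Sum>i\<in>I. C / c * of_real (y i / P i)) = 0"
    by (metis (mono_tags, lifting) sum.cong)
  then have "C / c * of_real (\<Sum>i\<in>I. y i / P i) = 0"
    by (simp add: sum_distrib_left)
  then show ?thesis
    using \<open>C \<noteq> 0\<close> by (simp add: c_def P_def del: of_real_sum)
qed

text \<open>
  If the points are in cyclic order, the products of sines alternate in sign too. Weak
  alternation of the values thus makes all terms of the divided difference have one sign, and
  since they sum to zero each of them vanishes. The \<open>2 m + 2\<close> zeros exceed the degree. Zeros
  may be double where the alternation is only weak, and the sum covers this case as well.
\<close>

lemma alternation_imp_zero:
  fixes f :: "complex poly" and \<theta> y :: "nat \<Rightarrow> real" and m :: nat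
  assumes deg: "degree f \<le> 2 * m" and C: "C \<noteq> 0"
    and mono: "\<And>i j. i < j \<Longrightarrow> j \<le> 2 * m + 1 \<Longrightarrow> \<theta> i < \<theta> j"
    and window: "\<theta> (2 * m + 1) < \<theta> 0 + 2 * pi"
    and val: "\<And>i. i \<le> 2 * m + 1 \<Longrightarrow> poly f (cis (\<theta> i)) = C * cis (\<theta> i) ^ m * of_real (y i)"
    and alt: "\<And>i. i \<le> 2 * m + 1 \<Longrightarrow> 0 \<le> \<tau> * (-1) ^ i * y i" and \<tau>: "\<tau> \<noteq> 0"
  shows "f = 0"
proof -
  define I where "I = {..2 * m + 1}"
  define P where "P = (\<lambda>i. \<Prod>j\<in>I-{i}. sin ((\<theta> i - \<theta> j) / 2))"
  have sin_pos: "0 < sin ((\<theta> j - \<theta> i) / 2)" if "i < j" "j \<le> 2 * m + 1" for i j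
  proof -
    have "\<theta> 0 \<le> \<theta> i" using mono[of 0 i] that by (cases "i = 0") auto
    moreover have "\<theta> j \<le> \<theta> (2 * m + 1)"
      using mono[of j "2 * m + 1"] that by (cases "j = 2 * m + 1") auto
    ultimately show ?thesis
      using mono[OF that] window by (intro sin_gt_zero) auto
  qed
  have inj: "inj_on (\<lambda>i. cis (\<theta> i)) I"
  proof (rule linorder_inj_onI)
    fix i j :: nat assume "i < j" "i \<in> I" "j \<in> I"
    then have "sin ((\<theta> j - \<theta> i) / 2) \<noteq> 0"
      using sin_pos[of i j] by (auto simp: I_def)
    then have "cis (\<theta> j) - cis (\<theta> i) \<noteq> 0"
      by (simp add: cis_diff_eq)
    then show "cis (\<theta> i) \<noteq> cis (\<theta> j)" by auto
  qed auto
  have P_sign: "(-1) ^ i * P i < 0" if "i \<in> I" for i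
  proof -
    \<comment> \<open>Only the factors with larger index are negative; the window of length \<open>2 * pi\<close> keeps all half differences below \<open>pi\<close>.\<close>
    have "I - {i} = {..<i} \<union> {i<..2 * m + 1}"
      using that by (auto simp: I_def)
    then have "P i = (\<Prod>j<i. sin ((\<theta> i - \<theta> j) / 2)) * (\<Prod>j\<in>{i<..2 * m + 1}. sin ((\<theta> i - \<theta> j) / 2))"
      unfolding P_def by (metis (no_types, lifting) prod.union_disjoint finite_lessThan
        finite_greaterThanAtMost disjoint_iff lessThan_iff greaterThanAtMost_iff less_asym)
    also have "(\<Prod>j\<in>{i<..2 * m + 1}. sin ((\<theta> i - \<theta> j) / 2))
        = (\<Prod>j\<in>{i<..2 * m + 1}. (-1) * sin ((\<theta> j - \<theta> i) / 2))"
      by (intro prod.cong) (auto simp: sin_minus [symmetric] minus_divide_left simp del: sin_minus)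
    also have "\<dots> = (-1) ^ (2 * m + 1 - i) * (\<Prod>j\<in>{i<..2 * m + 1}. sin ((\<theta> j - \<theta> i) / 2))"
      by (simp only: prod.distrib prod_constant card_greaterThanAtMost)
    finally have eq: "(-1) ^ i * P i = (-1) ^ i * (-1) ^ (2 * m + 1 - i) *
        ((\<Prod>j<i. sin ((\<theta> i - \<theta> j) / 2)) * (\<Prod>j\<in>{i<..2 * m + 1}. sin ((\<theta> j - \<theta> i) / 2)))"
      by simp
    have sgn: "(-1 :: real) ^ i * (-1) ^ (2 * m + 1 - i) = -1"
      using that by (simp add: I_def flip: power_add)
    have "0 < (\<Prod>j<i. sin ((\<theta> i - \<theta> j) / 2))" "0 < (\<Prod>j\<in>{i<..2 * m + 1}. sin ((\<theta> j - \<theta> i) / 2))"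
      using that by (intro prod_pos; use sin_pos in \<open>auto simp: I_def\<close>)+
    from mult_pos_pos[OF this] show ?thesis
      unfolding eq sgn by simp
  qed
  have "(\<Sum>i\<in>I. y i / P i) = 0"
    unfolding I_def P_def
    using inj val by (intro circle_divided_difference[OF deg C]) (auto simp: I_def)
  then have "(\<Sum>i\<in>I. - \<tau> * (y i / P i)) = 0"
    by (simp only: sum_distrib_left [symmetric] mult_zero_right)
  moreover have "0 \<le> - \<tau> * (y i / P i)" if "i \<in> I" for i
  proof -
    have "- \<tau> * (y i / P i) = (\<tau> * (-1) ^ i * y i) / - ((-1) ^ i * P i)"
      by (cases "even i") auto
    moreover have "0 \<le> \<tau> * (-1) ^ i * y i" "0 < - ((-1) ^ i * P i)"
      using P_sign[OF that] alt[of i] that by (auto simp: I_def)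
    ultimately show ?thesis by (metis divide_nonneg_pos)
  qed
  ultimately have zero: "- \<tau> * (y i / P i) = 0" if "i \<in> I" for i
    using that sum_nonneg_eq_0_iff[of I "\<lambda>i. - \<tau> * (y i / P i)"] by (auto simp: I_def)
  have "y i = 0" if "i \<in> I" for i
    using zero[OF that] P_sign[OF that] \<tau> by auto
  then have "poly f (cis (\<theta> i)) = 0" if "i \<in> I" for i
    using val[of i] that by (auto simp: I_def)
  moreover have "card ((\<lambda>i. cis (\<theta> i)) ` I) = 2 * m + 2"
    using inj by (simp add: card_image I_def)
  ultimately show ?thesis
    using deg by (intro poly_eqI_degree[of "(\<lambda>i. cis (\<theta> i)) ` I"]) auto
qed

section \<open>Unimodular rational functions\<close>

text \<open>
  The denominator in lowest terms cannot vanish where the given one does not: its zero would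
  also be a zero of the numerator in lowest terms.
\<close>

lemma ratfun_eval_Fract:
  assumes "poly q z \<noteq> 0"
  shows "ratfun_eval (Fract p q) z = poly p z / poly q z"
proof -
  obtain a b where ab: "quot_of_fract (Fract p q) = (a, b)" by fastforce
  have "q \<noteq> 0" using assms by auto
  have "b \<noteq> 0" "Fract a b = Fract p q" "coprime a b"
    using ab snd_quot_of_fract_nonzero[of "Fract p q"] Fract_quot_of_fract[of "Fract p q"]
      coprime_quot_of_fract[of "Fract p q"] by auto
  then have "a * q = p * b" using \<open>q \<noteq> 0\<close> by (simp add: eq_fract)
  then have eq: "poly a z * poly q z = poly p z * poly b z"
    by (metis poly_mult)
  have "poly b z \<noteq> 0"
  proof
    assume b: "poly b z = 0"
    with eq assms have "poly a z = 0" by simp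
    with b have "[:- z, 1:] dvd a" "[:- z, 1:] dvd b" by (simp_all add: poly_eq_0_iff_dvd)
    with \<open>coprime a b\<close> have "is_unit [:- z, 1:]" by (meson coprime_common_divisor)
    then show False by (simp add: is_unit_iff_degree)
  qed
  with eq assms show ?thesis by (simp add: ratfun_eval_def ab field_simps)
qed

lemma infinite_circle: "infinite {z :: complex. cmod z = 1}"
proof -
  have "inj_on cis {0..1}"
    by (rule inj_onI) (use cos_inj_pi pi_ge_two in \<open>force simp: complex_eq_iff\<close>)
  then have "infinite (cis ` {0..1})"
    using infinite_Icc[of 0 "1 :: real"] by (simp add: finite_image_iff)
  then show ?thesis
    by (rule infinite_super[rotated]) auto
qed

lemma poly_eq_if_eq_on_circle:
  fixes p q :: "complex poly"
  assumes "\<And>z. cmod z = 1 \<Longrightarrow> poly p z = poly q z"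
  shows "p = q"
proof (rule ccontr)
  assume "p \<noteq> q"
  then have "finite {z. poly (p - q) z = 0}"
    by (intro poly_roots_finite) auto
  then show False
    using infinite_circle assms by (auto dest!: rev_finite_subset[where A = "{z. cmod z = 1}"])
qed

text \<open>
  The classical \<open>p\<^sup>*\<close>, with \<open>p\<^sup>*(z) = z ^ degree p * cnj (p (1 / cnj z))\<close>.
\<close>

definition conj_reciprocal :: "complex poly \<Rightarrow> complex poly" where
  "conj_reciprocal p = map_poly cnj (reflect_poly p)"

lemma conj_reciprocal_on_circle:
  assumes "cmod z = 1"
  shows "poly (conj_reciprocal p) z = z ^ degree p * cnj (poly p z)"
proof -
  have "inverse (cnj z) = z" "z \<noteq> 0"
    using assms complex_norm_square[of z] by (auto intro: inverse_unique simp: mult.commute)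
  then show ?thesis
    using poly_reflect_poly_nz[of "cnj z" p] by (simp add: conj_reciprocal_def)
qed

lemma degree_conj_reciprocal_le: "degree (conj_reciprocal p) \<le> degree p"
  unfolding conj_reciprocal_def
  by (rule order_trans[OF map_poly_degree_leq degree_reflect_poly_le])

lemma cnj_circle: "cmod z = 1 \<Longrightarrow> z * cnj z = 1"
  by (metis complex_norm_square of_real_1 power_one)

text \<open>
  On the circle \<open>a * cnj a = b * cnj b\<close>; multiplied by a power of \<open>z\<close> this is an identity
  between polynomials, in which \<open>b\<close> divides the conjugate reciprocal of \<open>a\<close> because \<open>a\<close> and
  \<open>b\<close> are coprime. Comparison of degrees leaves only a constant.
\<close>

lemma self_inversive_if_le:
  fixes a b :: "complex poly"
  assumes "coprime a b" "a \<noteq> 0" "b \<noteq> 0" "degree a \<le> degree b"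
    and eq: "\<And>z. cmod z = 1 \<Longrightarrow> cmod (poly a z) = cmod (poly b z)"
  shows "\<exists>C. C \<noteq> 0 \<and> (\<forall>z. cmod z = 1 \<longrightarrow> z ^ degree b * cnj (poly a z) = C * poly b z)"
proof -
  define e where "e = degree b - degree a"
  have "a * (conj_reciprocal a * monom 1 e) = b * conj_reciprocal b"
  proof (rule poly_eq_if_eq_on_circle)
    fix z :: complex assume z: "cmod z = 1"
    have "poly a z * cnj (poly a z) = poly b z * cnj (poly b z)"
      using eq[OF z] by (simp flip: complex_norm_square)
    moreover have "z ^ degree b = z ^ degree a * z ^ e"
      using assms(4) by (simp add: e_def flip: power_add)
    ultimately show "poly (a * (conj_reciprocal a * monom 1 e)) z = poly (b * conj_reciprocal b) z"
      by (simp add: conj_reciprocal_on_circle[OF z] poly_monom mult_ac)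
  qed
  then have "b dvd conj_reciprocal a * monom 1 e"
    by (metis assms(1) coprime_commute coprime_dvd_mult_right_iff dvd_triv_left)
  then obtain h where h: "conj_reciprocal a * monom 1 e = b * h" by blast
  have "conj_reciprocal a \<noteq> 0"
  proof
    assume "conj_reciprocal a = 0"
    then have "poly a z = 0" if "cmod z = 1" for z
      using conj_reciprocal_on_circle[OF that, of a] that by auto
    then show False using poly_eq_if_eq_on_circle[of a 0] assms(2) by simp
  qed
  then have h0: "h \<noteq> 0" using h by auto
  have "degree b + degree h = degree (conj_reciprocal a) + e"
    using arg_cong[OF h, of degree] h0 assms(3) \<open>conj_reciprocal a \<noteq> 0\<close>
    by (simp add: degree_mult_eq degree_monom_eq)
  also have "\<dots> \<le> degree b"
    using degree_conj_reciprocal_le[of a] assms(4) by (simp add: e_def)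
  finally have "degree h = 0" by simp
  then obtain C where C: "h = [:C:]" by (rule degree_eq_zeroE)
  have "z ^ degree b * cnj (poly a z) = C * poly b z" if "cmod z = 1" for z
  proof -
    have "z ^ degree b = z ^ degree a * z ^ e"
      using assms(4) by (simp add: e_def flip: power_add)
    then show ?thesis
      using arg_cong[OF h, of "\<lambda>p. poly p z"] conj_reciprocal_on_circle[OF that, of a]
      by (simp add: poly_monom C mult_ac)
  qed
  moreover have "C \<noteq> 0" using h0 C by simp
  ultimately show ?thesis by blast
qed

text \<open>
  Numerator and denominator of a quotient of constant modulus on the circle. The exponent \<open>m\<close>
  is a formal degree, which the actual degrees need not attain.
\<close>

definition conj_reciprocal_pair :: "nat \<Rightarrow> complex \<Rightarrow> complex poly \<Rightarrow> complex poly \<Rightarrow> bool" where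
  "conj_reciprocal_pair m c p q \<longleftrightarrow> degree p \<le> m \<and> degree q \<le> m \<and> c \<noteq> 0 \<and>
     (\<forall>z. cmod z = 1 \<longrightarrow> poly p z = c * z ^ m * cnj (poly q z))"

lemma self_inversive:
  fixes a b :: "complex poly"
  assumes "coprime a b" "a \<noteq> 0" "b \<noteq> 0"
    and eq: "\<And>z. cmod z = 1 \<Longrightarrow> cmod (poly a z) = cmod (poly b z)"
  shows "\<exists>c. conj_reciprocal_pair (max (degree a) (degree b)) c a b"
proof (cases "degree a \<le> degree b")
  case True
  from self_inversive_if_le[OF assms(1-3) True eq] obtain C where
    C: "C \<noteq> 0" "\<And>z. cmod z = 1 \<Longrightarrow> z ^ degree b * cnj (poly a z) = C * poly b z"
    by blast
  have "poly a z = cnj C * z ^ degree b * cnj (poly b z)" if "cmod z = 1" for z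
  proof -
    have "(z * cnj z) ^ degree b * poly a z = z ^ degree b * cnj (z ^ degree b * cnj (poly a z))"
      by (simp add: power_mult_distrib)
    then show ?thesis
      unfolding C(2)[OF that] using cnj_circle[OF that] by simp
  qed
  with True C(1) show ?thesis
    by (auto simp: conj_reciprocal_pair_def max_def intro!: exI[of _ "cnj C"])
next
  case False
  then have "degree b \<le> degree a" by simp
  from self_inversive_if_le[OF coprime_commute[THEN iffD1, OF assms(1)] assms(3,2) this] eq
  obtain C where C: "C \<noteq> 0" "\<And>z. cmod z = 1 \<Longrightarrow> z ^ degree a * cnj (poly b z) = C * poly a z"
    by metis
  then have "poly a z = inverse C * z ^ degree a * cnj (poly b z)" if "cmod z = 1" for z
    using that by (simp add: mult.assoc)
  with False C(1) show ?thesis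
    by (auto simp: conj_reciprocal_pair_def max_def intro!: exI[of _ "inverse C"])
qed

text \<open>
  Two such pairs can be compared only at the same formal degree \<open>m\<close>. If the degree in lowest
  terms is smaller, numerator and denominator are padded with powers of \<open>z - \<zeta>\<close>, a polynomial
  that is its own conjugate reciprocal up to a constant. The price is a zero at \<open>\<zeta>\<close>, which can
  be placed outside the arcs of interest.
\<close>

lemma unimodular_ratfun_pair:
  assumes r: "r \<in> ratfuns m m" "unimodular_on_circle r" and "cmod \<zeta> = 1"
  obtains p q c where "conj_reciprocal_pair m c p q" "r = Fract p q" "q \<noteq> 0"
    "\<And>z. cmod z = 1 \<Longrightarrow> z \<noteq> \<zeta> \<Longrightarrow> poly q z \<noteq> 0"
proof -
  obtain a b where ab: "quot_of_fract r = (a, b)" by fastforce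
  have b0: "b \<noteq> 0" and r_ab: "r = Fract a b" and cop: "coprime a b"
    using ab snd_quot_of_fract_nonzero[of r] Fract_quot_of_fract[of r]
      coprime_quot_of_fract[of r] by auto
  have uni: "cmod (poly a z / poly b z) = 1" if "cmod z = 1" for z
    using r(2) that by (simp add: unimodular_on_circle_def ratfun_eval_def ab)
  have b_nz: "poly b z \<noteq> 0" if "cmod z = 1" for z
    using uni[OF that] by auto
  have eq: "cmod (poly a z) = cmod (poly b z)" if "cmod z = 1" for z
    using uni[OF that] b_nz[OF that] by (simp add: norm_divide)
  have a0: "a \<noteq> 0" using uni[of 1] by auto
  obtain p q where pq: "r = Fract p q" "q \<noteq> 0" "degree p \<le> m" "degree q \<le> m"
    using r(1) by (auto simp: ratfuns_def)
  have cross: "a * q = p * b" using pq b0 r_ab by (simp add: eq_fract)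
  then have p0: "p \<noteq> 0" using a0 pq(2) by auto
  have "a dvd p * b" "b dvd a * q" by (metis cross dvd_triv_left, metis cross dvd_triv_right)
  then have "a dvd p" "b dvd q"
    using cop by (simp_all add: coprime_dvd_mult_left_iff coprime_dvd_mult_right_iff coprime_commute)
  then have deg: "max (degree a) (degree b) \<le> m"
    using dvd_imp_degree_le p0 pq by (metis max.bounded_iff order_trans)
  obtain c where c: "conj_reciprocal_pair (max (degree a) (degree b)) c a b"
    using self_inversive[OF cop a0 b0 eq] by blast
  define e where "e = m - max (degree a) (degree b)"
  define l where "l = [:- \<zeta>, 1:] ^ e"
  have l0: "l \<noteq> 0" by (simp add: l_def)
  have deg_l: "degree l = e" by (simp add: l_def degree_power_eq)
  have l_eval: "poly l z = (- \<zeta>) ^ e * z ^ e * cnj (poly l z)" if z: "cmod z = 1" for z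
  proof -
    have "z - \<zeta> = - \<zeta> * z * cnj (z - \<zeta>)"
      using cnj_circle[OF z] cnj_circle[OF assms(3)] by (simp add: algebra_simps)
    then have "(z - \<zeta>) ^ e = (- \<zeta> * z * cnj (z - \<zeta>)) ^ e" by (rule arg_cong)
    also have "\<dots> = (- \<zeta>) ^ e * z ^ e * cnj ((z - \<zeta>) ^ e)"
      by (simp only: power_mult_distrib complex_cnj_power)
    finally have "(z - \<zeta>) ^ e = (- \<zeta>) ^ e * z ^ e * cnj ((z - \<zeta>) ^ e)" .
    moreover have "poly l z = (z - \<zeta>) ^ e" by (simp add: l_def)
    ultimately show ?thesis by metis
  qed
  show ?thesis
  proof (rule that[of "c * (- \<zeta>) ^ e" "a * l" "b * l"])
    have "poly (a * l) z = c * (- \<zeta>) ^ e * z ^ m * cnj (poly (b * l) z)" if z: "cmod z = 1" for z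
    proof -
      have "z ^ m = z ^ max (degree a) (degree b) * z ^ e"
        using deg by (simp add: e_def flip: power_add)
      moreover have "poly a z = c * z ^ max (degree a) (degree b) * cnj (poly b z)"
        using c z by (simp add: conj_reciprocal_pair_def)
      ultimately show ?thesis
        using l_eval[OF z] by (simp add: mult_ac)
    qed
    moreover have "degree (a * l) \<le> m" "degree (b * l) \<le> m"
      using deg a0 b0 l0 by (simp_all add: degree_mult_eq deg_l e_def)
    moreover have "\<zeta> \<noteq> 0" using assms(3) by auto
    ultimately show "conj_reciprocal_pair m (c * (- \<zeta>) ^ e) (a * l) (b * l)"
      using c by (auto simp: conj_reciprocal_pair_def)
    show "r = Fract (a * l) (b * l)"
      using r_ab b0 l0 by (simp add: eq_fract)
    show "b * l \<noteq> 0" using b0 l0 by simp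
    show "poly (b * l) z \<noteq> 0" if "cmod z = 1" "z \<noteq> \<zeta>" for z
      using b_nz that by (simp add: l_def)
  qed
qed

lemma conj_reciprocal_pair_norm:
  assumes "conj_reciprocal_pair m c p q" "cmod z = 1"
  shows "cmod (poly p z) = cmod c * cmod (poly q z)"
  using assms by (simp add: conj_reciprocal_pair_def norm_mult norm_power)

lemma conj_reciprocal_pair_swap:
  assumes "conj_reciprocal_pair m c p q" "cmod c = 1"
  shows "conj_reciprocal_pair m c q p"
proof -
  have "poly q z = c * z ^ m * cnj (poly p z)" if z: "cmod z = 1" for z
  proof -
    have p: "poly p z = c * z ^ m * cnj (poly q z)"
      using assms(1) z by (simp add: conj_reciprocal_pair_def)
    have "c * z ^ m * cnj (poly p z) = (c * cnj c) * (z * cnj z) ^ m * poly q z"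
      unfolding p by (simp add: power_mult_distrib mult_ac)
    then show ?thesis
      using cnj_circle[OF z] cnj_circle[OF assms(2)] by simp
  qed
  with assms(1) show ?thesis by (simp add: conj_reciprocal_pair_def)
qed

lemma conj_reciprocal_pair_unimodular:
  assumes "conj_reciprocal_pair m c p q" "cmod c = 1" "\<And>z. cmod z = 1 \<Longrightarrow> poly q z \<noteq> 0"
  shows "Fract p q \<in> ratfuns m m" "unimodular_on_circle (Fract p q)"
proof -
  have "q \<noteq> 0" using assms(3)[of 1] by auto
  with assms(1) show "Fract p q \<in> ratfuns m m"
    unfolding ratfuns_def conj_reciprocal_pair_def by blast
  show "unimodular_on_circle (Fract p q)"
    using conj_reciprocal_pair_norm[OF assms(1)] assms(2,3)
    by (simp add: unimodular_on_circle_def ratfun_eval_Fract norm_divide)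
qed

text \<open>
  The square root \<open>g\<close> of the constant symmetrizes the comparison of two pairs.
\<close>

lemma unimodular_ratfun_pair_sqrt:
  assumes r: "r \<in> ratfuns m m" "unimodular_on_circle r" and "cmod \<zeta> = 1"
  obtains p q g where "conj_reciprocal_pair m (g\<^sup>2) p q" "cmod g = 1" "r = Fract p q" "q \<noteq> 0"
    "\<And>z. cmod z = 1 \<Longrightarrow> z \<noteq> \<zeta> \<Longrightarrow> poly q z \<noteq> 0"
proof -
  obtain p q c where pq: "conj_reciprocal_pair m c p q" "r = Fract p q" "q \<noteq> 0"
    "\<And>z. cmod z = 1 \<Longrightarrow> z \<noteq> \<zeta> \<Longrightarrow> poly q z \<noteq> 0"
    using unimodular_ratfun_pair[OF assms] by metis
  \<comment> \<open>Any point of the circle other than \<open>\<zeta>\<close> shows that the constant has modulus one.\<close>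
  define z where "z = - \<zeta>"
  have z: "cmod z = 1" "z \<noteq> \<zeta>" using assms(3) by (auto simp: z_def)
  then have "poly q z \<noteq> 0" by (rule pq(4))
  have "cmod (ratfun_eval r z) = 1" using r(2) z(1) by (simp add: unimodular_on_circle_def)
  then have "cmod c = 1"
    using conj_reciprocal_pair_norm[OF pq(1) z(1)] \<open>poly q z \<noteq> 0\<close>
    by (simp add: pq(2) ratfun_eval_Fract norm_divide)
  then show ?thesis
    using that[of "csqrt c" p q] pq by simp
qed

lemma prod_Fract:
  fixes p q :: "'i \<Rightarrow> 'a :: idom"
  assumes "\<And>i. i \<in> A \<Longrightarrow> q i \<noteq> 0"
  shows "(\<Prod>i\<in>A. Fract (p i) (q i)) = Fract (\<Prod>i\<in>A. p i) (\<Prod>i\<in>A. q i)"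
  using assms by (induction A rule: infinite_finite_induct) (auto simp: One_fract_def)

lemma degree_prod_le_card:
  fixes f :: "'i \<Rightarrow> 'a :: comm_semiring_1 poly"
  assumes "\<And>i. i \<in> A \<Longrightarrow> degree (f i) \<le> 1"
  shows "degree (prod f A) \<le> card A"
proof (cases "finite A")
  case True
  have "degree (prod f A) \<le> (\<Sum>i\<in>A. degree (f i))"
    using degree_prod_sum_le[OF True, of f] by (simp add: o_def)
  also have "\<dots> \<le> of_nat (card A) * 1"
    by (rule sum_bounded_above) (rule assms)
  finally show ?thesis by simp
qed simp

section \<open>Comparing two phases\<close>

text \<open>
  With \<open>\<gamma> = g' / g\<close> for unimodular \<open>g\<close> and \<open>g'\<close>, where \<open>p = g\<^sup>2 z ^ m cnj q\<close> and
  \<open>p' = g'\<^sup>2 z ^ m cnj q'\<close>, the square of this number is a positive multiple of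
  \<open>(p' / q') / (p / q)\<close>, and \<open>p' q - p q'\<close> equals \<open>2 \<i> g g' z ^ m\<close> times its imaginary part.
\<close>

definition half_phase :: "complex \<Rightarrow> complex poly \<Rightarrow> complex poly \<Rightarrow> complex \<Rightarrow> complex" where
  "half_phase \<gamma> q q' z = \<gamma> * cnj (poly q' z) * poly q z"

text \<open>
  The standard argument of de la Vallee Poussin type: where the error \<open>e\<close> is \<open>E\<close>, the
  difference \<open>e' - e\<close> is not positive, and where it is \<open>- E\<close> not negative. As \<open>E < pi\<close>, half
  the difference stays within \<open>(-pi, pi)\<close>, where the sine has the sign of its argument.
\<close>

lemma alternation_imp_same_ratio:
  fixes \<theta> w e e' :: "nat \<Rightarrow> real"
  assumes pq: "conj_reciprocal_pair m (g\<^sup>2) p q" "cmod g = 1"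
    and pq': "conj_reciprocal_pair m (g'\<^sup>2) p' q'" "cmod g' = 1"
    and mono: "\<And>i j. i < j \<Longrightarrow> j \<le> 2 * m + 1 \<Longrightarrow> \<theta> i < \<theta> j"
    and window: "\<theta> (2 * m + 1) < \<theta> 0 + 2 * pi"
    and V: "\<And>i. i \<le> 2 * m + 1 \<Longrightarrow>
      half_phase (g' / g) q q' (cis (\<theta> i)) = of_real (\<epsilon> * w i) * cis ((e' i - e i) / 2)"
    and w: "\<And>i. i \<le> 2 * m + 1 \<Longrightarrow> 0 \<le> w i" and \<epsilon>: "\<bar>\<epsilon>\<bar> = 1"
    and e: "\<And>i. i \<le> 2 * m + 1 \<Longrightarrow> e i = \<tau> * (-1) ^ i * E" and \<tau>: "\<bar>\<tau>\<bar> = 1"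
    and e': "\<And>i. i \<le> 2 * m + 1 \<Longrightarrow> \<bar>e' i\<bar> \<le> E" and E: "E < pi"
  shows "p' * q = p * q'"
proof -
  define f where "f = p' * q - p * q'"
  define y where "y = (\<lambda>i. \<epsilon> * w i * sin ((e' i - e i) / 2))"
  have g0: "g \<noteq> 0" "g' \<noteq> 0" using pq(2) pq'(2) by auto
  have "f = 0"
  proof (rule alternation_imp_zero[where C = "g * g' * (2 * \<i>)" and y = y and \<tau> = "- \<tau> * \<epsilon>"])
    have "degree (p' * q) \<le> 2 * m" "degree (p * q') \<le> 2 * m"
      using pq pq' degree_mult_le[of p' q] degree_mult_le[of p q']
      by (auto simp: conj_reciprocal_pair_def)
    then show "degree f \<le> 2 * m"
      unfolding f_def by (rule degree_diff_le)
    show "g * g' * (2 * \<i>) \<noteq> 0" using g0 by simp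
    show "\<theta> i < \<theta> j" if "i < j" "j \<le> 2 * m + 1" for i j using mono that .
    show "\<theta> (2 * m + 1) < \<theta> 0 + 2 * pi" by (rule window)
    show "- \<tau> * \<epsilon> \<noteq> 0" using \<epsilon> \<tau> by auto
    fix i assume i: "i \<le> 2 * m + 1"
    define z where "z = cis (\<theta> i)"
    define V where "V = half_phase (g' / g) q q' z"
    have "Im V = y i" using assms(7)[OF i] by (simp add: V_def z_def y_def)
    have gc: "g * cnj g = 1" "g' * cnj g' = 1"
      using pq(2) pq'(2) by (simp_all add: cnj_circle)
    have "poly f z = z ^ m * (g'\<^sup>2 * cnj (poly q' z) * poly q z - g\<^sup>2 * cnj (poly q z) * poly q' z)"
      using pq(1) pq'(1) by (simp add: f_def conj_reciprocal_pair_def z_def algebra_simps)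
    also have "g'\<^sup>2 * cnj (poly q' z) * poly q z = g * g' * V"
      using g0 by (simp add: V_def half_phase_def power2_eq_square)
    also have "g\<^sup>2 * cnj (poly q z) * poly q' z = g * g' * cnj V"
    proof -
      have "cnj g = 1 / g" "cnj g' = 1 / g'" using gc g0 by (simp_all add: field_simps)
      then show ?thesis using g0 by (simp add: V_def half_phase_def power2_eq_square)
    qed
    \<comment> \<open>The two halves of the cross difference are conjugate, hence only the imaginary part survives.\<close>
    also have "g * g' * V - g * g' * cnj V = g * g' * (2 * \<i>) * of_real (Im V)"
      using complex_diff_cnj[of V] by (simp add: right_diff_distrib [symmetric])
    finally show "poly f (cis (\<theta> i)) = g * g' * (2 * \<i>) * cis (\<theta> i) ^ m * of_real (y i)"
      by (simp add: z_def \<open>Im V = y i\<close> mult_ac)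
    define s where "s = \<tau> * (-1) ^ i"
    have s: "s = 1 \<or> s = -1" using \<tau> by (auto simp: s_def abs_if minus_one_power_iff split: if_splits)
    have "0 \<le> - s * sin ((e' i - s * E) / 2)"
    proof (cases "s = 1")
      case True
      have "0 \<le> sin ((E - e' i) / 2)"
        using e'[OF i] E by (intro sin_ge_zero) auto
      moreover have "sin ((e' i - E) / 2) = - sin ((E - e' i) / 2)"
        by (metis minus_diff_eq minus_divide_left sin_minus)
      ultimately show ?thesis using True by simp
    next
      case False
      have "0 \<le> sin ((e' i + E) / 2)"
        using e'[OF i] E by (intro sin_ge_zero) auto
      with False s show ?thesis by simp
    qed
    moreover have "e i = s * E" using e[OF i] by (simp add: s_def)
    ultimately have "0 \<le> - s * sin ((e' i - e i) / 2)" by (simp only:)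
    then have "0 \<le> w i * (- s * sin ((e' i - e i) / 2))"
      by (rule mult_nonneg_nonneg[OF w[OF i]])
    also have "\<dots> = (\<epsilon> * \<epsilon>) * (w i * (- s * sin ((e' i - e i) / 2)))"
      using \<epsilon> by (auto simp: abs_if split: if_splits)
    also have "\<dots> = - \<tau> * \<epsilon> * (-1) ^ i * y i"
      by (simp add: y_def s_def)
    finally show "0 \<le> - \<tau> * \<epsilon> * (-1) ^ i * y i" .
  qed
  then show ?thesis by (simp add: f_def)
qed

text \<open>
  The half phase agrees with \<open>cis ((e' - e) / 2)\<close> up to a sign, because both have the same
  square. By continuity the sign \<open>\<epsilon>\<close> is constant on an interval; on two separate arcs the
  signs may differ.
\<close>

lemma half_phase_on_arc:
  fixes e e' :: "real \<Rightarrow> real" and F :: "real \<Rightarrow> complex"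
  assumes pq: "conj_reciprocal_pair m (g\<^sup>2) p q" "cmod g = 1"
    and pq': "conj_reciprocal_pair m (g'\<^sup>2) p' q'" "cmod g' = 1"
    and nz: "\<And>x. x \<in> {a..b} \<Longrightarrow> poly q (cis x) \<noteq> 0" "\<And>x. x \<in> {a..b} \<Longrightarrow> poly q' (cis x) \<noteq> 0"
    and F: "\<And>x. x \<in> {a..b} \<Longrightarrow> F x \<noteq> 0"
    and val: "\<And>x. x \<in> {a..b} \<Longrightarrow> poly p (cis x) / poly q (cis x) = F x * cis (e x)"
    and val': "\<And>x. x \<in> {a..b} \<Longrightarrow> poly p' (cis x) / poly q' (cis x) = F x * cis (e' x)"
    and cont: "continuous_on {a..b} e" "continuous_on {a..b} e'"
  obtains \<epsilon> :: real where "\<bar>\<epsilon>\<bar> = 1"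
    "\<And>x. x \<in> {a..b} \<Longrightarrow> half_phase (g' / g) q q' (cis x) =
      of_real (\<epsilon> * cmod (half_phase (g' / g) q q' (cis x))) * cis ((e' x - e x) / 2)"
proof -
  define V where "V = (\<lambda>x. half_phase (g' / g) q q' (cis x))"
  define W where "W = (\<lambda>x. V x / of_real (cmod (V x)) * cis (- ((e' x - e x) / 2)))"
  have g0: "g \<noteq> 0" "g' \<noteq> 0" using pq(2) pq'(2) by auto
  have V0: "V x \<noteq> 0" if "x \<in> {a..b}" for x
    using nz that g0 by (simp add: V_def half_phase_def)
  have V2: "(V x)\<^sup>2 = cis (e' x - e x) * (of_real (cmod (V x)))\<^sup>2" if x: "x \<in> {a..b}" for x
  proof -
    define z Q Q' where "z = cis x" and "Q = poly q z" and "Q' = poly q' z"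
    have Q0: "Q \<noteq> 0" "Q' \<noteq> 0" using nz[OF x] by (auto simp: Q_def Q'_def z_def)
    have "cis (e' x - e x) = (F x * cis (e' x)) / (F x * cis (e x))"
      using F[OF x] by (simp add: cis_divide)
    also have "\<dots> = (g'\<^sup>2 * z ^ m * cnj Q' / Q') / (g\<^sup>2 * z ^ m * cnj Q / Q)"
      using pq(1) pq'(1)
      by (simp add: val[OF x, symmetric] val'[OF x, symmetric] conj_reciprocal_pair_def z_def Q_def Q'_def)
    also have "\<dots> = (g' / g)\<^sup>2 * (cnj Q' / Q') * (Q / cnj Q)"
      using Q0 g0 by (simp add: z_def power_divide mult_ac)
    finally have cis: "cis (e' x - e x) = (g' / g)\<^sup>2 * (cnj Q' / Q') * (Q / cnj Q)" .
    have "cmod (V x) = cmod Q' * cmod Q"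
      using pq(2) pq'(2) by (simp add: V_def half_phase_def norm_mult norm_divide Q_def Q'_def z_def)
    then have "(of_real (cmod (V x)))\<^sup>2 = (Q' * cnj Q') * (Q * cnj Q)"
      by (simp add: power_mult_distrib flip: complex_norm_square)
    then show ?thesis
      unfolding cis using Q0
      by (simp add: V_def half_phase_def z_def [symmetric] Q_def [symmetric] Q'_def [symmetric]
          power_mult_distrib power2_eq_square mult_ac)
  qed
  have W: "W x = 1 \<or> W x = -1" if x: "x \<in> {a..b}" for x
  proof -
    have "(W x)\<^sup>2 = (V x)\<^sup>2 / (of_real (cmod (V x)))\<^sup>2 * (cis (- ((e' x - e x) / 2)))\<^sup>2"
      by (simp only: W_def power_mult_distrib power_divide)
    also have "(cis (- ((e' x - e x) / 2)))\<^sup>2 = cis (- (e' x - e x))"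
      unfolding power2_eq_square cis_mult by (rule arg_cong[of _ _ cis]) (simp add: field_simps)
    finally have "(W x)\<^sup>2 = cis (e' x - e x) * cis (- (e' x - e x))"
      unfolding V2[OF x] using V0[OF x] by simp
    also have "\<dots> = 1" by (simp add: cis_mult)
    finally show ?thesis by (simp add: power2_eq_1_iff)
  qed
  have contV: "continuous_on {a..b} V"
    unfolding V_def half_phase_def by (intro continuous_intros)
  have contW: "continuous_on {a..b} W"
    unfolding W_def using V0 by (intro continuous_intros contV cont) auto
  have "W ` {a..b} \<subseteq> {1, -1}" using W by blast
  then have "finite (W ` {a..b})" by (rule finite_subset) simp
  then have "W constant_on {a..b}"
    by (intro continuous_finite_range_constant contW) auto
  then obtain c where c: "\<And>x. x \<in> {a..b} \<Longrightarrow> W x = c"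
    by (auto simp: constant_on_def)
  define \<epsilon> where "\<epsilon> = (if c = 1 then 1 else -1 :: real)"
  have W\<epsilon>: "W x = of_real \<epsilon>" if "x \<in> {a..b}" for x
    using W[OF that] c[OF that] by (auto simp: \<epsilon>_def)
  show ?thesis
  proof
    show "\<bar>\<epsilon>\<bar> = 1" by (simp add: \<epsilon>_def)
    fix x assume x: "x \<in> {a..b}"
    have "W x * of_real (cmod (V x)) * cis ((e' x - e x) / 2)
        = V x * (cis (- ((e' x - e x) / 2)) * cis ((e' x - e x) / 2))"
      using V0[OF x] by (simp add: W_def)
    also have "\<dots> = V x" by (simp only: cis_mult) simp
    finally show "half_phase (g' / g) q q' (cis x) =
        of_real (\<epsilon> * cmod (half_phase (g' / g) q q' (cis x))) * cis ((e' x - e x) / 2)"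
      using W\<epsilon>[OF x] by (simp add: V_def)
  qed
qed

text \<open>
  The argument is discontinuous only at \<open>-1\<close>, where it equals \<open>pi\<close>.
\<close>

lemma continuous_on_phase_error:
  assumes "continuous_on A f" "\<And>x. x \<in> A \<Longrightarrow> f x \<noteq> 0" "\<And>x. x \<in> A \<Longrightarrow> \<bar>Arg (f x)\<bar> < pi"
  shows "continuous_on A (\<lambda>x. Arg (f x))"
proof (rule continuous_on_Arg'[OF assms(1)])
  fix x assume x: "x \<in> A"
  show "f x \<notin> \<real>\<^sub>\<le>\<^sub>0"
  proof
    assume "f x \<in> \<real>\<^sub>\<le>\<^sub>0"
    then have "Arg (f x) = pi"
      using assms(2)[OF x] by (auto elim!: nonpos_Reals_cases simp: Arg_of_real)
    with assms(3)[OF x] show False by simp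
  qed
qed

lemma SUP_abs_Arg_eq:
  assumes "\<And>z. z \<in> A \<Longrightarrow> \<bar>Arg (f z)\<bar> \<le> E" "z0 \<in> A" "\<bar>Arg (f z0)\<bar> = E"
  shows "(SUP z\<in>A. \<bar>Arg (f z)\<bar>) = E"
  using assms by (intro cSup_eq_maximum) auto

lemma abs_Arg_le_SUP:
  assumes "z \<in> A" shows "\<bar>Arg (f z)\<bar> \<le> (SUP z\<in>A. \<bar>Arg (f z)\<bar>)"
proof (rule cSUP_upper[OF assms])
  show "bdd_above ((\<lambda>z. \<bar>Arg (f z)\<bar>) ` A)"
  proof (rule bdd_aboveI2[of _ _ pi])
    show "\<bar>Arg (f x)\<bar> \<le> pi" for x using Arg_bounded[of "f x"] by linarith
  qed
qed

text \<open>
  The competitor enters only through a bound \<open>E < pi\<close> for its error on the arc. That bound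
  makes the principal argument a continuous phase.
\<close>

lemma half_phase_of_error:
  fixes e :: "real \<Rightarrow> real" and F :: "real \<Rightarrow> complex"
  assumes pq: "conj_reciprocal_pair m (g\<^sup>2) p q" "cmod g = 1"
    and pq': "conj_reciprocal_pair m (g'\<^sup>2) p' q'" "cmod g' = 1"
    and nz: "\<And>x. x \<in> {a..b} \<Longrightarrow> poly q (cis x) \<noteq> 0" "\<And>x. x \<in> {a..b} \<Longrightarrow> poly q' (cis x) \<noteq> 0"
    and F: "\<And>x. x \<in> {a..b} \<Longrightarrow> cmod (F x) = 1" "continuous_on {a..b} F"
    and val: "\<And>x. x \<in> {a..b} \<Longrightarrow> poly p (cis x) / poly q (cis x) = F x * cis (e x)"
    and cont: "continuous_on {a..b} e"
    and bound: "\<And>x. x \<in> {a..b} \<Longrightarrow> \<bar>Arg (ratfun_eval (Fract p' q') (cis x) / F x)\<bar> \<le> E" and E: "E < pi"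
  obtains \<epsilon> e' where "\<bar>\<epsilon>\<bar> = 1" "\<And>x. x \<in> {a..b} \<Longrightarrow> \<bar>e' x\<bar> \<le> E"
    "\<And>x. x \<in> {a..b} \<Longrightarrow> half_phase (g' / g) q q' (cis x) =
      of_real (\<epsilon> * cmod (half_phase (g' / g) q q' (cis x))) * cis ((e' x - e x) / 2)"
proof -
  define u where "u = (\<lambda>x. poly p' (cis x) / poly q' (cis x) / F x)"
  define e' where "e' = (\<lambda>x. Arg (u x))"
  have F0: "F x \<noteq> 0" if "x \<in> {a..b}" for x using F(1)[OF that] by auto
  have u1: "cmod (u x) = 1" if x: "x \<in> {a..b}" for x
    using F(1)[OF x] nz(2)[OF x] pq'(2) conj_reciprocal_pair_norm[OF pq'(1), of "cis x"]
    by (simp add: u_def norm_divide norm_power norm_mult F0[OF x])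
  then have u0: "u x \<noteq> 0" if "x \<in> {a..b}" for x
    using that by force
  have e'_le: "\<bar>e' x\<bar> \<le> E" if x: "x \<in> {a..b}" for x
    using bound[OF x] nz(2)[OF x] by (simp add: e'_def u_def ratfun_eval_Fract)
  have "continuous_on {a..b} u"
    unfolding u_def using nz F0 by (intro continuous_intros F(2)) auto
  then have cont': "continuous_on {a..b} e'"
    unfolding e'_def using u0 e'_le E
    by (intro continuous_on_phase_error) (force simp: e'_def)+
  have val': "poly p' (cis x) / poly q' (cis x) = F x * cis (e' x)" if x: "x \<in> {a..b}" for x
  proof -
    have "cis (e' x) = u x"
      using cis_Arg[OF u0[OF x]] u1[OF x] by (simp add: e'_def sgn_div_norm)
    then show ?thesis using F0[OF x] by (simp add: u_def)
  qed
  obtain \<epsilon> :: real where "\<bar>\<epsilon>\<bar> = 1"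
    "\<And>x. x \<in> {a..b} \<Longrightarrow> half_phase (g' / g) q q' (cis x) =
      of_real (\<epsilon> * cmod (half_phase (g' / g) q q' (cis x))) * cis ((e' x - e x) / 2)"
    using half_phase_on_arc[OF pq pq' nz F0 val val' cont cont'] by metis
  with e'_le show ?thesis using that by blast
qed

text \<open>
  The minimizers are exactly \<open>M\<close> as soon as everything not worse than the common value \<open>E\<close> on
  \<open>M\<close> lies in \<open>M\<close>: existence and uniqueness come from the same comparison.
\<close>

lemma arg_min_set_eqI:
  fixes f :: "'a \<Rightarrow> 'b :: linorder"
  assumes "M \<noteq> {}" "\<And>x. x \<in> M \<Longrightarrow> P x \<and> f x = E" "\<And>x. P x \<Longrightarrow> f x \<le> E \<Longrightarrow> x \<in> M"
  shows "{x. is_arg_min f P x} = M"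
proof (intro set_eqI iffI; unfold mem_Collect_eq is_arg_min_def)
  fix x assume x: "P x \<and> \<not> (\<exists>y. P y \<and> f y < f x)"
  obtain y where "y \<in> M" using assms(1) by blast
  with x assms(2) have "f x \<le> E" using not_less by blast
  with x assms(3) show "x \<in> M" by blast
next
  fix x assume "x \<in> M"
  with assms show "P x \<and> \<not> (\<exists>y. P y \<and> f y < f x)"
    by (metis less_imp_le less_irrefl)
qed

section \<open>Jacobi functions at real arguments\<close>

text \<open>
  Only real arguments occur. Every identity is derived from the amplitude, the inverse of
  \<open>elliptic_F k\<close>, and its derivative \<open>dn\<close>.
\<close>

locale jacobi =
  fixes k :: real
  assumes k_pos: "0 < k" and k_less_1: "k < 1"
begin

abbreviation "F \<equiv> elliptic_F k"
abbreviation "K \<equiv> elliptic_K k"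
abbreviation "am u \<equiv> jacobi_am u k"
abbreviation "sn u \<equiv> jacobi_sn u k"
abbreviation "cn u \<equiv> jacobi_cn u k"
abbreviation "dn u \<equiv> jacobi_dn u k"

lemma k_sin_less_1: "(k * sin x)\<^sup>2 < 1" "k\<^sup>2 * (sin x)\<^sup>2 < 1"
proof -
  have "k\<^sup>2 < 1" using k_pos k_less_1 by (simp add: power_less_one_iff abs_square_less_1)
  have "k\<^sup>2 * (sin x)\<^sup>2 \<le> k\<^sup>2 * 1"
    by (intro mult_left_mono) (auto simp: abs_square_le_1)
  with \<open>k\<^sup>2 < 1\<close> show "k\<^sup>2 * (sin x)\<^sup>2 < 1" by simp
  then show "(k * sin x)\<^sup>2 < 1" by (simp add: power_mult_distrib)
qed

lemma F_has_derivative: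
  "(F has_real_derivative 1 / sqrt (1 - k\<^sup>2 * (sin x)\<^sup>2)) (at x)"
proof -
  define w where "w = (\<lambda>\<theta>. 1 / sqrt (1 - k\<^sup>2 * (sin \<theta>)\<^sup>2))"
  define R where "R = \<bar>x\<bar> + 1"
  define I where "I = (\<lambda>y. integral {-R..y} w)"
  have cont: "continuous_on A w" for A
    unfolding w_def using k_sin_less_1(2) by (intro continuous_intros) (auto simp: less_le)
  have int: "w integrable_on {a..b}" for a b
    using cont by (rule integrable_continuous_real)
  have F_eq: "F y = I y - I 0" if "y \<in> {-R<..<R}" for y
  proof (cases "0 \<le> y")
    case True
    have "integral {-R..0} w + integral {0..y} w = integral {-R..y} w"
      using True that int by (intro Henstock_Kurzweil_Integration.integral_combine) (auto simp: R_def)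
    with True show ?thesis by (simp add: elliptic_F_def I_def w_def)
  next
    case False
    have "integral {-R..y} w + integral {y..0} w = integral {-R..0} w"
      using False that int by (intro Henstock_Kurzweil_Integration.integral_combine) auto
    with False show ?thesis by (simp add: elliptic_F_def I_def w_def)
  qed
  have xR: "x \<in> {-R<..<R}" by (auto simp: R_def)
  have "(I has_real_derivative w x) (at x within {-R..R})"
    unfolding I_def using xR cont by (intro integral_has_real_derivative) auto
  then have "(I has_real_derivative w x) (at x within {-R<..<R})"
    by (rule DERIV_subset) auto
  then have "(I has_real_derivative w x) (at x)"
    by (simp only: at_within_open[OF xR open_greaterThanLessThan])
  then have "((\<lambda>y. I y - I 0) has_real_derivative w x) (at x)"
    by (auto intro!: derivative_eq_intros)
  then have "(F has_real_derivative w x) (at x)"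
    by (rule has_field_derivative_transform_within_open[OF _ open_greaterThanLessThan xR])
       (simp add: F_eq)
  then show ?thesis by (simp add: w_def)
qed

lemmas F_chain [derivative_intros] = F_has_derivative [THEN DERIV_chain2]

lemma F_strict_mono: "strict_mono F"
proof (rule strict_monoI)
  fix x y :: real assume "x < y"
  then show "F x < F y"
    by (rule DERIV_pos_imp_increasing)
      (meson F_has_derivative k_sin_less_1(2) diff_gt_0_iff_gt real_sqrt_gt_zero zero_less_divide_1_iff)
qed

lemma F_0 [simp]: "F 0 = 0"
  by (simp add: elliptic_F_def)

lemma F_pi_half: "F (pi / 2) = K"
  by (simp add: elliptic_F_def elliptic_K_def)

lemma F_minus: "F (- x) = - F x"
proof -
  have "((\<lambda>x. F (- x) + F x) has_real_derivative 0) (at x)" for x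
    by (auto intro!: derivative_eq_intros)
  then have "F (- x) + F x = F (- 0) + F 0"
    by (intro DERIV_isconst_all) auto
  then show ?thesis by simp
qed

lemma F_plus_pi: "F (x + pi) = F x + 2 * K"
proof -
  have "((\<lambda>x. F (x + pi) - F x) has_real_derivative 0) (at x)" for x
    by (auto intro!: derivative_eq_intros)
  then have "F (x + pi) - F x = F (- (pi / 2) + pi) - F (- (pi / 2))"
    by (intro DERIV_isconst_all) auto
  then show ?thesis by (simp add: F_minus F_pi_half)
qed

lemma isCont_F: "isCont F x"
  using F_has_derivative DERIV_isCont by blast

text \<open>
  The integrand is at least one. Together with oddness this makes \<open>F\<close> unbounded in both
  directions.
\<close>

lemma F_ge: assumes "0 \<le> x" shows "x \<le> F x"
proof -
  have "F 0 - 0 \<le> F x - x"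
  proof (rule DERIV_nonneg_imp_nondecreasing[OF assms])
    fix y
    have "1 \<le> 1 / sqrt (1 - k\<^sup>2 * (sin y)\<^sup>2)"
      using k_sin_less_1(2)[of y] by (simp add: le_divide_eq)
    then show "\<exists>d. ((\<lambda>x. F x - x) has_real_derivative d) (at y) \<and> 0 \<le> d"
      by (intro exI[of _ "1 / sqrt (1 - k\<^sup>2 * (sin y)\<^sup>2) - 1"]) (auto intro!: derivative_eq_intros)
  qed
  then show ?thesis by simp
qed

lemma F_surj: "\<exists>x. F x = u"
proof -
  have "\<exists>x\<ge>- \<bar>u\<bar>. x \<le> \<bar>u\<bar> \<and> F x = u"
    using F_ge[of "\<bar>u\<bar>"] F_minus[of "\<bar>u\<bar>"] isCont_F by (intro IVT) auto
  then show ?thesis by blast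
qed

lemma F_am [simp]: "F (am u) = u" and am_F [simp]: "am (F x) = x"
proof -
  have uniq: "x = y" if "F x = F y" for x y
    using F_strict_mono that by (simp add: strict_mono_eq)
  have "\<exists>!x. F x = v" for v
    using F_surj[of v] uniq by blast
  then show *: "F (am u) = u" for u
    unfolding jacobi_am_def by (rule theI')
  show "am (F x) = x"
    by (rule uniq) (rule *)
qed

lemma K_pos: "0 < K"
  using strict_monoD[OF F_strict_mono, of 0 "pi / 2"] by (simp add: F_pi_half)

lemma am_strict_mono: "strict_mono am"
proof (rule strict_monoI)
  fix u v :: real assume "u < v"
  then show "am u < am v" using strict_mono_less[OF F_strict_mono, of "am u" "am v"] by simp
qed

lemma am_0 [simp]: "am 0 = 0" and am_K: "am K = pi / 2"
  and am_minus [simp]: "am (- u) = - am u" and am_plus_2K: "am (u + 2 * K) = am u + pi"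
  using am_F[of 0] am_F[of "pi / 2"] am_F[of "- am u"] am_F[of "am u + pi"]
  by (simp_all add: F_pi_half F_minus F_plus_pi)

lemma dn_pos: "0 < dn u"
  using k_sin_less_1(2) by (simp add: jacobi_dn_def jacobi_sn_def)

lemma sn_cn_square: "(sn u)\<^sup>2 + (cn u)\<^sup>2 = 1"
  by (simp add: jacobi_sn_def jacobi_cn_def)

lemma cn_square: "(cn u)\<^sup>2 = 1 - (sn u)\<^sup>2"
  using sn_cn_square[of u] by simp

lemma dn_square: "(dn u)\<^sup>2 = 1 - k\<^sup>2 * (sn u)\<^sup>2"
  using k_sin_less_1(2)[of "am u"] by (simp add: jacobi_dn_def jacobi_sn_def)

lemma am_has_derivative: "(am has_real_derivative dn u) (at u)"
proof -
  have "isCont am (F (am u))"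
    by (rule isCont_inverse_function[where d = 1]) (auto simp: isCont_F)
  then have "(am has_real_derivative inverse (1 / sqrt (1 - k\<^sup>2 * (sin (am u))\<^sup>2))) (at u)"
    using k_sin_less_1(2)[of "am u"]
    by (intro DERIV_inverse_function[where f = F and a = "u - 1" and b = "u + 1"])
       (auto intro!: F_has_derivative)
  then show ?thesis by (simp add: jacobi_dn_def jacobi_sn_def)
qed

lemmas am_chain [derivative_intros] = am_has_derivative [THEN DERIV_chain2]

lemma sn_has_derivative: "((\<lambda>u. sn u) has_real_derivative cn u * dn u) (at u)"
  unfolding jacobi_sn_def jacobi_cn_def by (auto intro!: derivative_eq_intros)

lemma cn_has_derivative: "((\<lambda>u. cn u) has_real_derivative - sn u * dn u) (at u)"
  unfolding jacobi_sn_def jacobi_cn_def by (auto intro!: derivative_eq_intros)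

lemmas sn_chain [derivative_intros] = sn_has_derivative [THEN DERIV_chain2]

lemma dn_has_derivative: "((\<lambda>u. dn u) has_real_derivative - k\<^sup>2 * sn u * cn u) (at u)"
proof -
  have "((\<lambda>u. sqrt (1 - k\<^sup>2 * (sn u)\<^sup>2)) has_real_derivative - k\<^sup>2 * sn u * cn u) (at u)"
    using dn_pos[of u] unfolding jacobi_dn_def
    by (auto intro!: derivative_eq_intros simp: field_simps jacobi_dn_def)
  then show ?thesis by (simp add: jacobi_dn_def)
qed

lemmas cn_chain [derivative_intros] = cn_has_derivative [THEN DERIV_chain2]
lemmas dn_chain [derivative_intros] = dn_has_derivative [THEN DERIV_chain2]

lemma sn_0 [simp]: "sn 0 = 0" and cn_0 [simp]: "cn 0 = 1" and dn_0 [simp]: "dn 0 = 1"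
  by (simp_all add: jacobi_sn_def jacobi_cn_def jacobi_dn_def)

lemma sn_K: "sn K = 1" and cn_K: "cn K = 0"
  by (simp_all add: jacobi_sn_def jacobi_cn_def am_K)

lemma sn_minus [simp]: "sn (- u) = - sn u" and cn_minus [simp]: "cn (- u) = cn u"
  and dn_minus [simp]: "dn (- u) = dn u"
  by (simp_all add: jacobi_sn_def jacobi_cn_def jacobi_dn_def)

lemma sn_plus_2K: "sn (u + 2 * K) = - sn u"
  by (simp add: jacobi_sn_def am_plus_2K)

lemma addition_denominator_pos: "0 < 1 - k\<^sup>2 * (sn x)\<^sup>2 * (sn y)\<^sup>2"
proof -
  have "k\<^sup>2 * (sn x)\<^sup>2 * (sn y)\<^sup>2 \<le> k\<^sup>2 * (sn x)\<^sup>2 * 1"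
    by (intro mult_left_mono) (auto simp: jacobi_sn_def abs_square_le_1)
  also have "\<dots> < 1"
    using k_sin_less_1(2)[of "am x"] by (simp add: jacobi_sn_def)
  finally show ?thesis by simp
qed

text \<open>
  Euler's device for the addition theorems: along \<open>t + (x + y - t) = x + y\<close> the candidate
  quotient \<open>N / D\<close> is constant, and at \<open>t = 0\<close> the denominator is one. The last assumption is
  \<open>N' * D = N * D'\<close> with the derivative of \<open>D\<close> written out.
\<close>

lemma addition_constant:
  fixes N N' :: "real \<Rightarrow> real" and x y :: real
  defines "D \<equiv> \<lambda>t. 1 - k\<^sup>2 * (sn t)\<^sup>2 * (sn (x + y - t))\<^sup>2"
  assumes "\<And>t. (N has_real_derivative N' t) (at t)"
  assumes "\<And>t. N' t * D t =
    N t * (- 2 * k\<^sup>2 * sn t * sn (x + y - t) *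
      (cn t * dn t * sn (x + y - t) - sn t * cn (x + y - t) * dn (x + y - t)))"
  shows "N 0 = N x / D x"
proof -
  have D_pos: "D t > 0" for t
    unfolding D_def by (rule addition_denominator_pos)
  have D': "(D has_real_derivative - 2 * k\<^sup>2 * sn t * sn (x + y - t) *
      (cn t * dn t * sn (x + y - t) - sn t * cn (x + y - t) * dn (x + y - t))) (at t)" for t
    unfolding D_def
    by (auto intro!: derivative_eq_intros simp: algebra_simps power2_eq_square)
  have "((\<lambda>t. N t / D t) has_real_derivative 0) (at t)" for t
    using D_pos[of t] assms(3)[of t]
    by (auto intro!: derivative_eq_intros assms(2) D')
  then have "N x / D x = N 0 / D 0"
    by (intro DERIV_isconst_all) auto
  then show ?thesis by (simp add: D_def)
qed

lemma sn_add:
  "sn (x + y) = (sn x * cn y * dn y + sn y * cn x * dn x) / (1 - k\<^sup>2 * (sn x)\<^sup>2 * (sn y)\<^sup>2)"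
proof -
  \<comment> \<open>Both are polynomial identities modulo the quadratic relations between the three functions.\<close>
  have alg: "2 * k2 * s1 * s2 * (s1\<^sup>2 - s2\<^sup>2) * (1 - k2 * s1\<^sup>2 * s2\<^sup>2)
      = (s1 * c2 * d2 + s2 * c1 * d1) * (- 2 * k2 * s1 * s2 * (c1 * d1 * s2 - s1 * c2 * d2))"
    if "c1\<^sup>2 = 1 - s1\<^sup>2" "c2\<^sup>2 = 1 - s2\<^sup>2" "d1\<^sup>2 = 1 - k2 * s1\<^sup>2" "d2\<^sup>2 = 1 - k2 * s2\<^sup>2"
    for k2 s1 s2 c1 c2 d1 d2 :: real
    using that by algebra
  have alg': "s1 * (s2 * d2 * d2) + s1 * (c2 * (k2 * s2 * c2)) - s2 * (s1 * d1 * d1) - s2 * (c1 * (k2 * s1 * c1))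
      = 2 * k2 * s1 * s2 * (s1\<^sup>2 - s2\<^sup>2)"
    if "c1\<^sup>2 = 1 - s1\<^sup>2" "c2\<^sup>2 = 1 - s2\<^sup>2" "d1\<^sup>2 = 1 - k2 * s1\<^sup>2" "d2\<^sup>2 = 1 - k2 * s2\<^sup>2"
    for k2 s1 s2 c1 c2 d1 d2 :: real
    using that by algebra
  let ?N = "\<lambda>t. sn t * cn (x + y - t) * dn (x + y - t) + sn (x + y - t) * cn t * dn t"
  have "(?N has_real_derivative
      2 * k\<^sup>2 * sn t * sn (x + y - t) * ((sn t)\<^sup>2 - (sn (x + y - t))\<^sup>2)) (at t)" for t
    unfolding alg'[OF cn_square cn_square dn_square dn_square, symmetric]
    by (auto intro!: derivative_eq_intros simp: algebra_simps)
  from addition_constant[OF this alg[OF cn_square cn_square dn_square dn_square]]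
  show ?thesis by simp
qed

lemma cn_add:
  "cn (x + y) = (cn x * cn y - sn x * sn y * dn x * dn y) / (1 - k\<^sup>2 * (sn x)\<^sup>2 * (sn y)\<^sup>2)"
proof -
  have alg: "(- (s1 * d1 * c2) + c1 * s2 * d2 - c1 * d1 * s2 * d1 * d2 + s1 * c2 * d2 * d1 * d2
        + s1 * s2 * k2 * s1 * c1 * d2 - s1 * s2 * d1 * k2 * s2 * c2) * (1 - k2 * s1\<^sup>2 * s2\<^sup>2)
      = (c1 * c2 - s1 * s2 * d1 * d2) * (- 2 * k2 * s1 * s2 * (c1 * d1 * s2 - s1 * c2 * d2))"
    if "c1\<^sup>2 = 1 - s1\<^sup>2" "c2\<^sup>2 = 1 - s2\<^sup>2" "d1\<^sup>2 = 1 - k2 * s1\<^sup>2" "d2\<^sup>2 = 1 - k2 * s2\<^sup>2"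
    for k2 s1 s2 c1 c2 d1 d2 :: real
    using that by algebra
  let ?N = "\<lambda>t. cn t * cn (x + y - t) - sn t * sn (x + y - t) * dn t * dn (x + y - t)"
  have "(?N has_real_derivative
      (- (sn t * dn t * cn (x + y - t)) + cn t * sn (x + y - t) * dn (x + y - t)
       - cn t * dn t * sn (x + y - t) * dn t * dn (x + y - t)
       + sn t * cn (x + y - t) * dn (x + y - t) * dn t * dn (x + y - t)
       + sn t * sn (x + y - t) * k\<^sup>2 * sn t * cn t * dn (x + y - t)
       - sn t * sn (x + y - t) * dn t * k\<^sup>2 * sn (x + y - t) * cn (x + y - t))) (at t)" for t
    by (auto intro!: derivative_eq_intros simp: algebra_simps)
  from addition_constant[OF this alg[OF cn_square cn_square dn_square dn_square]]
  show ?thesis by simp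
qed

lemma dn_add:
  "dn (x + y) = (dn x * dn y - k\<^sup>2 * sn x * sn y * cn x * cn y) / (1 - k\<^sup>2 * (sn x)\<^sup>2 * (sn y)\<^sup>2)"
proof -
  have alg: "(- (k2 * s1 * c1 * d2) + d1 * k2 * s2 * c2 - k2 * c1 * d1 * s2 * c1 * c2 + k2 * s1 * c2 * d2 * c1 * c2
        + k2 * s1 * s2 * s1 * d1 * c2 - k2 * s1 * s2 * c1 * s2 * d2) * (1 - k2 * s1\<^sup>2 * s2\<^sup>2)
      = (d1 * d2 - k2 * s1 * s2 * c1 * c2) * (- 2 * k2 * s1 * s2 * (c1 * d1 * s2 - s1 * c2 * d2))"
    if "c1\<^sup>2 = 1 - s1\<^sup>2" "c2\<^sup>2 = 1 - s2\<^sup>2" "d1\<^sup>2 = 1 - k2 * s1\<^sup>2" "d2\<^sup>2 = 1 - k2 * s2\<^sup>2"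
    for k2 s1 s2 c1 c2 d1 d2 :: real
    using that by algebra
  let ?N = "\<lambda>t. dn t * dn (x + y - t) - k\<^sup>2 * sn t * sn (x + y - t) * cn t * cn (x + y - t)"
  have "(?N has_real_derivative
      (- (k\<^sup>2 * sn t * cn t * dn (x + y - t)) + dn t * k\<^sup>2 * sn (x + y - t) * cn (x + y - t)
       - k\<^sup>2 * cn t * dn t * sn (x + y - t) * cn t * cn (x + y - t)
       + k\<^sup>2 * sn t * cn (x + y - t) * dn (x + y - t) * cn t * cn (x + y - t)
       + k\<^sup>2 * sn t * sn (x + y - t) * sn t * dn t * cn (x + y - t)
       - k\<^sup>2 * sn t * sn (x + y - t) * cn t * sn (x + y - t) * dn (x + y - t))) (at t)" for t
    by (auto intro!: derivative_eq_intros simp: algebra_simps)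
  from addition_constant[OF this alg[OF cn_square cn_square dn_square dn_square]]
  show ?thesis by simp
qed

end

section \<open>The phase of a Blaschke factor\<close>

text \<open>
  Together with the denominator below this is the factor \<open>(z - \<i> b) / (1 + \<i> b z)\<close> with
  \<open>b = tan (\<phi> / 2)\<close>, cleared of the tangent. In this form \<open>b = \<infinity>\<close> is the regular case
  \<open>\<phi> = pi\<close>, with value \<open>-1 / z\<close>.
\<close>

definition blaschke_num :: "real \<Rightarrow> complex \<Rightarrow> complex" where
  "blaschke_num \<phi> z = of_real (cos (\<phi> / 2)) * z - \<i> * of_real (sin (\<phi> / 2))"

definition blaschke_den :: "real \<Rightarrow> complex \<Rightarrow> complex" where
  "blaschke_den \<phi> z = of_real (cos (\<phi> / 2)) + \<i> * of_real (sin (\<phi> / 2)) * z"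

lemma blaschke_num_cis: "blaschke_num \<phi> (cis \<theta>) = cis \<theta> * cnj (blaschke_den \<phi> (cis \<theta>))"
proof -
  have "cis \<theta> * cis (- \<theta>) = 1" by (simp add: cis_mult)
  then show ?thesis
    by (simp add: blaschke_num_def blaschke_den_def cis_cnj algebra_simps)
qed

lemma norm_blaschke_den: "(cmod (blaschke_den \<phi> (cis \<theta>)))\<^sup>2 = 1 - sin \<phi> * sin \<theta>"
proof -
  have 1: "sin \<phi> = 2 * sin (\<phi> / 2) * cos (\<phi> / 2)"
    using sin_double[of "\<phi> / 2"] by simp
  have 2: "(c - s * x)\<^sup>2 + (s * y)\<^sup>2 = 1 - 2 * s * c * x"
    if "s\<^sup>2 + c\<^sup>2 = 1" "x\<^sup>2 + y\<^sup>2 = 1" for s c x y :: real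
    using that by algebra
  have "blaschke_den \<phi> (cis \<theta>) =
      Complex (cos (\<phi> / 2) - sin (\<phi> / 2) * sin \<theta>) (sin (\<phi> / 2) * cos \<theta>)"
    by (simp add: blaschke_den_def complex_eq_iff)
  then show ?thesis
    unfolding cmod_power2 1
    using 2[of "sin (\<phi> / 2)" "cos (\<phi> / 2)" "sin \<theta>" "cos \<theta>"] by simp
qed

lemma blaschke_factor_derivative:
  assumes "blaschke_den \<phi> z \<noteq> 0"
  shows "((\<lambda>z. blaschke_num \<phi> z / blaschke_den \<phi> z) has_field_derivative
    of_real (cos \<phi>) / (blaschke_den \<phi> z)\<^sup>2) (at z)"
proof -
  define c s :: complex where "c = of_real (cos (\<phi> / 2))" and "s = of_real (sin (\<phi> / 2))"
  have num: "(blaschke_num \<phi> has_field_derivative c) (at z)"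
    unfolding blaschke_num_def [abs_def] c_def by (auto intro!: derivative_eq_intros)
  have den: "(blaschke_den \<phi> has_field_derivative \<i> * s) (at z)"
    unfolding blaschke_den_def [abs_def] s_def by (auto intro!: derivative_eq_intros)
  have "c * (c + \<i> * s * z) - \<i> * s * (c * z - \<i> * s) = c * c + (\<i> * \<i>) * (s * s)"
    by (simp only: ring_distribs mult_ac) simp
  also have "\<dots> = of_real (cos \<phi>)"
    using cos_double[of "\<phi> / 2"] by (simp add: c_def s_def power2_eq_square)
  finally have "c * blaschke_den \<phi> z - \<i> * s * blaschke_num \<phi> z = of_real (cos \<phi>)"
    by (simp add: blaschke_num_def blaschke_den_def c_def s_def)
  with DERIV_quotient[OF num den assms] show ?thesis by (simp add: numeral_2_eq_2)
qed

context jacobi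
begin

text \<open>
  The curve \<open>cis (angle u) = dn u + \<i> k sn u\<close> runs along the right arc; it covers the arc once
  while \<open>u\<close> runs through \<open>[-K, K]\<close> and turns back at the ends, with period \<open>4 K\<close>.
\<close>

definition angle :: "real \<Rightarrow> real" where "angle u = arcsin (k * sn u)"

lemma abs_k_sn: "\<bar>k * sn u\<bar> < 1"
  using k_sin_less_1(1)[of "am u"] by (simp add: jacobi_sn_def abs_square_less_1)

lemma sin_angle [simp]: "sin (angle u) = k * sn u"
  using abs_k_sn[of u] by (simp add: angle_def)

lemma angle_has_derivative: "(angle has_real_derivative k * cn u) (at u)"
proof -
  have "((\<lambda>u. arcsin (k * sn u)) has_real_derivative
      inverse (sqrt (1 - (k * sn u)\<^sup>2)) * (k * (cn u * dn u))) (at u)"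
    using abs_k_sn[of u]
    by (intro DERIV_chain2[of arcsin] DERIV_arcsin DERIV_cmult sn_has_derivative) auto
  moreover have "sqrt (1 - (k * sn u)\<^sup>2) = dn u"
    by (simp add: jacobi_dn_def power_mult_distrib)
  ultimately show ?thesis
    using dn_pos[of u] by (simp add: angle_def [abs_def] field_simps)
qed

lemmas angle_chain [derivative_intros] = angle_has_derivative [THEN DERIV_chain2]

lemma angle_0 [simp]: "angle 0 = 0" and angle_minus [simp]: "angle (- u) = - angle u"
  and angle_plus_2K: "angle (u + 2 * K) = - angle u"
  using abs_k_sn[of u] by (simp_all add: angle_def sn_plus_2K arcsin_minus)

text \<open>
  A primitive of \<open>(dn + k cn) / 2\<close>. The derivative is positive because
  \<open>dn\<^sup>2 - k\<^sup>2 cn\<^sup>2 = 1 - k\<^sup>2\<close>.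
\<close>

definition Psi :: "real \<Rightarrow> real" where "Psi u = (am u + angle u) / 2"

lemma Psi_has_derivative: "(Psi has_real_derivative (dn u + k * cn u) / 2) (at u)"
  unfolding Psi_def [abs_def] by (auto intro!: derivative_eq_intros)

lemmas Psi_chain [derivative_intros] = Psi_has_derivative [THEN DERIV_chain2]

lemma Psi_strict_mono: "strict_mono Psi"
proof (rule strict_monoI)
  fix x y :: real assume "x < y"
  then show "Psi x < Psi y"
  proof (rule DERIV_pos_imp_increasing)
    fix u
    have "(k * cn u)\<^sup>2 < (dn u)\<^sup>2"
      using k_pos k_less_1 abs_square_less_1[of k]
      by (simp add: power_mult_distrib cn_square dn_square algebra_simps)
    then have "\<bar>k * cn u\<bar> < dn u"
      using dn_pos[of u] by (metis abs_of_pos power2_abs power_less_imp_less_base less_imp_le)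
    then have "0 < (dn u + k * cn u) / 2" by (simp add: abs_less_iff)
    with Psi_has_derivative show "\<exists>d. (Psi has_real_derivative d) (at u) \<and> 0 < d" by blast
  qed
qed

lemma Psi_plus_4K: "Psi (u + 4 * K) = Psi u + pi"
proof -
  have "Psi (u + 2 * K + 2 * K) = Psi u + pi"
    unfolding Psi_def am_plus_2K angle_plus_2K by simp
  moreover have "u + 2 * K + 2 * K = u + 4 * K" by simp
  ultimately show ?thesis by simp
qed

text \<open>
  The right-hand side is the phase velocity of the Blaschke factor with \<open>\<phi> = am s\<close> along the
  right arc. The point is that it separates into a function of \<open>t - s\<close> and a function of
  \<open>t + s\<close>.
\<close>

lemma dn_cn_product:
  "(dn (t - s) + k * cn (t - s)) / 2 - (dn (t + s) - k * cn (t + s)) / 2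
    = k * cn t * cn s / (1 - k * sn t * sn s)"
proof -
  define D where "D = 1 - k\<^sup>2 * (sn t)\<^sup>2 * (sn s)\<^sup>2"
  have D: "D > 0" "D = (1 - k * sn t * sn s) * (1 + k * sn t * sn s)"
    using addition_denominator_pos[of t s] by (auto simp: D_def algebra_simps power2_eq_square)
  then have nz: "1 - k * sn t * sn s \<noteq> 0" "1 + k * sn t * sn s \<noteq> 0" by auto
  have 1: "cn (t - s) = (cn t * cn s + sn t * sn s * dn t * dn s) / D"
    using cn_add[of t "- s"] by (simp add: D_def)
  have 2: "dn (t - s) = (dn t * dn s + k\<^sup>2 * sn t * sn s * cn t * cn s) / D"
    using dn_add[of t "- s"] by (simp add: D_def)
  have "(dn (t - s) + k * cn (t - s)) / 2 - (dn (t + s) - k * cn (t + s)) / 2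
      = k * cn t * cn s * (1 + k * sn t * sn s) / D"
    unfolding 1 2 cn_add dn_add D_def [symmetric] using D(1)
    by (simp add: field_simps power2_eq_square)
  also have "\<dots> = k * cn t * cn s / (1 - k * sn t * sn s)"
    unfolding D(2) using nz by simp
  finally show ?thesis .
qed

lemma blaschke_den_angle_nonzero: "blaschke_den \<phi> (cis (angle t)) \<noteq> 0"
proof -
  have "\<bar>sin \<phi> * (k * sn t)\<bar> \<le> 1 * \<bar>k * sn t\<bar>"
    unfolding abs_mult[of "sin \<phi>"] by (intro mult_right_mono) auto
  with abs_k_sn[of t] have "(cmod (blaschke_den \<phi> (cis (angle t))))\<^sup>2 > 0"
    unfolding norm_blaschke_den by auto
  then show ?thesis by auto
qed

text \<open>
  Both sides are unimodular with the same phase velocity, by \<open>dn_cn_product\<close>, and they agree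
  at \<open>t = 0\<close>. The shift by \<open>2 K\<close> turns the primitive \<open>(am - angle) / 2\<close> of \<open>(dn - k cn) / 2\<close>
  into \<open>Psi\<close>, at the cost of the constant phase \<open>-\<i>\<close>.
\<close>

lemma blaschke_factor_phase:
  "blaschke_num (am s) (cis (angle t)) / blaschke_den (am s) (cis (angle t))
     = - \<i> * cis (Psi (t - s)) / cis (Psi (t + s - 2 * K))"
proof -
  define Xi where "Xi = (\<lambda>t. (am (t - s) - am (t + s) + angle (t - s) + angle (t + s)) / 2)"
  define B where "B = (\<lambda>z. blaschke_num (am s) z / blaschke_den (am s) z)"
  have Xi': "(Xi has_real_derivative k * cn t * cn s / (1 - k * sn t * sn s)) (at t)" for t
    unfolding dn_cn_product [symmetric] Xi_def
    by (auto intro!: derivative_eq_intros simp: field_simps)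
  have "((\<lambda>t. cis (- Xi t) * B (cis (angle t))) has_vector_derivative 0) (at t)" for t
  proof -
    define H where "H = k * cn t * cn s / (1 - k * sn t * sn s)"
    define z where "z = cis (angle t)"
    define d where "d = blaschke_den (am s) z"
    have d: "d \<noteq> 0" using blaschke_den_angle_nonzero by (simp add: d_def z_def)
    have 1: "((\<lambda>t. cis (angle t)) has_vector_derivative of_real (k * cn t) * (\<i> * z)) (at t)"
      using has_derivative_cis[OF angle_has_derivative[of t, unfolded has_field_derivative_def]]
      by (simp add: has_vector_derivative_def z_def scaleR_conv_of_real mult_ac)
    have 2: "((B \<circ> (\<lambda>t. cis (angle t))) has_vector_derivative
        of_real (k * cn t) * (\<i> * z) * (of_real (cos (am s)) / d\<^sup>2)) (at t)"
      unfolding B_def d_def z_def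
      by (rule field_vector_diff_chain_at[OF 1[unfolded z_def] blaschke_factor_derivative])
         (rule blaschke_den_angle_nonzero)
    have 3: "((\<lambda>t. cis (- Xi t)) has_vector_derivative of_real (- H) * (\<i> * cis (- Xi t))) (at t)"
      using has_derivative_cis[OF DERIV_minus[OF Xi'[of t], unfolded has_field_derivative_def]]
      by (simp add: has_vector_derivative_def scaleR_conv_of_real mult_ac H_def)
    \<comment> \<open>Since the numerator is \<open>z * cnj d\<close>, the logarithmic derivative of the factor has the real denominator \<open>d * cnj d\<close>.\<close>
    have num: "blaschke_num (am s) z = z * cnj d"
      by (simp add: z_def d_def blaschke_num_cis)
    have "d * cnj d = of_real (1 - k * sn t * sn s)"
      using norm_blaschke_den[of "am s" "angle t"]
      by (simp add: d_def z_def jacobi_sn_def mult_ac flip: complex_norm_square of_real_power)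
    moreover have "1 - k * sn t * sn s \<noteq> 0"
      using calculation d by (metis complex_cnj_zero_iff mult_eq_0_iff of_real_0)
    ultimately have H: "of_real H * (d * cnj d) = of_real (k * cn t * cos (am s))"
      by (simp add: H_def jacobi_cn_def flip: of_real_mult)
    have Bz: "B z = z * cnj d / d" by (simp add: B_def num d_def)
    have "cis (- Xi t) * (of_real (k * cn t) * (\<i> * z) * (of_real (cos (am s)) / d\<^sup>2))
        = \<i> * cis (- Xi t) * z * of_real (k * cn t * cos (am s)) / d\<^sup>2"
      by simp
    also have "\<dots> = of_real H * (\<i> * cis (- Xi t)) * B z"
      unfolding H [symmetric] Bz using d by (simp add: power2_eq_square)
    finally have "cis (- Xi t) * (of_real (k * cn t) * (\<i> * z) * (of_real (cos (am s)) / d\<^sup>2))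
        + of_real (- H) * (\<i> * cis (- Xi t)) * B (cis (angle t)) = 0"
      by (simp add: z_def)
    with has_vector_derivative_mult[OF 3 2] show ?thesis
      by (simp add: o_def)
  qed
  then obtain c where c: "\<And>t. cis (- Xi t) * B (cis (angle t)) = c"
    using has_vector_derivative_zero_constant[of UNIV "\<lambda>t. cis (- Xi t) * B (cis (angle t))"]
    by auto
  have "blaschke_num (am s) 1 = cis (- (am s / 2))" "blaschke_den (am s) 1 = cis (am s / 2)"
    by (simp_all add: blaschke_num_def blaschke_den_def complex_eq_iff)
  then have "B 1 = cis (- am s)" by (simp add: B_def cis_divide)
  then have "c = 1"
    using c[of 0] by (simp add: Xi_def cis_mult)
  with c[of t] have "cis (Xi t) * (cis (- Xi t) * B (cis (angle t))) = cis (Xi t)" by simp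
  then have "B (cis (angle t)) = cis (Xi t)"
    by (simp add: cis_mult flip: mult.assoc)
  moreover have "Psi (t + s - 2 * K) = (am (t + s) - angle (t + s)) / 2 - pi / 2"
    using am_plus_2K[of "t + s - 2 * K"] angle_plus_2K[of "t + s - 2 * K"]
    by (simp add: Psi_def field_simps)
  then have "Xi t = - (pi / 2) + Psi (t - s) - Psi (t + s - 2 * K)"
    by (simp add: Xi_def Psi_def field_simps)
  then have "cis (Xi t) = cis (- (pi / 2)) * cis (Psi (t - s)) / cis (Psi (t + s - 2 * K))"
    by (simp only: cis_mult cis_divide)
  ultimately show ?thesis
    by (simp add: B_def)
qed

end

section \<open>Equioscillation of the Blaschke product\<close>

lemma sum_alternating_telescope:
  fixes f :: "nat \<Rightarrow> real"
  shows "(\<Sum>l=1..n. f (2 * l - 1) - f (2 * l)) + (\<Sum>l=1..n. f (2 * l) - f (2 * l + 1)) = f 1 - f (2 * n + 1)"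
    and "(\<Sum>l=1..n. f (2 * l - 2) - f (2 * l - 1)) + (\<Sum>l=1..n. f (2 * l - 1) - f (2 * l)) = f 0 - f (2 * n)"
  by (induction n) (simp_all add: algebra_simps)

text \<open>
  The points \<open>\<sigma>\<close> and \<open>2 K - \<sigma>\<close> of the \<open>j\<close>-th factor lie, modulo \<open>4 K\<close>, on a grid with \<open>2 m\<close>
  points numbered from \<open>1\<close> to \<open>2 m\<close>. One of them has an even number, which is
  \<open>even_label m j\<close>; the other has the number \<open>2 m + 1 - even_label m j\<close>. Every even number
  occurs for exactly one factor.
\<close>

definition even_label :: "nat \<Rightarrow> nat \<Rightarrow> nat" where
  "even_label m j = (if even j then j else if even m then 2 * m + 1 - j else j + m)"

lemma bij_even_label: "bij_betw (\<lambda>j. even_label m j div 2) {1..m} {1..m}"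
proof -
  have inj: "inj_on (\<lambda>j. even_label m j div 2) {1..m}"
  proof (rule inj_onI)
    fix i j assume *: "i \<in> {1..m}" "j \<in> {1..m}" "even_label m i div 2 = even_label m j div 2"
    then have "even (even_label m i)" "even (even_label m j)"
      by (auto simp: even_label_def)
    then have "even_label m i = even_label m j"
      using *(3) by (metis dvd_div_mult_self)
    then show "i = j" using * by (auto simp: even_label_def split: if_splits)
  qed
  have "(\<lambda>j. even_label m j div 2) ` {1..m} \<subseteq> {1..m}"
    by (auto simp: even_label_def elim!: evenE oddE)
  with inj show ?thesis
    by (simp add: bij_betw_def endo_inj_surj)
qed

lemma even_label: "j \<in> {1..m} \<Longrightarrow> even (even_label m j)" "j \<in> {1..m} \<Longrightarrow> even_label m j \<le> 2 * m"
  unfolding even_label_def by (auto split: if_splits) 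

lemma prod_even_label:
  fixes G :: "nat \<Rightarrow> complex"
  shows "(\<Prod>j=1..m. G (even_label m j) / G (2 * m + 1 - even_label m j)) =
    (\<Prod>l=1..m. G (2 * l) / G (2 * l - 1))"
proof -
  have "(\<Prod>j=1..m. G (even_label m j) / G (2 * m + 1 - even_label m j)) =
      (\<Prod>j=1..m. (\<lambda>l. G (2 * l) / G (2 * m + 1 - 2 * l)) (even_label m j div 2))"
    using even_label(1) by (intro prod.cong) (auto simp: dvd_mult_div_cancel)
  also have "\<dots> = (\<Prod>l=1..m. G (2 * l) / G (2 * m + 1 - 2 * l))"
    by (rule prod.reindex_bij_betw) (rule bij_even_label)
  also have "(\<Prod>l=1..m. G (2 * l) / G (2 * m + 1 - 2 * l)) =
      (\<Prod>l=1..m. G (2 * l)) / (\<Prod>l=1..m. G (2 * m + 1 - 2 * l))"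
    by (rule prod_dividef)
  also have "(\<Prod>l=1..m. G (2 * m + 1 - 2 * l)) = (\<Prod>l=1..m. G (2 * l - 1))"
    by (subst (2) prod.atLeastAtMost_rev) (intro prod.cong arg_cong[of _ _ G]; auto)
  finally show ?thesis by (simp add: prod_dividef)
qed

context jacobi
begin

text \<open>
  The grid of mesh \<open>2 K / m\<close>: increasing \<open>i\<close> by \<open>2 m\<close> adds \<open>4 K\<close>.
\<close>

definition rho :: "nat \<Rightarrow> real \<Rightarrow> real" where
  "rho m i = (real m - 1 + 2 * i) * K / real m"

text \<open>
  The argument for which the tangent of half the amplitude is the \<open>j\<close>-th coefficient. The even
  factors have \<open>tan (am (rho m j) / 2)\<close> itself; for odd \<open>j\<close> the exponent \<open>-1\<close> and the sign
  \<open>(-1) ^ m\<close> turn \<open>\<phi>\<close> into \<open>pi - \<phi>\<close> or \<open>\<phi> + pi\<close>.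
\<close>

definition sigma :: "nat \<Rightarrow> nat \<Rightarrow> real" where
  "sigma m j = (if even j then rho m j else if even m then 2 * K - rho m j else rho m j + 2 * K)"

text \<open>
  The phase of the whole product on the right arc: an alternating sum over one full period of
  the grid, in which all signs fit because of \<open>even_label\<close>.
\<close>

definition phase_err :: "nat \<Rightarrow> real \<Rightarrow> real" where
  "phase_err m t = pi / 2 - (\<Sum>l\<in>{1..m}. Psi (t - rho m (2 * real l - 1)) - Psi (t - rho m (2 * real l)))"

lemma cis_Psi_plus_4K: "cis (Psi (u + 4 * K)) = - cis (Psi u)"
  unfolding Psi_plus_4K by (rule minus_cis [symmetric])

text \<open>
  In each of the three cases one of the two arguments of \<open>Psi\<close> differs from a grid point by
  \<open>4 K\<close>, which produces a sign; with \<open>-\<i>\<close> it makes \<open>\<i>\<close> in all cases.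
\<close>

lemma blaschke_factor_even_label:
  assumes "j \<in> {1..m}"
  shows "blaschke_num (am (sigma m j)) (cis (angle t)) / blaschke_den (am (sigma m j)) (cis (angle t)) =
    \<i> * (cis (Psi (t - rho m (even_label m j))) / cis (Psi (t - rho m (2 * m + 1 - even_label m j))))"
proof -
  define a where "a = even_label m j"
  have m: "m > 0" and j: "j \<le> m" using assms by auto
  have a_le: "a \<le> 2 * m" using even_label(2)[OF assms] by (simp add: a_def)
  consider (plain) "t - sigma m j = t - rho m a"
      "t + sigma m j - 2 * K = (t - rho m (real (2 * m + 1 - a))) + 4 * K"
    | (flip) "t - sigma m j = (t - rho m a) + 4 * K"
      "t + sigma m j - 2 * K = t - rho m (real (2 * m + 1 - a))"
  proof (cases "even j")
    case True
    then show ?thesis using plain m j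
      by (simp add: a_def even_label_def sigma_def rho_def field_simps of_nat_diff)
  next
    case False
    show ?thesis
    proof (cases "even m")
      case True
      with False show ?thesis using flip m j
        by (simp add: a_def even_label_def sigma_def rho_def field_simps of_nat_diff)
    next
      case False
      with \<open>odd j\<close> show ?thesis using plain m j
        by (simp add: a_def even_label_def sigma_def rho_def field_simps of_nat_diff)
    qed
  qed
  then show ?thesis
  proof cases
    case plain
    then show ?thesis
      unfolding blaschke_factor_phase plain cis_Psi_plus_4K a_def
      using a_le by (simp add: a_def of_nat_diff)
  next
    case flip
    then show ?thesis
      unfolding blaschke_factor_phase flip cis_Psi_plus_4K a_def
      using a_le by (simp add: a_def of_nat_diff)
  qed
qed

lemma blaschke_product_phase:
  "\<i> powi (1 - int m) * (\<Prod>j=1..m. blaschke_num (am (sigma m j)) (cis (angle t)) /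
      blaschke_den (am (sigma m j)) (cis (angle t))) = cis (phase_err m t)"
proof -
  define G where "G = (\<lambda>i::nat. cis (Psi (t - rho m i)))"
  have "(\<Prod>j=1..m. blaschke_num (am (sigma m j)) (cis (angle t)) / blaschke_den (am (sigma m j)) (cis (angle t)))
      = (\<Prod>j=1..m. \<i> * (G (even_label m j) / G (2 * m + 1 - even_label m j)))"
  proof (rule prod.cong)
    fix j assume j: "j \<in> {1..m}"
    have "real (2 * m + 1 - even_label m j) = 2 * real m + 1 - real (even_label m j)"
      using even_label(2)[OF j] by (simp add: of_nat_diff)
    then show "blaschke_num (am (sigma m j)) (cis (angle t)) / blaschke_den (am (sigma m j)) (cis (angle t))
        = \<i> * (G (even_label m j) / G (2 * m + 1 - even_label m j))"
      using blaschke_factor_even_label[OF j, of t] by (simp add: G_def)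
  qed simp
  also have "\<dots> = \<i> ^ m * (\<Prod>j=1..m. G (even_label m j) / G (2 * m + 1 - even_label m j))"
    by (subst prod.distrib) simp
  also have "\<dots> = \<i> ^ m * (\<Prod>l=1..m. G (2 * l) / G (2 * l - 1))"
    unfolding prod_even_label ..
  also have "(\<Prod>l=1..m. G (2 * l) / G (2 * l - 1)) =
      (\<Prod>l=1..m. cis (- (Psi (t - rho m (2 * real l - 1)) - Psi (t - rho m (2 * real l)))))"
    by (intro prod.cong) (auto simp: G_def cis_divide of_nat_diff)
  also have "\<dots> = cis (phase_err m t - pi / 2)"
    unfolding cis_sum [symmetric] sum_negf by (simp add: phase_err_def)
  finally show ?thesis
    by (simp add: cis_divide [symmetric] power_int_diff)
qed

lemma isCont_Psi: "isCont Psi u"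
  using Psi_has_derivative DERIV_isCont by blast

lemma continuous_on_err: "continuous_on A (phase_err m)"
proof -
  have "continuous_on UNIV Psi"
    by (simp add: continuous_on_eq_continuous_at isCont_Psi)
  then have "continuous_on A (\<lambda>t. Psi (t - c))" for c
    by (rule continuous_on_compose2) (auto intro: continuous_intros)
  then show ?thesis
    unfolding phase_err_def by (intro continuous_on_diff continuous_on_sum continuous_on_const)
qed

lemma Psi_minus_rho:
  assumes "m > 0"
  shows "Psi (t - rho m (i + 2 * real m)) = Psi (t - rho m i) - pi"
proof -
  have "t - rho m i = t - rho m (i + 2 * real m) + 4 * K"
    using assms by (simp add: rho_def field_simps)
  then show ?thesis
    using Psi_plus_4K[of "t - rho m (i + 2 * real m)"] by (simp only:)
qed

lemma Psi_minus_rho_less: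
  assumes "m > 0" "i < j" shows "Psi (t - rho m j) < Psi (t - rho m i)"
proof (rule strict_monoD[OF Psi_strict_mono])
  have "(real m - 1 + 2 * i) * K < (real m - 1 + 2 * j) * K"
    using assms K_pos by (intro mult_strict_right_mono) auto
  then show "t - rho m j < t - rho m i"
    unfolding rho_def using assms divide_strict_right_mono[of _ _ "real m"] by simp
qed

text \<open>
  Regrouping the alternating sum in the two possible ways gives two positive numbers whose sum
  is the increment \<open>pi\<close> of \<open>Psi\<close> over a period. So each of them lies strictly between \<open>0\<close> and
  \<open>pi\<close>. So the product has positive real part on the right arc.
\<close>

lemma abs_err_less:
  assumes "m > 0" shows "\<bar>phase_err m t\<bar> < pi / 2"
proof -
  define f where "f = (\<lambda>i::nat. Psi (t - rho m i))"
  define X where "X = (\<Sum>l=1..m. f (2 * l - 1) - f (2 * l))"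
  have phase_err: "phase_err m t = pi / 2 - X"
    unfolding phase_err_def X_def f_def
    by (intro arg_cong2[of _ _ _ _ minus] sum.cong) (auto simp: of_nat_diff)
  have dec: "f j < f i" if "i < j" for i j
    unfolding f_def using assms that by (intro Psi_minus_rho_less) auto
  have "0 < X"
    unfolding X_def using assms by (intro sum_pos) (auto intro!: dec)
  moreover have "0 < (\<Sum>l=1..m. f (2 * l) - f (2 * l + 1))"
    using assms by (intro sum_pos) (auto intro!: dec)
  moreover have "f 1 - f (2 * m + 1) = pi"
    using Psi_minus_rho[OF assms, of t 1] by (simp add: f_def add.commute)
  ultimately have "0 < X" "X < pi"
    using sum_alternating_telescope(1)[of f m] by (auto simp: X_def)
  then show ?thesis unfolding phase_err abs_less_iff by linarith
qed

text \<open>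
  The shift exchanges the two groupings of the alternating sum, whose values add up to \<open>pi\<close>.
\<close>

lemma phase_err_shift:
  assumes "m > 0" shows "phase_err m (t + 2 * K / m) = - phase_err m t"
proof -
  define f where "f = (\<lambda>i::nat. Psi (t - rho m i))"
  have 1: "phase_err m t = pi / 2 - (\<Sum>l=1..m. f (2 * l - 1) - f (2 * l))"
    unfolding phase_err_def f_def
    by (intro arg_cong2[of _ _ _ _ minus] sum.cong) (auto simp: of_nat_diff)
  have "rho m (i - 1) = rho m i - 2 * K / m" for i
    by (simp add: rho_def algebra_simps add_divide_distrib diff_divide_distrib)
  then have shift: "t + 2 * K / m - rho m i = t - rho m (i - 1)" for i
    by simp
  have 2: "phase_err m (t + 2 * K / m) = pi / 2 - (\<Sum>l=1..m. f (2 * l - 2) - f (2 * l - 1))"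
    unfolding phase_err_def f_def shift
    by (intro arg_cong2[of _ _ _ _ minus] sum.cong) (auto simp: of_nat_diff)
  have "f 0 - f (2 * m) = pi"
    using Psi_minus_rho[OF assms, of t 0] by (simp add: f_def)
  then show ?thesis
    using sum_alternating_telescope(2)[of f m] unfolding 1 2 by linarith
qed

lemma angle_reflect: "angle (2 * K - t) = angle t"
proof -
  have "2 * K - t = - t + 2 * K" by simp
  then show ?thesis by (simp only: angle_plus_2K angle_minus minus_minus)
qed

text \<open>
  The curve turns back at \<open>K\<close>, so the phase at \<open>2 K - t\<close> and at \<open>t\<close> can differ only by a
  multiple of \<open>2 * pi\<close>; the bound excludes a nonzero one.
\<close>

lemma phase_err_reflect:
  assumes "m > 0" shows "phase_err m (2 * K - t) = phase_err m t"
proof -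
  have "cis (phase_err m (2 * K - t)) = cis (phase_err m t)"
    using blaschke_product_phase[of m "2 * K - t"] blaschke_product_phase[of m t]
    by (simp only: angle_reflect)
  then have "sin (phase_err m (2 * K - t)) = sin (phase_err m t)"
    by (metis cis.sel(2))
  moreover have "- (pi / 2) \<le> phase_err m u" "phase_err m u \<le> pi / 2" for u
    using abs_err_less[OF assms, of u] unfolding abs_less_iff by linarith+
  ultimately show ?thesis
    by (metis sin_inj_pi)
qed

end

text \<open>
  Suppose \<open>\<bar>e u\<bar>\<close> exceeds \<open>\<bar>e K\<bar>\<close>. The interval \<open>[-K, K]\<close> consists of \<open>m\<close> intervals of length
  \<open>h = 2 K / m\<close>, at whose ends \<open>\<bar>e\<bar> = \<bar>e K\<bar>\<close>. In the one with right end \<open>K\<close> an intermediate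
  value is taken twice, on both sides of \<open>u\<close>. Shift and reflection carry one of the two
  solutions into each of the other intervals, so there are at least \<open>m + 1\<close> solutions.
\<close>

lemma abs_le_of_shift_antiperiodic:
  fixes e :: "real \<Rightarrow> real" and m :: nat and K :: real
  assumes "m > 0" "K > 0"
    and cont: "continuous_on UNIV e"
    and shift: "\<And>t. e (t + 2 * K / m) = - e t"
    and reflect: "\<And>t. e (2 * K - t) = e t"
    and bound: "\<And>v A. A \<subseteq> {-K<..<K} \<Longrightarrow> finite A \<Longrightarrow> (\<And>t. t \<in> A \<Longrightarrow> e t = v) \<Longrightarrow> card A \<le> m"
  shows "\<bar>e t\<bar> \<le> \<bar>e K\<bar>"
proof (rule ccontr)
  define h where "h = 2 * K / m"
  have h: "h > 0" "h * m = 2 * K"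
    unfolding h_def using assms(1,2) by simp_all
  have shift': "e (t + h) = - e t" for t using shift by (simp add: h_def)
  have shift_nat: "e (t - real j * h) = (-1) ^ j * e t" for t j
  proof (induction j arbitrary: t)
    case (Suc j)
    have "e (t - real (Suc j) * h) = - e (t - real j * h)"
      using shift'[of "t - real (Suc j) * h"] by (simp add: algebra_simps)
    with Suc show ?case by simp
  qed simp
  assume "\<not> \<bar>e t\<bar> \<le> \<bar>e K\<bar>"
  \<comment> \<open>The point \<open>u\<close> is the translate of \<open>t\<close> in the last interval \<open>[K - h, K)\<close>; shifting up by \<open>n\<close> steps first keeps the number \<open>j\<close> of downward steps natural.\<close>
  define n where "n = nat \<lceil>\<bar>K - t\<bar> / h\<rceil>"
  define j where "j = nat \<lfloor>(t + n * h - (K - h)) / h\<rfloor>"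
  define u where "u = t + n * h - j * h"
  have abs_u: "\<bar>e u\<bar> = \<bar>e t\<bar>"
    using shift_nat[of "t + n * h" j] shift_nat[of "t + n * h" n]
    by (simp add: u_def abs_mult power_abs)
  have "\<bar>K - t\<bar> / h \<le> n" unfolding n_def by (rule real_nat_ceiling_ge)
  then have "\<bar>K - t\<bar> \<le> n * h" using h by (simp add: field_simps)
  then have "0 \<le> (t + n * h - (K - h)) / h" using h by auto
  then have "real j \<le> (t + n * h - (K - h)) / h" "(t + n * h - (K - h)) / h < real j + 1"
    unfolding j_def by linarith+
  then have u: "K - h \<le> u" "u < K" using h by (auto simp: u_def field_simps)
  define s where "s = sgn (e u)"
  define v where "v = (\<bar>e u\<bar> + \<bar>e K\<bar>) / 2"
  have v: "\<bar>e K\<bar> < v" "v < \<bar>e u\<bar>" using \<open>\<not> _\<close> abs_u by (auto simp: v_def)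
  have su: "s * e u = \<bar>e u\<bar>" "\<bar>s\<bar> = 1" using v by (auto simp: s_def sgn_if abs_if split: if_splits)
  have eKh: "e (K - h) = - e K" using shift'[of "K - h"] by simp
  have s_bound: "s * w \<le> \<bar>w\<bar>" for w
    using su(2) by (metis abs_ge_self abs_mult mult_1)
  have contw: "continuous_on A (\<lambda>x. s * e x)" for A
    using cont by (intro continuous_intros) (auto intro: continuous_on_subset)
  obtain x where x: "K - h \<le> x" "x \<le> u" "s * e x = v"
    using IVT'[of "\<lambda>x. s * e x" "K - h" v u] u v su s_bound[of "- e K"] contw eKh by auto
  obtain y where y: "u \<le> y" "y \<le> K" "s * e y = v"
    using IVT2'[of "\<lambda>x. s * e x" K v u] u v su s_bound[of "e K"] contw by auto
  have "x \<noteq> K - h" using x(3) eKh v s_bound[of "- e K"] by auto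
  have "y \<noteq> K" using y(3) v s_bound[of "e K"] by auto
  have "x \<noteq> u" "y \<noteq> u" using x(3) y(3) su v by auto
  have xy: "K - h < x" "x < y" "y < K"
    using x y \<open>x \<noteq> K - h\<close> \<open>y \<noteq> K\<close> \<open>x \<noteq> u\<close> \<open>y \<noteq> u\<close> by auto
  have exy: "e x = e y"
    using x(3) y(3) su(2) by (metis abs_1 abs_zero mult_cancel_left one_neq_zero)
  \<comment> \<open>A shift by an odd multiple of \<open>h\<close> negates \<open>e\<close>; reflection of the interval in its midpoint negates it once more.\<close>
  define pt where "pt = (\<lambda>j::nat. (if even j then x else 2 * K - h - x) - j * h)"
  have pt_range: "K - (j + 1) * h < pt j" "pt j < K - j * h" for j
    using xy by (auto simp: pt_def algebra_simps)
  have e_pt: "e (pt j) = e y" for j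
  proof (cases "even j")
    case True
    then show ?thesis using shift_nat[of x j] exy by (simp add: pt_def)
  next
    case False
    have "e (2 * K - h - x) = - e x"
      using shift'[of "2 * K - h - x"] reflect[of x] by simp
    with False show ?thesis using shift_nat[of "2 * K - h - x" j] exy by (simp add: pt_def)
  qed
  have pt_dec: "pt j < pt i" if "i < j" for i j
  proof -
    have "(real i + 1) * h \<le> real j * h" using that h by (intro mult_right_mono) auto
    then show ?thesis using pt_range(2)[of j] pt_range(1)[of i] by linarith
  qed
  then have inj: "inj_on pt {..<m}"
    by (intro linorder_inj_onI) (auto simp: order_less_irrefl dest!: pt_dec)
  have y_notin: "y \<notin> pt ` {..<m}"
  proof
    assume "y \<in> pt ` {..<m}"
    then obtain j where j: "y = pt j" by auto
    have "pt j \<le> pt 0" using pt_dec[of 0 j] by (cases "j = 0") auto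
    then show False using j xy by (simp add: pt_def)
  qed
  have "card (insert y (pt ` {..<m})) \<le> m"
  proof (rule bound[where v = "e y"])
    have "K - h * m < pt j" "pt j < K" if "j < m" for j
    proof -
      have "(real j + 1) * h \<le> real m * h" using that h by (intro mult_right_mono) auto
      then show "K - h * m < pt j" using pt_range(1)[of j] by (simp add: mult.commute)
      have "0 \<le> real j * h" using h by simp
      then show "pt j < K" using pt_range(2)[of j] by linarith
    qed
    moreover have "h * 1 \<le> h * m" using h assms(1) by (intro mult_left_mono) auto
    ultimately show "insert y (pt ` {..<m}) \<subseteq> {-K<..<K}"
      using xy h(2) by auto
  qed (auto simp: e_pt)
  then show False using inj y_notin by (simp add: card_image)
qed

section \<open>The Blaschke product with the prescribed zeros\<close>

context jacobi
begin

lemma dn_K: "dn K = sqrt (1 - k\<^sup>2)"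
  by (simp add: jacobi_dn_def sn_K)

lemma sn_plus_K: "sn (u + K) = cn u / dn u"
  and cn_plus_K: "cn (u + K) = - (sqrt (1 - k\<^sup>2) * sn u / dn u)"
proof -
  have "1 - k\<^sup>2 * (sn u)\<^sup>2 * (sn K)\<^sup>2 = dn u * dn u"
    using dn_square[of u] by (simp add: sn_K power2_eq_square)
  then show "sn (u + K) = cn u / dn u" "cn (u + K) = - (sqrt (1 - k\<^sup>2) * sn u / dn u)"
    using dn_pos[of u] unfolding sn_add cn_add by (simp_all add: sn_K cn_K dn_K)
qed

lemma angle_strict_mono_on: "strict_mono_on {-K..K} angle"
proof (rule strict_mono_onI)
  fix s t assume st: "s \<in> {-K..K}" "t \<in> {-K..K}" "s < t"
  have range: "- (pi / 2) \<le> am u \<and> am u \<le> pi / 2" if "u \<in> {-K..K}" for u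
    using that am_strict_mono am_K am_minus[of K]
    by (metis atLeastAtMost_iff strict_mono_less_eq)
  have "am s < am t" using am_strict_mono st(3) by (rule strict_monoD)
  then have "sn s < sn t"
    unfolding jacobi_sn_def using range st by (intro sin_monotone_2pi) auto
  then show "angle s < angle t"
    unfolding angle_def using k_pos abs_k_sn[of s] abs_k_sn[of t]
    by (intro arcsin_less_arcsin) auto
qed

lemma isCont_angle: "isCont angle u"
  using angle_has_derivative DERIV_isCont by blast

lemma angle_surj:
  assumes "x \<in> {- angle K..angle K}" obtains t where "t \<in> {-K..K}" "angle t = x"
proof -
  have "\<exists>t\<ge>-K. t \<le> K \<and> angle t = x"
    using assms isCont_angle K_pos by (intro IVT) auto
  then show ?thesis using that by auto
qed

end

text \<open>
  From here on the modulus is \<open>sin \<Theta>\<close>, the complementary modulus of \<open>cos \<Theta>\<close>.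
\<close>

locale arc =
  fixes \<Theta> :: real
  assumes Theta_pos: "0 < \<Theta>" and Theta_less: "\<Theta> < pi / 2"

sublocale arc \<subseteq> jacobi "sin \<Theta>"
proof
  show "0 < sin \<Theta>" using Theta_pos Theta_less by (intro sin_gt_zero) auto
  show "sin \<Theta> < 1"
    using Theta_pos Theta_less sin_monotone_2pi[of \<Theta> "pi / 2"] by simp
qed

definition num_poly :: "real \<Rightarrow> complex poly" where
  "num_poly \<phi> = [: - \<i> * of_real (sin (\<phi> / 2)), of_real (cos (\<phi> / 2)) :]"

definition den_poly :: "real \<Rightarrow> complex poly" where
  "den_poly \<phi> = [: of_real (cos (\<phi> / 2)), \<i> * of_real (sin (\<phi> / 2)) :]"

lemma poly_num_poly: "poly (num_poly \<phi>) z = blaschke_num \<phi> z"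
  by (simp add: num_poly_def blaschke_num_def algebra_simps)

lemma poly_den_poly: "poly (den_poly \<phi>) z = blaschke_den \<phi> z"
  by (simp add: den_poly_def blaschke_den_def algebra_simps)

lemma degree_num_den_poly: "degree (num_poly \<phi>) \<le> 1" "degree (den_poly \<phi>) \<le> 1"
  by (simp_all add: num_poly_def den_poly_def)

lemma den_poly_nonzero: "den_poly \<phi> \<noteq> 0"
proof
  assume "den_poly \<phi> = 0"
  then have "sin (\<phi> / 2) = 0" "cos (\<phi> / 2) = 0" by (simp_all add: den_poly_def)
  then have "(sin (\<phi> / 2))\<^sup>2 + (cos (\<phi> / 2))\<^sup>2 = 0\<^sup>2 + 0\<^sup>2" by (simp only:)
  then show False by (simp only: sin_cos_squared_add) simp
qed

lemma s_factor_eq: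
  assumes "cos (\<phi> / 2) \<noteq> 0"
  shows "s_factor (ereal (sin (\<phi> / 2) / cos (\<phi> / 2))) = Fract (num_poly \<phi>) (den_poly \<phi>)"
proof -
  have "den_poly \<phi> \<noteq> 0" by (rule den_poly_nonzero)
  then show ?thesis
    using assms by (simp add: s_factor_def eq_fract num_poly_def den_poly_def)
qed

lemma s_factor_infinite:
  assumes "cos (\<phi> / 2) = 0"
  shows "s_factor \<infinity> = Fract (num_poly \<phi>) (den_poly \<phi>)"
proof -
  have "den_poly \<phi> \<noteq> 0" by (rule den_poly_nonzero)
  then show ?thesis
    using assms by (simp add: s_factor_def eq_fract num_poly_def den_poly_def)
qed

lemma blaschke_den_circle_nonzero:
  assumes "cos \<phi> \<noteq> 0" "cmod z = 1"
  shows "blaschke_den \<phi> z \<noteq> 0"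
proof -
  obtain x where z: "z = cis x" using assms(2) by (metis cis_Arg_unique[of z] complex_norm_eq_1_exp_eq cis_conv_exp)
  have "(sin \<phi>)\<^sup>2 < 1" using assms(1) by (simp add: sin_squared_eq)
  then have "\<bar>sin \<phi>\<bar> < 1" by (simp add: abs_square_less_1)
  moreover have "\<bar>sin \<phi> * sin x\<bar> \<le> \<bar>sin \<phi>\<bar> * 1"
    unfolding abs_mult by (intro mult_left_mono) auto
  ultimately have "sin \<phi> * sin x < 1" by linarith
  then have "(cmod (blaschke_den \<phi> z))\<^sup>2 > 0"
    by (simp add: z norm_blaschke_den)
  then show ?thesis by auto
qed

lemma blaschke_factor_at_i:
  assumes "cos \<phi> \<noteq> 0"
  shows "blaschke_num \<phi> \<i> / blaschke_den \<phi> \<i> = \<i>"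
  using blaschke_den_circle_nonzero[OF assms, of \<i>]
  by (simp add: blaschke_num_def blaschke_den_def field_simps)

lemma blaschke_minus_cnj:
  "blaschke_num \<phi> (- cnj z) = - cnj (blaschke_num \<phi> z)"
  "blaschke_den \<phi> (- cnj z) = cnj (blaschke_den \<phi> z)"
  by (simp_all add: blaschke_num_def blaschke_den_def)

context arc
begin

lemma k_Theta: "sqrt (1 - (cos \<Theta>)\<^sup>2) = sin \<Theta>" "sqrt (1 - (sin \<Theta>)\<^sup>2) = cos \<Theta>"
proof -
  have "0 \<le> cos \<Theta>" using Theta_pos Theta_less by (intro cos_ge_zero) auto
  then show "sqrt (1 - (cos \<Theta>)\<^sup>2) = sin \<Theta>" "sqrt (1 - (sin \<Theta>)\<^sup>2) = cos \<Theta>"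
    using k_pos by (simp_all add: sin_squared_eq[symmetric] cos_squared_eq[symmetric])
qed

lemma angle_K: "angle K = \<Theta>"
  using Theta_pos Theta_less by (simp add: angle_def sn_K arcsin_sin)

text \<open>
  Half-angle formula \<open>tan (\<phi> / 2) = (1 - cos \<phi>) / sin \<phi>\<close> together with the quarter-period
  shift \<open>sn (u + K) = cn u / dn u\<close>, \<open>cn (u + K) = - cos \<Theta> * sn u / dn u\<close>.
\<close>

lemma elliptic_quot_eq:
  fixes t defines "\<phi> \<equiv> am (t * K + K)"
  assumes "cn (t * K) \<noteq> 0"
  shows "elliptic_quot \<Theta> t = sin (\<phi> / 2) / cos (\<phi> / 2)" "sin (\<phi> / 2) \<noteq> 0" "cos (\<phi> / 2) \<noteq> 0"
proof -
  define u where "u = t * K"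
  have sin: "sin \<phi> = cn u / dn u" and cos: "cos \<phi> = - (cos \<Theta> * sn u / dn u)"
    using sn_plus_K[of u] cn_plus_K[of u]
    by (simp_all add: \<phi>_def u_def jacobi_sn_def jacobi_cn_def k_Theta)
  have sin2: "sin \<phi> = 2 * sin (\<phi> / 2) * cos (\<phi> / 2)" and cos2: "cos \<phi> = 1 - 2 * (sin (\<phi> / 2))\<^sup>2"
    using sin_double[of "\<phi> / 2"] cos_double_sin[of "\<phi> / 2"] by simp_all
  have "sin \<phi> \<noteq> 0" using assms(2) dn_pos[of u] by (simp add: sin u_def)
  then show nz: "sin (\<phi> / 2) \<noteq> 0" "cos (\<phi> / 2) \<noteq> 0" by (auto simp: sin2)
  have "elliptic_quot \<Theta> t = (cos \<Theta> * sn u + dn u) / cn u"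
    by (simp add: elliptic_quot_def Let_def k_Theta u_def)
  also have "\<dots> = (1 - cos \<phi>) / sin \<phi>"
    using dn_pos[of u] assms(2) unfolding sin cos by (simp add: field_simps u_def)
  also have "\<dots> = sin (\<phi> / 2) / cos (\<phi> / 2)"
    using nz unfolding sin2 cos2 by (simp add: field_simps power2_eq_square)
  finally show "elliptic_quot \<Theta> t = sin (\<phi> / 2) / cos (\<phi> / 2)" .
qed

lemma rho_eq: "m > 0 \<Longrightarrow> rho m j = (2 * j - 1) / m * K + K"
  by (simp add: rho_def field_simps)

lemma am_range:
  assumes "0 < u" "u < 2 * K" shows "0 < am u" "am u < pi"
  using strict_monoD[OF am_strict_mono assms(1)] strict_monoD[OF am_strict_mono assms(2)]
    am_plus_2K[of 0] by simp_all

lemma cn_nonzero: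
  assumes "0 < u" "u < 2 * K" "u \<noteq> K" shows "cn u \<noteq> 0"
proof
  assume "cn u = 0"
  then have "cos (am u) = cos (pi / 2)" by (simp add: jacobi_cn_def)
  moreover have "0 \<le> am u" "am u \<le> pi" "0 \<le> pi / 2" "pi / 2 \<le> pi"
    using am_range[OF assms(1,2)] pi_gt_zero by linarith+
  ultimately have "am u = pi / 2" by (metis cos_inj_pi)
  then have "u = K" by (metis F_am F_pi_half)
  with assms(3) show False by simp
qed

lemma sn_pos:
  assumes "0 < u" "u < 2 * K" shows "0 < sn u"
  using am_range[OF assms] by (simp add: jacobi_sn_def sin_gt_zero)

lemma node_range:
  assumes "j \<in> {1..m}"
  shows "0 < (2 * real j - 1) / m * K" "(2 * real j - 1) / m * K < 2 * K"
proof -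
  have "0 < (2 * real j - 1) / m" "(2 * real j - 1) / m < 2"
    using assms by (auto simp: field_simps)
  from this[THEN mult_strict_right_mono, OF K_pos]
  show "0 < (2 * real j - 1) / m * K" "(2 * real j - 1) / m * K < 2 * K"
    by (simp_all only: mult_zero_left)
qed

lemma am_sigma:
  "am (sigma m j) = (if even j then am (rho m j) else if even m then pi - am (rho m j) else am (rho m j) + pi)"
proof -
  have "am (2 * K - rho m j) = pi - am (rho m j)"
    using am_plus_2K[of "- rho m j"] by (simp add: add.commute)
  then show ?thesis by (simp add: sigma_def am_plus_2K)
qed

text \<open>
  If the cosine vanished, the Blaschke factor would degenerate to a constant with a common
  zero of numerator and denominator on the circle.
\<close>

lemma cos_am_sigma_nonzero:
  assumes j: "j \<in> {1..m}"
  shows "cos (am (sigma m j)) \<noteq> 0"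
proof -
  have m: "m > 0" using j by auto
  have "cos (am (rho m j)) = - (cos \<Theta> * sn ((2 * real j - 1) / m * K) / dn ((2 * real j - 1) / m * K))"
    unfolding rho_eq[OF m] using cn_plus_K[of "(2 * real j - 1) / m * K"]
    by (simp add: jacobi_cn_def k_Theta)
  moreover have "cos \<Theta> > 0" using Theta_pos Theta_less by (intro cos_gt_zero) auto
  ultimately have "cos (am (rho m j)) \<noteq> 0"
    using sn_pos[OF node_range[OF j]] dn_pos[of "(2 * real j - 1) / m * K"]
    by (simp add: less_imp_neq[symmetric])
  then show ?thesis by (simp add: am_sigma)
qed

text \<open>
  The middle factor of odd \<open>m\<close>, with coefficient \<open>0\<close> or \<open>\<infinity>\<close>, is the case \<open>am (rho m j) = pi\<close>.
\<close>

lemma s_factor_b_coeff: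
  assumes j: "j \<in> {1..m}"
  shows "s_factor (b_coeff m \<Theta> j) = Fract (num_poly (am (sigma m j))) (den_poly (am (sigma m j)))"
proof (cases "m = 2 * j - 1")
  case True
  then have "real m = 2 * real j - 1" using j by (auto simp: of_nat_diff)
  moreover have "m > 0" using j by auto
  ultimately have "rho m j = 0 + 2 * K" by (simp add: rho_eq)
  then have am_rho: "am (rho m j) = pi" using am_plus_2K[of 0] by simp
  have "odd m" using True j by auto
  show ?thesis
  proof (cases "even j")
    case True
    then have "cos (am (sigma m j) / 2) = 0" by (simp add: am_sigma am_rho)
    then show ?thesis using s_factor_infinite True \<open>m = _\<close> by (simp add: b_coeff_def)
  next
    case False
    then have "cos (am (sigma m j) / 2) = -1" "sin (am (sigma m j) / 2) = 0"
      using \<open>odd m\<close> by (simp_all add: am_sigma am_rho)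
    then show ?thesis
      using s_factor_eq[of "am (sigma m j)"] False \<open>m = _\<close> by (simp add: b_coeff_def zero_ereal_def)
  qed
next
  case False
  have m: "m > 0" using j by auto
  define \<phi> where "\<phi> = am (rho m j)"
  have "(2 * real j - 1) / m * K \<noteq> K"
  proof
    assume "(2 * real j - 1) / m * K = K"
    then have "(2 * real j - 1) / m = 1"
      using K_pos by (metis less_irrefl mult_cancel_right mult_1)
    then have "2 * real j - 1 = m" using m by (simp add: divide_eq_1_iff)
    then show False using False j by linarith
  qed
  then have "cn ((2 * real j - 1) / m * K) \<noteq> 0"
    using node_range[OF j] by (intro cn_nonzero)
  from elliptic_quot_eq[OF this] have
    q: "elliptic_quot \<Theta> ((2 * real j - 1) / m) = sin (\<phi> / 2) / cos (\<phi> / 2)"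
    and nz: "sin (\<phi> / 2) \<noteq> 0" "cos (\<phi> / 2) \<noteq> 0"
    by (simp_all add: \<phi>_def rho_eq[OF m])
  have "b_coeff m \<Theta> j = ereal (sin (am (sigma m j) / 2) / cos (am (sigma m j) / 2))
    \<and> cos (am (sigma m j) / 2) \<noteq> 0"
  proof (cases "even j")
    case True
    then show ?thesis using \<open>m \<noteq> _\<close> nz by (simp add: b_coeff_def q am_sigma \<phi>_def)
  next
    case odd_j: False
    show ?thesis
    proof (cases "even m")
      case True
      have half: "am (sigma m j) / 2 = pi / 2 - \<phi> / 2"
        using odd_j True by (simp add: am_sigma \<phi>_def diff_divide_distrib)
      have "sin (am (sigma m j) / 2) = cos (\<phi> / 2)" "cos (am (sigma m j) / 2) = sin (\<phi> / 2)"
        unfolding half by (simp_all add: sin_diff cos_diff)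
      then show ?thesis
        using \<open>m \<noteq> _\<close> nz odd_j True by (simp add: b_coeff_def q power_int_minus)
    next
      case False
      have half: "am (sigma m j) / 2 = \<phi> / 2 + pi / 2"
        using odd_j False by (simp add: am_sigma \<phi>_def add_divide_distrib)
      have "sin (am (sigma m j) / 2) = cos (\<phi> / 2)" "cos (am (sigma m j) / 2) = - sin (\<phi> / 2)"
        unfolding half by (simp_all add: sin_add cos_add)
      then show ?thesis
        using \<open>m \<noteq> _\<close> nz odd_j False by (simp add: b_coeff_def q power_int_minus)
    qed
  qed
  then show ?thesis using s_factor_eq by simp
qed

definition opt_num :: "nat \<Rightarrow> complex poly" where
  "opt_num m = smult (\<i> powi (1 - int m)) (\<Prod>j=1..m. num_poly (am (sigma m j)))"

definition opt_den :: "nat \<Rightarrow> complex poly" where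
  "opt_den m = (\<Prod>j=1..m. den_poly (am (sigma m j)))"

lemma opt_den_nonzero: "opt_den m \<noteq> 0"
  by (simp add: opt_den_def den_poly_nonzero)

lemma s_opt_Fract: "s_opt m \<Theta> = Fract (opt_num m) (opt_den m)"
proof -
  have "(\<Prod>j=1..m. s_factor (b_coeff m \<Theta> j)) =
      (\<Prod>j=1..m. Fract (num_poly (am (sigma m j))) (den_poly (am (sigma m j))))"
    by (intro prod.cong s_factor_b_coeff) auto
  also have "\<dots> = Fract (\<Prod>j=1..m. num_poly (am (sigma m j))) (opt_den m)"
    unfolding opt_den_def by (intro prod_Fract den_poly_nonzero)
  finally show ?thesis by (simp add: s_opt_def to_fract_def opt_num_def)
qed

lemma opt_quotient:
  "poly (opt_num m) z / poly (opt_den m) z =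
    \<i> powi (1 - int m) * (\<Prod>j=1..m. blaschke_num (am (sigma m j)) z / blaschke_den (am (sigma m j)) z)"
  by (simp add: opt_num_def opt_den_def poly_prod poly_num_poly poly_den_poly prod_dividef)

lemma opt_den_circle_nonzero: "cmod z = 1 \<Longrightarrow> poly (opt_den m) z \<noteq> 0"
  using cos_am_sigma_nonzero blaschke_den_circle_nonzero
  by (auto simp: opt_den_def poly_prod poly_den_poly)

text \<open>
  Every factor takes the value \<open>\<i>\<close> at \<open>\<i>\<close>. As the phase on the right arc never reaches
  \<open>pi / 2\<close> for \<open>m > 0\<close>, this shows that the product is not constant, and it distinguishes it
  from its reciprocal for every \<open>m\<close>.
\<close>

lemma opt_at_i: "poly (opt_num m) \<i> / poly (opt_den m) \<i> = \<i>"
proof -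
  have "(\<Prod>j=1..m. blaschke_num (am (sigma m j)) \<i> / blaschke_den (am (sigma m j)) \<i>) = (\<Prod>j=1..m. \<i>)"
    by (intro prod.cong blaschke_factor_at_i cos_am_sigma_nonzero) auto
  then show ?thesis unfolding opt_quotient by (simp add: power_int_diff)
qed

lemma opt_right_arc: "poly (opt_num m) (cis (angle t)) / poly (opt_den m) (cis (angle t)) = cis (phase_err m t)"
  unfolding opt_quotient by (rule blaschke_product_phase)

text \<open>
  The symmetry that maps the right arc to the left one and negates the error. The constant
  \<open>\<i> powi (1 - int m)\<close> is chosen so that the sign comes out as \<open>-1\<close> for every \<open>m\<close>.
\<close>

lemma opt_minus_cnj:
  "poly (opt_num m) (- cnj z) / poly (opt_den m) (- cnj z) =
    - cnj (poly (opt_num m) z / poly (opt_den m) z)"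
proof -
  define P Q where "P = (\<Prod>j=1..m. blaschke_num (am (sigma m j)) z)"
    and "Q = (\<Prod>j=1..m. blaschke_den (am (sigma m j)) z)"
  have opt: "poly (opt_num m) z / poly (opt_den m) z = \<i> / \<i> ^ m * (P / Q)"
    unfolding opt_quotient P_def Q_def by (simp add: prod_dividef power_int_diff)
  have "(\<Prod>j=1..m. - cnj (blaschke_num (am (sigma m j)) z)) = (\<Prod>j=1..m. - 1 * cnj (blaschke_num (am (sigma m j)) z))"
    by simp
  also have "\<dots> = (-1) ^ m * cnj P"
    unfolding P_def prod.distrib by simp
  finally have N: "(\<Prod>j=1..m. - cnj (blaschke_num (am (sigma m j)) z)) = (-1) ^ m * cnj P" .
  have D: "(\<Prod>j=1..m. cnj (blaschke_den (am (sigma m j)) z)) = cnj Q"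
    by (simp add: Q_def)
  have opt': "poly (opt_num m) (- cnj z) / poly (opt_den m) (- cnj z) =
      \<i> / \<i> ^ m * ((-1) ^ m * cnj P / cnj Q)"
    unfolding opt_quotient blaschke_minus_cnj prod_dividef N D by (simp add: power_int_diff)
  have "(- \<i>) ^ m = (-1) ^ m * \<i> ^ m" by (rule power_minus)
  moreover have "(-1 :: complex) ^ m * (-1) ^ m = 1" by (simp flip: power_add)
  ultimately have sign: "\<i> / \<i> ^ m * (-1) ^ m = - (- \<i> / (- \<i>) ^ m)"
    by (simp add: divide_eq_eq eq_divide_eq)
  have "\<i> / \<i> ^ m * ((-1) ^ m * cnj P / cnj Q) = (\<i> / \<i> ^ m * (-1) ^ m) * (cnj P / cnj Q)"
    by (simp only: divide_inverse mult_ac)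
  also have "\<dots> = - cnj (\<i> / \<i> ^ m * (P / Q))"
    unfolding sign by simp
  finally show ?thesis unfolding opt opt' .
qed

lemma opt_pair: "conj_reciprocal_pair m (\<i> powi (1 - int m)) (opt_num m) (opt_den m)"
proof -
  have "degree (\<Prod>j=1..m. num_poly (am (sigma m j))) \<le> m"
       "degree (\<Prod>j=1..m. den_poly (am (sigma m j))) \<le> m"
    using degree_prod_le_card[of "{1..m}" "\<lambda>j. num_poly (am (sigma m j))", OF degree_num_den_poly(1)]
      degree_prod_le_card[of "{1..m}" "\<lambda>j. den_poly (am (sigma m j))", OF degree_num_den_poly(2)]
    by simp_all
  moreover have "blaschke_num \<phi> z = z * cnj (blaschke_den \<phi> z)" if "cmod z = 1" for z \<phi>
  proof -
    have "z \<noteq> 0" using that by auto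
    then have "cis (Arg z) = z" using that cis_Arg[of z] by (simp add: sgn_div_norm)
    then show ?thesis using blaschke_num_cis[of \<phi> "Arg z"] by simp
  qed
  ultimately show ?thesis
    by (auto simp: conj_reciprocal_pair_def opt_num_def opt_den_def poly_prod poly_num_poly
        poly_den_poly prod.distrib)
qed

end

section \<open>The sign problem\<close>

context arc
begin

text \<open>
  The number of solutions of \<open>phase_err m t = v\<close> is bounded by the number of zeros of a
  polynomial of degree at most \<open>m\<close>, which is not zero by its value at \<open>\<i>\<close>. For \<open>m = 0\<close> the
  phase is the constant \<open>pi / 2\<close>.
\<close>

lemma abs_err_le: "\<bar>phase_err m t\<bar> \<le> \<bar>phase_err m K\<bar>"
proof (cases "m = 0")
  case True
  then show ?thesis by (simp add: phase_err_def)
next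
  case False
  then have m: "m > 0" by simp
  show ?thesis
  proof (rule abs_le_of_shift_antiperiodic[OF m K_pos continuous_on_err phase_err_shift[OF m] phase_err_reflect[OF m]])
    fix v A assume A: "A \<subseteq> {-K<..<K}" "finite A" "\<And>t. t \<in> A \<Longrightarrow> phase_err m t = v"
    show "card A \<le> m"
    proof (cases "A = {}")
      case False
      then obtain t where "t \<in> A" by blast
      with A(3) abs_err_less[OF m, of t] have "\<bar>v\<bar> < pi / 2" by auto
      then have "cos v > 0" by (intro cos_gt_zero_pi) auto
      then have v: "cis v \<noteq> \<i>" by (auto simp: complex_eq_iff)
      define f where "f = opt_num m - smult (cis v) (opt_den m)"
      have "poly (opt_num m) \<i> = \<i> * poly (opt_den m) \<i>" "poly (opt_den m) \<i> \<noteq> 0"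
        using opt_at_i[of m] opt_den_circle_nonzero[of \<i> m] by (simp_all add: field_simps)
      then have "poly f \<i> \<noteq> 0" using v by (simp add: f_def)
      then have f0: "f \<noteq> 0" by auto
      have "degree f \<le> m"
        unfolding f_def using opt_pair[of m]
        by (intro degree_diff_le) (auto simp: conj_reciprocal_pair_def intro: order_trans[OF degree_smult_le])
      have "inj_on (\<lambda>t. cis (angle t)) {-K..K}"
      proof (rule inj_onI)
        fix s t assume st: "s \<in> {-K..K}" "t \<in> {-K..K}" "cis (angle s) = cis (angle t)"
        then have "sin (angle s) = sin (angle t)" by (metis cis.sel(2))
        then have "sin \<Theta> * sn s = sin \<Theta> * sn t" by (simp only: sin_angle)
        then have "angle s = angle t" by (simp only: angle_def)
        then show "s = t" using st strict_mono_on_imp_inj_on[OF angle_strict_mono_on] by (meson inj_onD)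
      qed
      moreover have "A \<subseteq> {-K..K}" using A(1) by auto
      ultimately have "inj_on (\<lambda>t. cis (angle t)) A" by (rule inj_on_subset)
      then have "card A = card ((\<lambda>t. cis (angle t)) ` A)"
        by (rule card_image[symmetric])
      also have "\<dots> \<le> card {z. poly f z = 0}"
      proof (rule card_mono)
        show "(\<lambda>t. cis (angle t)) ` A \<subseteq> {z. poly f z = 0}"
        proof (intro image_subsetI CollectI)
          fix t assume "t \<in> A"
          then show "poly f (cis (angle t)) = 0"
            using opt_right_arc[of m t] opt_den_circle_nonzero[of "cis (angle t)" m] A(3)
            by (simp add: f_def field_simps)
        qed
      qed (rule poly_roots_finite[OF f0])
      also have "\<dots> \<le> m"
        using card_poly_roots_bound[OF f0] \<open>degree f \<le> m\<close> by linarith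
      finally show ?thesis .
    qed simp
  qed
qed

lemma phase_err_K_less: "\<bar>phase_err m K\<bar> < pi"
proof (cases "m = 0")
  case False
  then show ?thesis using abs_err_less[of m K] pi_gt_zero by linarith
qed (simp add: phase_err_def)

lemma Arg_cis_err: "\<bar>Arg (cis (phase_err m t))\<bar> = \<bar>phase_err m t\<bar>" "\<bar>Arg (cis (- phase_err m t))\<bar> = \<bar>phase_err m t\<bar>"
proof -
  have "\<bar>phase_err m t\<bar> < pi"
    using abs_err_le[of m t] phase_err_K_less[of m] by linarith
  then have "phase_err m t \<in> {-pi<..pi}" "- phase_err m t \<in> {-pi<..pi}" by (auto simp: abs_less_iff)
  from this[THEN Arg_cis] show "\<bar>Arg (cis (phase_err m t))\<bar> = \<bar>phase_err m t\<bar>" "\<bar>Arg (cis (- phase_err m t))\<bar> = \<bar>phase_err m t\<bar>"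
    by simp_all
qed

text \<open>
  The points of the right arc where the error is extremal. For \<open>m = 0\<close> only \<open>node 0 0 = - K\<close>
  is used, and division by zero is harmless.
\<close>

definition node :: "nat \<Rightarrow> nat \<Rightarrow> real" where
  "node m i = - K + real i * (2 * K / real m)"

lemma node_0 [simp]: "node m 0 = - K"
  by (simp add: node_def)

lemma node_in_range:
  assumes "i \<le> m" shows "node m i \<in> {-K..K}"
proof -
  have "real i * (2 * K / m) \<le> real m * (2 * K / m)"
    using assms K_pos by (intro mult_right_mono) auto
  also have "\<dots> \<le> 2 * K" using K_pos by simp
  finally show ?thesis using K_pos by (auto simp: node_def)
qed

lemma phase_err_node: "i \<le> m \<Longrightarrow> phase_err m (node m i) = (-1) ^ i * phase_err m (- K)"
proof (induction i)
  case (Suc i)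
  have "node m (Suc i) = node m i + 2 * K / m"
    by (simp add: node_def algebra_simps add_divide_distrib)
  then have "phase_err m (node m (Suc i)) = - phase_err m (node m i)"
    using phase_err_shift[of m "node m i"] Suc.prems by (simp only:)
  then show ?case using Suc by simp
qed simp

lemma abs_err_minus_K: "\<bar>phase_err m (- K)\<bar> = \<bar>phase_err m K\<bar>"
proof (cases "m = 0")
  case False
  then have "node m m = K" by (simp add: node_def)
  with phase_err_node[of m m] have "phase_err m K = (-1) ^ m * phase_err m (- K)" by simp
  then show ?thesis by (simp add: abs_mult power_abs)
qed (simp add: phase_err_def)

lemma angle_node_less:
  assumes "i < j" "j \<le> m" shows "angle (node m i) < angle (node m j)"
proof (rule strict_mono_onD[OF angle_strict_mono_on])
  have "real i * (2 * K / real m) < real j * (2 * K / real m)"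
    using assms K_pos by (intro mult_strict_right_mono) auto
  then show "node m i < node m j" by (simp add: node_def)
  show "node m i \<in> {-K..K}" "node m j \<in> {-K..K}"
    using assms by (auto simp del: atLeastAtMost_iff intro!: node_in_range)
qed

lemma angle_bounds:
  assumes "t \<in> {-K..K}" shows "angle t \<in> {-\<Theta>..\<Theta>}"
  using strict_mono_on_leD[OF angle_strict_mono_on, of "-K" t] strict_mono_on_leD[OF angle_strict_mono_on, of t K]
    assms K_pos by (auto simp: angle_K)

lemma csign_cis_right: "x \<in> {-\<Theta>..\<Theta>} \<Longrightarrow> csign (cis x) = 1"
proof -
  assume x: "x \<in> {-\<Theta>..\<Theta>}"
  then have "0 < cos x" using Theta_less by (intro cos_gt_zero_pi) auto
  then show ?thesis by (simp add: csign_def csqrt_square)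
qed

lemma cis_pi_minus: "cis (pi - x) = - cnj (cis x)"
  by (simp add: complex_eq_iff)

lemma csign_cis_left: "x \<in> {-\<Theta>..\<Theta>} \<Longrightarrow> csign (cis (pi - x)) = -1"
proof -
  assume x: "x \<in> {-\<Theta>..\<Theta>}"
  then have "0 < cos x" using Theta_less by (intro cos_gt_zero_pi) auto
  then have "csqrt ((- cnj (cis x))\<^sup>2) = cnj (cis x)"
    using csqrt_square[of "cnj (cis x)"] by simp
  then show ?thesis unfolding cis_pi_minus csign_def by (simp add: cis_cnj)
qed

lemma T_arc_cases:
  assumes "z \<in> T_arc \<Theta>"
  obtains t where "z = cis (angle t)" "csign z = 1" | t where "z = cis (pi - angle t)" "csign z = -1"
proof -
  obtain x where x: "z = cis x" "x \<in> {-\<Theta>..\<Theta>} \<or> pi - x \<in> {-\<Theta>..\<Theta>}"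
    using assms by (force simp: T_arc_def)
  from x(2) show ?thesis
  proof
    assume r: "x \<in> {-\<Theta>..\<Theta>}"
    then obtain t where "angle t = x" using angle_surj[of x] angle_K by auto
    with r x(1) csign_cis_right show ?thesis using that(1) by blast
  next
    assume l: "pi - x \<in> {-\<Theta>..\<Theta>}"
    then obtain t where t: "angle t = pi - x" using angle_surj[of "pi - x"] angle_K by auto
    then have "z = cis (pi - angle t)" using x(1) by simp
    moreover have "csign z = -1" using l csign_cis_left[of "pi - x"] x(1) by simp
    ultimately show ?thesis by (rule that(2))
  qed
qed

lemma mem_T_arc:
  assumes "x \<in> {-\<Theta>..\<Theta>}" shows "cis x \<in> T_arc \<Theta>" "cis (pi - x) \<in> T_arc \<Theta>"
  using assms by (auto simp: T_arc_def)

lemma opt_left_arc: "poly (opt_num m) (cis (pi - angle t)) / poly (opt_den m) (cis (pi - angle t)) = - cis (- phase_err m t)"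
  unfolding cis_pi_minus opt_minus_cnj opt_right_arc by (simp add: cis_cnj)

lemma opt_num_circle_nonzero: "cmod z = 1 \<Longrightarrow> poly (opt_num m) z \<noteq> 0"
  using conj_reciprocal_pair_norm[OF opt_pair, of z m] opt_den_circle_nonzero[of z m]
  by (auto simp: norm_power_int)

lemma s_opt_class: "s_opt m \<Theta> \<in> ratfuns m m" "unimodular_on_circle (s_opt m \<Theta>)"
  unfolding s_opt_Fract
  using conj_reciprocal_pair_unimodular[OF opt_pair _ opt_den_circle_nonzero]
  by (auto simp: norm_power_int)

lemma inverse_s_opt: "inverse (s_opt m \<Theta>) = Fract (opt_den m) (opt_num m)"
proof -
  have "opt_num m \<noteq> 0" using opt_num_circle_nonzero[of 1 m] by auto
  then show ?thesis by (simp add: s_opt_Fract)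
qed

lemma inverse_s_opt_class:
  "inverse (s_opt m \<Theta>) \<in> ratfuns m m" "unimodular_on_circle (inverse (s_opt m \<Theta>))"
  unfolding inverse_s_opt
  using conj_reciprocal_pair_unimodular[OF conj_reciprocal_pair_swap[OF opt_pair] _ opt_num_circle_nonzero]
  by (auto simp: norm_power_int)

lemma eval_s_opt:
  "ratfun_eval (s_opt m \<Theta>) (cis x) = poly (opt_num m) (cis x) / poly (opt_den m) (cis x)"
  "ratfun_eval (inverse (s_opt m \<Theta>)) (cis x) = inverse (poly (opt_num m) (cis x) / poly (opt_den m) (cis x))"
  unfolding inverse_s_opt unfolding s_opt_Fract
  using opt_den_circle_nonzero[of "cis x" m] opt_num_circle_nonzero[of "cis x" m]
  by (simp_all add: ratfun_eval_Fract)

lemma sign_phase_error_s_opt: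
  "sign_phase_error \<Theta> (s_opt m \<Theta>) = \<bar>phase_err m K\<bar>"
  "sign_phase_error \<Theta> (inverse (s_opt m \<Theta>)) = \<bar>phase_err m K\<bar>"
proof -
  have K_mem: "cis (angle K) \<in> T_arc \<Theta>" "csign (cis (angle K)) = 1"
    using Theta_pos by (auto intro!: mem_T_arc csign_cis_right simp: angle_K)
  show "sign_phase_error \<Theta> (s_opt m \<Theta>) = \<bar>phase_err m K\<bar>"
    unfolding sign_phase_error_def
  proof (rule SUP_abs_Arg_eq[OF _ K_mem(1)])
    show "\<bar>Arg (ratfun_eval (s_opt m \<Theta>) z / csign z)\<bar> \<le> \<bar>phase_err m K\<bar>" if "z \<in> T_arc \<Theta>" for z
      using that
    proof (cases rule: T_arc_cases)
      case (1 t)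
      then show ?thesis using abs_err_le[of m t] by (simp add: eval_s_opt opt_right_arc Arg_cis_err)
    next
      case (2 t)
      then show ?thesis using abs_err_le[of m t]
        by (simp add: eval_s_opt opt_left_arc Arg_cis_err del: cis_inverse)
    qed
    show "\<bar>Arg (ratfun_eval (s_opt m \<Theta>) (cis (angle K)) / csign (cis (angle K)))\<bar> = \<bar>phase_err m K\<bar>"
      by (simp add: eval_s_opt opt_right_arc Arg_cis_err K_mem(2))
  qed
  show "sign_phase_error \<Theta> (inverse (s_opt m \<Theta>)) = \<bar>phase_err m K\<bar>"
    unfolding sign_phase_error_def
  proof (rule SUP_abs_Arg_eq[OF _ K_mem(1)])
    show "\<bar>Arg (ratfun_eval (inverse (s_opt m \<Theta>)) z / csign z)\<bar> \<le> \<bar>phase_err m K\<bar>" if "z \<in> T_arc \<Theta>" for z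
      using that
    proof (cases rule: T_arc_cases)
      case (1 t)
      then show ?thesis using abs_err_le[of m t]
        by (simp add: eval_s_opt opt_right_arc Arg_cis_err)
    next
      case (2 t)
      then show ?thesis using abs_err_le[of m t]
        by (simp add: eval_s_opt opt_left_arc Arg_cis_err)
    qed
    show "\<bar>Arg (ratfun_eval (inverse (s_opt m \<Theta>)) (cis (angle K)) / csign (cis (angle K)))\<bar> = \<bar>phase_err m K\<bar>"
      by (simp add: eval_s_opt opt_right_arc Arg_cis_err K_mem(2))
  qed
qed

lemma s_opt_neq_inverse: "s_opt m \<Theta> \<noteq> inverse (s_opt m \<Theta>)"
proof -
  have "ratfun_eval (s_opt m \<Theta>) (cis (pi / 2)) \<noteq> ratfun_eval (inverse (s_opt m \<Theta>)) (cis (pi / 2))"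
    unfolding eval_s_opt by (simp add: opt_at_i complex_eq_iff)
  then show ?thesis by metis
qed


text \<open>
  The half phase is followed along the arc in the angle, not in the elliptic parameter.
\<close>

lemma continuous_arc_error:
  obtains e where "continuous_on {-\<Theta>..\<Theta>} e" "\<And>t. t \<in> {-K..K} \<Longrightarrow> e (angle t) = phase_err m t"
proof -
  define g where "g = inv_into {-K..K} angle"
  have inj: "inj_on angle {-K..K}"
    by (rule strict_mono_on_imp_inj_on[OF angle_strict_mono_on])
  have "{-\<Theta>..\<Theta>} \<subseteq> angle ` {-K..K}"
  proof
    fix x assume "x \<in> {-\<Theta>..\<Theta>}"
    then obtain t where "t \<in> {-K..K}" "angle t = x" using angle_surj[of x] unfolding angle_K by blast
    then show "x \<in> angle ` {-K..K}" by blast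
  qed
  moreover have g: "g (angle t) = t" if "t \<in> {-K..K}" for t
    using inj that by (simp add: g_def inv_into_f_f)
  have "continuous_on (angle ` {-K..K}) g"
    using g by (intro continuous_on_inv) (auto intro!: continuous_at_imp_continuous_on isCont_angle)
  ultimately have "continuous_on {-\<Theta>..\<Theta>} g"
    using continuous_on_subset by blast
  then have "continuous_on {-\<Theta>..\<Theta>} (\<lambda>x. phase_err m (g x))"
    by (rule continuous_on_compose2[OF continuous_on_err[of UNIV m]]) simp
  with g that show ?thesis by force
qed

lemma angle_surj_Theta:
  assumes "x \<in> {-\<Theta>..\<Theta>}" obtains t where "t \<in> {-K..K}" "angle t = x"
  using assms angle_surj[of x] unfolding angle_K by blast

lemma opt_pair_root: "conj_reciprocal_pair m ((csqrt (\<i> powi (1 - int m)))\<^sup>2) (opt_num m) (opt_den m)"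
  "cmod (csqrt (\<i> powi (1 - int m))) = 1"
  using opt_pair[of m] by (simp_all add: norm_power_int)

text \<open>
  The \<open>m + 1\<close> extremal points on the right arc, followed by their mirror images in reverse
  order, are \<open>2 m + 2\<close> points in cyclic order at which the error alternates throughout: across
  the gap the extremal values at a point and at its mirror image are opposite. What can fail
  is the sign of the half phase, \<open>\<epsilon>1\<close> on the right arc and \<open>\<epsilon>2\<close> on the left one. Passing from
  \<open>s_opt m \<Theta>\<close> to its reciprocal multiplies the half phase by the value of \<open>s_opt m \<Theta>\<close>, which
  is \<open>cis e\<close> with the error \<open>e\<close> on the right arc but \<open>- cis e\<close> on the left one; the minus sign
  makes opposite signs equal.
\<close>

lemma sign_problem_unique:
  assumes r: "r \<in> ratfuns m m" "unimodular_on_circle r"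
    and le: "sign_phase_error \<Theta> r \<le> \<bar>phase_err m K\<bar>"
  shows "r \<in> {s_opt m \<Theta>, inverse (s_opt m \<Theta>)}"
proof -
  define E where "E = \<bar>phase_err m K\<bar>"
  have E: "E < pi" using phase_err_K_less by (simp add: E_def)
  define p q where "p = opt_num m" and "q = opt_den m"
  define g where "g = csqrt (\<i> powi (1 - int m))"
  have pq: "conj_reciprocal_pair m (g\<^sup>2) p q" "cmod g = 1"
    using opt_pair_root[of m] by (simp_all only: p_def q_def g_def)
  \<comment> \<open>The possible extra zero of the denominator is put at \<open>\<i>\<close>, which lies in a gap.\<close>
  obtain p' q' g' where pq': "conj_reciprocal_pair m (g'\<^sup>2) p' q'" "cmod g' = 1"
    and r_eq: "r = Fract p' q'" "q' \<noteq> 0"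
    and q'_nz: "\<And>z. cmod z = 1 \<Longrightarrow> z \<noteq> \<i> \<Longrightarrow> poly q' z \<noteq> 0"
    using unimodular_ratfun_pair_sqrt[OF r, of \<i>] by (metis norm_ii)
  have q_nz: "poly q (cis x) \<noteq> 0" for x by (simp add: q_def opt_den_circle_nonzero)
  have p_nz: "poly p (cis x) \<noteq> 0" for x by (simp add: p_def opt_num_circle_nonzero)
  have r_le: "\<bar>Arg (ratfun_eval r z / csign z)\<bar> \<le> E" if "z \<in> T_arc \<Theta>" for z
    using abs_Arg_le_SUP[OF that, of "\<lambda>z. ratfun_eval r z / csign z"] le
    by (simp add: E_def sign_phase_error_def)
  have cos_pos: "cos x > 0" if "x \<in> {-\<Theta>..\<Theta>}" for x
    using that Theta_less by (intro cos_gt_zero_pi) auto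
  obtain e where e: "continuous_on {-\<Theta>..\<Theta>} e" "\<And>t. t \<in> {-K..K} \<Longrightarrow> e (angle t) = phase_err m t"
    using continuous_arc_error by metis
  define V where "V = (\<lambda>x. half_phase (g' / g) q q' (cis x))"
  obtain \<epsilon>1 e1 where \<epsilon>1: "\<bar>\<epsilon>1\<bar> = 1" and e1: "\<And>x. x \<in> {-\<Theta>..\<Theta>} \<Longrightarrow> \<bar>e1 x\<bar> \<le> E"
    and V1: "\<And>x. x \<in> {-\<Theta>..\<Theta>} \<Longrightarrow> V x = of_real (\<epsilon>1 * cmod (V x)) * cis ((e1 x - e x) / 2)"
  proof (rule half_phase_of_error[OF pq pq', of "-\<Theta>" \<Theta> "\<lambda>_. 1" e E])
    fix x assume x: "x \<in> {-\<Theta>..\<Theta>}"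
    show "poly q (cis x) \<noteq> 0" by (rule q_nz)
    show "poly q' (cis x) \<noteq> 0"
      using cos_pos[OF x] by (intro q'_nz) (auto simp: complex_eq_iff)
    obtain t where t: "t \<in> {-K..K}" "angle t = x" using angle_surj_Theta[OF x] by metis
    have "poly p (cis (angle t)) / poly q (cis (angle t)) = cis (e (angle t))"
      unfolding p_def q_def e(2)[OF t(1)] by (rule opt_right_arc)
    then show "poly p (cis x) / poly q (cis x) = 1 * cis (e x)"
      unfolding t(2) by simp
    show "\<bar>Arg (ratfun_eval (Fract p' q') (cis x) / 1)\<bar> \<le> E"
      using r_le[OF mem_T_arc(1)[OF x]] csign_cis_right[OF x] by (simp add: r_eq)
  qed (use e(1) E in \<open>auto simp: V_def\<close>)
  obtain \<epsilon>2 e2 where \<epsilon>2: "\<bar>\<epsilon>2\<bar> = 1" and e2: "\<And>x. x \<in> {pi - \<Theta>..pi + \<Theta>} \<Longrightarrow> \<bar>e2 x\<bar> \<le> E"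
    and V2: "\<And>x. x \<in> {pi - \<Theta>..pi + \<Theta>} \<Longrightarrow> V x = of_real (\<epsilon>2 * cmod (V x)) * cis ((e2 x - (- e (pi - x))) / 2)"
  proof (rule half_phase_of_error[OF pq pq', of "pi - \<Theta>" "pi + \<Theta>" "\<lambda>_. -1" "\<lambda>x. - e (pi - x)" E])
    show "continuous_on {pi - \<Theta>..pi + \<Theta>} (\<lambda>x. - e (pi - x))"
      by (intro continuous_intros continuous_on_compose2[OF e(1)]) auto
    fix x assume "x \<in> {pi - \<Theta>..pi + \<Theta>}"
    then have x: "pi - x \<in> {-\<Theta>..\<Theta>}" by auto
    show "poly q (cis x) \<noteq> 0" by (rule q_nz)
    show "poly q' (cis x) \<noteq> 0"
      using cos_pos[OF x] by (intro q'_nz) (auto simp: complex_eq_iff)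
    obtain t where t: "t \<in> {-K..K}" "angle t = pi - x" using angle_surj_Theta[OF x] by metis
    have "poly p (cis (pi - angle t)) / poly q (cis (pi - angle t)) = - cis (- e (angle t))"
      unfolding p_def q_def e(2)[OF t(1)] by (rule opt_left_arc)
    moreover have "pi - (pi - x) = x" by simp
    ultimately have "poly p (cis x) / poly q (cis x) = - cis (- e (pi - x))"
      unfolding t(2) by (simp only:)
    then show "poly p (cis x) / poly q (cis x) = -1 * cis (- e (pi - x))" by simp
    show "\<bar>Arg (ratfun_eval (Fract p' q') (cis x) / -1)\<bar> \<le> E"
      using r_le[OF mem_T_arc(2)[OF x]] csign_cis_left[OF x] by (simp add: r_eq)
  qed (use E in \<open>auto simp: V_def\<close>)
  define \<theta> where "\<theta> = (\<lambda>i. if i \<le> m then angle (node m i) else pi - angle (node m (2 * m + 1 - i)))"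
  define ei where "ei = (\<lambda>i. if i \<le> m then phase_err m (node m i) else - phase_err m (node m (2 * m + 1 - i)))"
  define e'i where "e'i = (\<lambda>i. if i \<le> m then e1 (\<theta> i) else e2 (\<theta> i))"
  define \<tau> where "\<tau> = (if phase_err m (- K) \<ge> 0 then 1 else -1 :: real)"
  have \<tau>: "\<bar>\<tau>\<bar> = 1" "phase_err m (- K) = \<tau> * E"
    using abs_err_minus_K[of m] by (auto simp: \<tau>_def E_def)
  have left_index: "2 * m + 1 - i \<le> m" if "\<not> i \<le> m" for i using that by linarith
  have \<theta>_right: "\<theta> i \<in> {-\<Theta>..\<Theta>}" if "i \<le> m" for i
    using angle_bounds[OF node_in_range[OF that]] that by (simp add: \<theta>_def)
  have \<theta>_left: "\<theta> i \<in> {pi - \<Theta>..pi + \<Theta>}" if "\<not> i \<le> m" for i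
    using angle_bounds[OF node_in_range[OF left_index[OF that]]] that by (auto simp: \<theta>_def)
  have mono: "\<theta> i < \<theta> j" if "i < j" "j \<le> 2 * m + 1" for i j
  proof -
    consider "j \<le> m" | "i \<le> m" "\<not> j \<le> m" | "\<not> i \<le> m" using \<open>i < j\<close> by linarith
    then show ?thesis
    proof cases
      case 1 then show ?thesis using angle_node_less[of i j m] that by (simp add: \<theta>_def)
    next
      case 2 then show ?thesis using \<theta>_right[of i] \<theta>_left[of j] Theta_less by auto
    next
      case 3 then show ?thesis
        using angle_node_less[of "2 * m + 1 - j" "2 * m + 1 - i" m] that left_index[of i]
        by (simp add: \<theta>_def diff_less_mono2)
    qed
  qed
  have window: "\<theta> (2 * m + 1) < \<theta> 0 + 2 * pi"
    using \<theta>_right[of 0] \<theta>_left[of "2 * m + 1"] Theta_less by auto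
  have ei: "ei i = \<tau> * (-1) ^ i * E" if "i \<le> 2 * m + 1" for i
  proof (cases "i \<le> m")
    case True
    then show ?thesis using \<tau>(2) phase_err_node[OF True] by (simp add: ei_def)
  next
    case False
    have "(-1 :: real) ^ (2 * m + 1 - i) = - ((-1) ^ i)"
      using that by (simp add: minus_one_power_iff)
    then show ?thesis using False \<tau>(2) phase_err_node[OF left_index[OF False]] by (simp add: ei_def)
  qed
  have e'i: "\<bar>e'i i\<bar> \<le> E" for i
    using e1[OF \<theta>_right] e2[OF \<theta>_left] by (simp add: e'i_def)
  have V: "V (\<theta> i) = of_real ((if i \<le> m then \<epsilon>1 else \<epsilon>2) * cmod (V (\<theta> i))) * cis ((e'i i - ei i) / 2)" for i
  proof (cases "i \<le> m")
    case True
    then have "e (\<theta> i) = ei i" using e(2)[OF node_in_range[OF True]] by (simp add: \<theta>_def ei_def)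
    then show ?thesis using V1[OF \<theta>_right[OF True]] True by (simp add: e'i_def)
  next
    case False
    then have "- e (pi - \<theta> i) = ei i"
      using e(2)[OF node_in_range[OF left_index[OF False]]] by (simp add: \<theta>_def ei_def)
    then show ?thesis using V2[OF \<theta>_left[OF False]] False by (simp add: e'i_def)
  qed
  have "\<epsilon>2 = \<epsilon>1 \<or> \<epsilon>2 = - \<epsilon>1" using \<epsilon>1 \<epsilon>2 by linarith
  then show ?thesis
  proof
    assume eq: "\<epsilon>2 = \<epsilon>1"
    have "p' * q = p * q'"
    proof (rule alternation_imp_same_ratio[OF pq pq' mono window,
          where \<epsilon> = \<epsilon>1 and e = ei and e' = e'i and \<tau> = \<tau> and E = E and w = "\<lambda>i. cmod (V (\<theta> i))"])
      show "half_phase (g' / g) q q' (cis (\<theta> i)) = of_real (\<epsilon>1 * cmod (V (\<theta> i))) * cis ((e'i i - ei i) / 2)" for i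
        using V[of i] unfolding eq if_cancel V_def .
    qed (use \<epsilon>1 ei \<tau>(1) e'i E in auto)
    then have "r = s_opt m \<Theta>"
      using r_eq opt_den_nonzero[of m] by (simp add: s_opt_Fract eq_fract p_def q_def)
    then show ?thesis by simp
  next
    assume eq: "\<epsilon>2 = - \<epsilon>1"
    have c1: "cmod (g\<^sup>2) = 1" using pq(2) by (simp add: norm_power)
    have "p' * p = q * q'"
    proof (rule alternation_imp_same_ratio[OF conj_reciprocal_pair_swap[OF pq(1) c1] pq(2) pq' mono window,
          where \<epsilon> = \<epsilon>1 and e = "\<lambda>i. - ei i" and e' = e'i and \<tau> = "- \<tau>" and E = E and w = "\<lambda>i. cmod (V (\<theta> i))"])
      fix i
      define F :: complex where "F = (if i \<le> m then 1 else -1)"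
      have ratio: "poly p (cis (\<theta> i)) / poly q (cis (\<theta> i)) = F * cis (ei i)"
        using opt_right_arc[of m "node m i"] opt_left_arc[of m "node m (2 * m + 1 - i)"]
        by (simp add: p_def q_def F_def \<theta>_def ei_def del: cis_inverse)
      have half: "cis ((e'i i - ei i) / 2) * cis (ei i) = cis ((e'i i - (- ei i)) / 2)"
        unfolding cis_mult by (rule arg_cong[of _ _ cis]) (simp add: field_simps)
      have F: "of_real (if i \<le> m then \<epsilon>1 else \<epsilon>2) * F = of_real \<epsilon>1" by (simp add: F_def eq)
      have "half_phase (g' / g) p q' (cis (\<theta> i)) = V (\<theta> i) * (poly p (cis (\<theta> i)) / poly q (cis (\<theta> i)))"
        using q_nz[of "\<theta> i"] by (simp add: V_def half_phase_def)
      also have "\<dots> = (of_real (if i \<le> m then \<epsilon>1 else \<epsilon>2) * F) * of_real (cmod (V (\<theta> i)))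
          * (cis ((e'i i - ei i) / 2) * cis (ei i))"
        unfolding ratio by (subst V) (simp only: of_real_mult mult_ac)
      also have "\<dots> = of_real (\<epsilon>1 * cmod (V (\<theta> i))) * cis ((e'i i - (- ei i)) / 2)"
        unfolding F half by simp
      finally show "half_phase (g' / g) p q' (cis (\<theta> i)) =
          of_real (\<epsilon>1 * cmod (V (\<theta> i))) * cis ((e'i i - (- ei i)) / 2)" .
    next
      show "- ei i = - \<tau> * (- 1) ^ i * E" if "i \<le> 2 * m + 1" for i using ei[OF that] by simp
    qed (use \<epsilon>1 \<tau>(1) e'i E in auto)
    moreover have "p \<noteq> 0" using p_nz[of 0] by auto
    ultimately have "r = inverse (s_opt m \<Theta>)"
      using r_eq unfolding inverse_s_opt p_def q_def by (simp add: eq_fract)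
    then show ?thesis by simp
  qed
qed

lemma sign_problem_solutions:
  "{r. is_arg_min (sign_phase_error \<Theta>) (\<lambda>r. r \<in> ratfuns m m \<and> unimodular_on_circle r) r}
    = {s_opt m \<Theta>, inverse (s_opt m \<Theta>)}"
  by (rule arg_min_set_eqI[where E = "\<bar>phase_err m K\<bar>"])
     (use s_opt_class inverse_s_opt_class sign_phase_error_s_opt sign_problem_unique in auto)

end

section \<open>The square root problem\<close>

lemma prod_mirror:
  fixes f :: "nat \<Rightarrow> 'a :: comm_monoid_mult"
  shows "(\<Prod>j=1..2 * n + 1. f j) = (\<Prod>j=1..n. f j * f (2 * n + 2 - j)) * f (n + 1)"
proof -
  have "{1..2 * n + 1} = {1..n} \<union> ({n + 1} \<union> {n + 2..2 * n + 1})" by auto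
  then have "(\<Prod>j=1..2 * n + 1. f j) = (\<Prod>j\<in>{1..n} \<union> ({n + 1} \<union> {n + 2..2 * n + 1}). f j)"
    by (simp only:)
  also have "\<dots> = (\<Prod>j=1..n. f j) * (f (n + 1) * (\<Prod>j\<in>{n + 2..2 * n + 1}. f j))"
    by (subst prod.union_disjoint, simp, simp, force, subst prod.union_disjoint) auto
  also have "(\<Prod>j\<in>{n + 2..2 * n + 1}. f j) = (\<Prod>j=1..n. f (2 * n + 2 - j))"
    by (rule prod.reindex_bij_witness[of _ "\<lambda>j. 2 * n + 2 - j" "\<lambda>j. 2 * n + 2 - j"]) auto
  finally show ?thesis by (simp add: prod.distrib mult_ac)
qed

context arc
begin

lemma am_4K_minus: "am (4 * K - x) = 2 * pi - am x"
proof -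
  have "4 * K - x = - x + 2 * K + 2 * K" by simp
  then show ?thesis by (simp only: am_plus_2K am_minus)
qed

lemma am_sigma_mirror:
  assumes "j \<in> {1..n}"
  shows "am (sigma (2 * n + 1) (2 * n + 2 - j)) = (if even j then 2 * pi else 4 * pi) - am (sigma (2 * n + 1) j)"
proof -
  have "rho (2 * n + 1) (real (2 * n + 2 - j)) = 4 * K - rho (2 * n + 1) j"
    using assms by (simp add: rho_def of_nat_diff field_simps)
  moreover have "even (2 * n + 2 - j) = even j" using assms by auto
  ultimately show ?thesis by (simp add: am_sigma am_4K_minus)
qed

text \<open>
  For odd degree the factors with indices \<open>j\<close> and \<open>2 n + 2 - j\<close> have opposite zeros, so their
  product depends on \<open>z\<^sup>2\<close> only.
\<close>

lemma blaschke_mirror_product: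
  assumes "j \<in> {1..n}"
  defines "\<phi> \<equiv> am (sigma (2 * n + 1) j)" and "\<phi>' \<equiv> am (sigma (2 * n + 1) (2 * n + 2 - j))"
  defines "C \<equiv> of_real (cos (\<phi> / 2))" and "S \<equiv> of_real (sin (\<phi> / 2))"
  shows "(blaschke_num \<phi> z / blaschke_den \<phi> z) * (blaschke_num \<phi>' z / blaschke_den \<phi>' z) =
    (C\<^sup>2 * z\<^sup>2 + S\<^sup>2) / (C\<^sup>2 + S\<^sup>2 * z\<^sup>2)"
proof (cases "even j")
  case True
  then have half: "\<phi>' / 2 = pi - \<phi> / 2"
    using am_sigma_mirror[OF assms(1)] by (simp add: \<phi>_def \<phi>'_def field_simps)
  have num: "blaschke_num \<phi>' z = - C * z - \<i> * S" and den: "blaschke_den \<phi>' z = - C + \<i> * S * z"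
    unfolding blaschke_num_def blaschke_den_def half by (simp_all add: C_def S_def)
  have "(C * z - \<i> * S) * (- C * z - \<i> * S) = - (C\<^sup>2 * z\<^sup>2 + S\<^sup>2)"
    by (simp add: algebra_simps power2_eq_square)
  moreover have "(C + \<i> * S * z) * (- C + \<i> * S * z) = - (C\<^sup>2 + S\<^sup>2 * z\<^sup>2)"
    by (simp add: algebra_simps power2_eq_square)
  ultimately show ?thesis
    unfolding times_divide_times_eq num den
    unfolding blaschke_num_def blaschke_den_def
    by (simp only: C_def [symmetric] S_def [symmetric] minus_divide_divide)
next
  case False
  then have half: "\<phi>' / 2 = 2 * pi - \<phi> / 2"
    using am_sigma_mirror[OF assms(1)] by (simp add: \<phi>_def \<phi>'_def field_simps)
  have num: "blaschke_num \<phi>' z = C * z + \<i> * S" and den: "blaschke_den \<phi>' z = C - \<i> * S * z"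
    unfolding blaschke_num_def blaschke_den_def half
    by (simp_all add: C_def S_def cos_diff sin_diff)
  have "(C * z - \<i> * S) * (C * z + \<i> * S) = C\<^sup>2 * z\<^sup>2 + S\<^sup>2"
    by (simp add: algebra_simps power2_eq_square)
  moreover have "(C + \<i> * S * z) * (C - \<i> * S * z) = C\<^sup>2 + S\<^sup>2 * z\<^sup>2"
    by (simp add: algebra_simps power2_eq_square)
  ultimately show ?thesis
    unfolding times_divide_times_eq num den
    unfolding blaschke_num_def blaschke_den_def
    by (simp only: C_def [symmetric] S_def [symmetric])
qed

text \<open>
  The coefficient is \<open>b\<^sup>2\<close> for even \<open>n\<close> and its inverse for odd \<open>n\<close>, where \<open>b = tan (\<phi> / 2)\<close>
  is the coefficient of the product of degree \<open>2 n + 1\<close>.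
\<close>

lemma a_coeff_eq:
  assumes j: "j \<in> {1..n}"
  defines "\<phi> \<equiv> am (sigma (2 * n + 1) j)"
  shows "a_coeff n \<Theta> j = (if even n then (sin (\<phi> / 2))\<^sup>2 / (cos (\<phi> / 2))\<^sup>2 else (cos (\<phi> / 2))\<^sup>2 / (sin (\<phi> / 2))\<^sup>2)"
    and "sin (\<phi> / 2) \<noteq> 0" "cos (\<phi> / 2) \<noteq> 0"
proof -
  define t where "t = (2 * real j - 1) / (2 * real n + 1)"
  define \<psi> where "\<psi> = am (rho (2 * n + 1) j)"
  have "0 < t" "t < 1" using j by (auto simp: t_def)
  from this[THEN mult_strict_right_mono, OF K_pos] have tK: "0 < t * K" "t * K < K" by simp_all
  moreover from this K_pos have "t * K < 2 * K" by linarith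
  ultimately have "cn (t * K) \<noteq> 0" by (intro cn_nonzero less_imp_neq)
  from elliptic_quot_eq[OF this] have
    q: "elliptic_quot \<Theta> t = sin (\<psi> / 2) / cos (\<psi> / 2)"
    and nz: "sin (\<psi> / 2) \<noteq> 0" "cos (\<psi> / 2) \<noteq> 0"
    by (simp_all add: \<psi>_def rho_eq t_def add.commute)
  have a: "a_coeff n \<Theta> j = (sin (\<psi> / 2) / cos (\<psi> / 2)) powi (2 * (-1) ^ (j + n))"
    by (simp add: a_coeff_def q [unfolded t_def])
  have powi2: "x powi 2 = x\<^sup>2" for x :: real
    using power_int_of_nat[of x 2] by simp
  have "a_coeff n \<Theta> j = (if even n then (sin (\<phi> / 2))\<^sup>2 / (cos (\<phi> / 2))\<^sup>2 else (cos (\<phi> / 2))\<^sup>2 / (sin (\<phi> / 2))\<^sup>2)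
    \<and> sin (\<phi> / 2) \<noteq> 0 \<and> cos (\<phi> / 2) \<noteq> 0"
  proof (cases "even j")
    case True
    then have "\<phi> = \<psi>" by (simp add: \<phi>_def \<psi>_def am_sigma)
    then show ?thesis using nz True
      by (cases "even n") (simp_all add: a powi2 power_int_minus power_divide)
  next
    case False
    then have half: "\<phi> / 2 = \<psi> / 2 + pi / 2"
      by (simp add: \<phi>_def \<psi>_def am_sigma add_divide_distrib)
    have "sin (\<phi> / 2) = cos (\<psi> / 2)" "cos (\<phi> / 2) = - sin (\<psi> / 2)"
      unfolding half by (simp_all add: sin_add cos_add)
    then show ?thesis using nz False
      by (cases "even n") (simp_all add: a powi2 power_int_minus power_divide)
  qed
  then show "a_coeff n \<Theta> j = (if even n then (sin (\<phi> / 2))\<^sup>2 / (cos (\<phi> / 2))\<^sup>2 else (cos (\<phi> / 2))\<^sup>2 / (sin (\<phi> / 2))\<^sup>2)"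
    "sin (\<phi> / 2) \<noteq> 0" "cos (\<phi> / 2) \<noteq> 0" by blast+
qed

lemma a_coeff_pos_neq_1:
  assumes j: "j \<in> {1..n}" shows "0 < a_coeff n \<Theta> j" "a_coeff n \<Theta> j \<noteq> 1"
proof -
  define \<phi> where "\<phi> = am (sigma (2 * n + 1) j)"
  have "cos \<phi> \<noteq> 0" unfolding \<phi>_def using j by (intro cos_am_sigma_nonzero) auto
  moreover have "cos \<phi> = (cos (\<phi> / 2))\<^sup>2 - (sin (\<phi> / 2))\<^sup>2"
    using cos_double[of "\<phi> / 2"] by simp
  ultimately show "0 < a_coeff n \<Theta> j" "a_coeff n \<Theta> j \<noteq> 1"
    using a_coeff_eq[OF j, folded \<phi>_def] by (auto simp: divide_eq_1_iff)
qed

definition sqrt_num :: "nat \<Rightarrow> complex poly" where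
  "sqrt_num n = (\<Prod>j=1..n. [:1, of_real (a_coeff n \<Theta> j):])"

definition sqrt_den :: "nat \<Rightarrow> complex poly" where
  "sqrt_den n = (\<Prod>j=1..n. [:of_real (a_coeff n \<Theta> j), 1:])"

lemma r_opt_Fract: "r_opt n \<Theta> = Fract (sqrt_num n) (sqrt_den n)"
  unfolding r_opt_def sqrt_num_def sqrt_den_def by (intro prod_Fract) simp

lemma sqrt_den_circle_nonzero:
  assumes "cmod z = 1" shows "poly (sqrt_den n) z \<noteq> 0"
proof -
  have "of_real (a_coeff n \<Theta> j) + z \<noteq> 0" if j: "j \<in> {1..n}" for j
  proof
    assume "of_real (a_coeff n \<Theta> j) + z = 0"
    then have "z = - of_real (a_coeff n \<Theta> j)" by (simp add: add_eq_0_iff)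
    then have "\<bar>a_coeff n \<Theta> j\<bar> = 1" using assms by simp
    then show False using a_coeff_pos_neq_1[OF j] by simp
  qed
  then show ?thesis by (simp add: sqrt_den_def poly_prod)
qed

lemma sqrt_pair: "conj_reciprocal_pair n 1 (sqrt_num n) (sqrt_den n)"
proof -
  have "degree (sqrt_num n) \<le> card {1..n}" "degree (sqrt_den n) \<le> card {1..n}"
    unfolding sqrt_num_def sqrt_den_def by (intro degree_prod_le_card; simp)+
  moreover have "1 + z * of_real a = z * (of_real a + cnj z)" if "cmod z = 1" for z a
    using cnj_circle[OF that] by (simp add: algebra_simps)
  ultimately show ?thesis
    by (auto simp: conj_reciprocal_pair_def sqrt_num_def sqrt_den_def poly_prod prod.distrib)
qed

text \<open>
  Besides the paired factors the product of degree \<open>2 n + 1\<close> has its middle factor, \<open>z\<close> for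
  even \<open>n\<close> and \<open>-1 / z\<close> for odd \<open>n\<close>. The parity therefore decides between \<open>s\<close> and its
  reciprocal.
\<close>

lemma sqrt_quotient:
  fixes n :: nat
  assumes z: "cmod z = 1"
  defines "s \<equiv> poly (opt_num (2 * n + 1)) z / poly (opt_den (2 * n + 1)) z"
  shows "poly (sqrt_num n) (z\<^sup>2) / poly (sqrt_den n) (z\<^sup>2) = (if even n then z * inverse s else z * s)"
proof -
  define B where "B = (\<lambda>j. blaschke_num (am (sigma (2 * n + 1) j)) z / blaschke_den (am (sigma (2 * n + 1) j)) z)"
  define P where "P = (\<Prod>j=1..n. B j * B (2 * n + 2 - j))"
  have z0: "z \<noteq> 0" using z by auto
  have factor: "(1 + z\<^sup>2 * of_real (a_coeff n \<Theta> j)) / (of_real (a_coeff n \<Theta> j) + z\<^sup>2)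
      = (if even n then inverse (B j * B (2 * n + 2 - j)) else B j * B (2 * n + 2 - j))"
    if j: "j \<in> {1..n}" for j
  proof -
    define \<phi> where "\<phi> = am (sigma (2 * n + 1) j)"
    define C S :: complex where "C = of_real (cos (\<phi> / 2))" and "S = of_real (sin (\<phi> / 2))"
    have nz: "C \<noteq> 0" "S \<noteq> 0"
      using a_coeff_eq(2,3)[OF j] by (simp_all add: C_def S_def \<phi>_def)
    have B: "B j * B (2 * n + 2 - j) = (C\<^sup>2 * z\<^sup>2 + S\<^sup>2) / (C\<^sup>2 + S\<^sup>2 * z\<^sup>2)"
      using blaschke_mirror_product[OF j] by (simp add: B_def C_def S_def \<phi>_def)
    have cancel: "(u / d) / (v / d) = u / v" if "d \<noteq> 0" for u v d :: complex
      using that by simp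
    have nz2: "C\<^sup>2 \<noteq> 0" "S\<^sup>2 \<noteq> 0" using nz by simp_all
    show ?thesis
    proof (cases "even n")
      case True
      then have a: "of_real (a_coeff n \<Theta> j) = S\<^sup>2 / C\<^sup>2"
        using a_coeff_eq(1)[OF j] by (simp add: C_def S_def \<phi>_def)
      have "1 + z\<^sup>2 * (S\<^sup>2 / C\<^sup>2) = (C\<^sup>2 + S\<^sup>2 * z\<^sup>2) / C\<^sup>2" "S\<^sup>2 / C\<^sup>2 + z\<^sup>2 = (C\<^sup>2 * z\<^sup>2 + S\<^sup>2) / C\<^sup>2"
        using nz by (simp_all add: add_divide_distrib mult.commute)
      note e = this
      show ?thesis unfolding B a unfolding e cancel[OF nz2(1)] using True by simp
    next
      case False
      then have a: "of_real (a_coeff n \<Theta> j) = C\<^sup>2 / S\<^sup>2"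
        using a_coeff_eq(1)[OF j] by (simp add: C_def S_def \<phi>_def)
      have "1 + z\<^sup>2 * (C\<^sup>2 / S\<^sup>2) = (C\<^sup>2 * z\<^sup>2 + S\<^sup>2) / S\<^sup>2" "C\<^sup>2 / S\<^sup>2 + z\<^sup>2 = (C\<^sup>2 + S\<^sup>2 * z\<^sup>2) / S\<^sup>2"
        using nz by (simp_all add: add_divide_distrib mult.commute)
      note e = this
      show ?thesis unfolding B a unfolding e cancel[OF nz2(2)] using False by simp
    qed
  qed
  have "poly (sqrt_num n) (z\<^sup>2) / poly (sqrt_den n) (z\<^sup>2) =
      (\<Prod>j=1..n. (1 + z\<^sup>2 * of_real (a_coeff n \<Theta> j)) / (of_real (a_coeff n \<Theta> j) + z\<^sup>2))"
    by (simp add: sqrt_num_def sqrt_den_def poly_prod prod_dividef)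
  also have "\<dots> = (\<Prod>j=1..n. if even n then inverse (B j * B (2 * n + 2 - j)) else B j * B (2 * n + 2 - j))"
    by (rule prod.cong[OF refl factor])
  also have "\<dots> = (if even n then inverse P else P)"
    using prod_inversef[of "\<lambda>j. B j * B (2 * n + 2 - j)" "{1..n}"]
    by (cases "even n") (simp_all only: P_def o_def if_True if_False)
  finally have r: "poly (sqrt_num n) (z\<^sup>2) / poly (sqrt_den n) (z\<^sup>2) = (if even n then inverse P else P)" .
  have powi: "\<i> powi (1 - int (2 * n + 1)) = (-1) ^ n"
  proof -
    have "1 - int (2 * n + 1) = - int (2 * n)" by simp
    then have "\<i> powi (1 - int (2 * n + 1)) = inverse (\<i> ^ (2 * n))"
      by (simp only: power_int_minus power_int_of_nat)
    also have "\<i> ^ (2 * n) = (-1) ^ n" by (simp add: power_mult)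
    also have "inverse ((-1) ^ n) = ((-1) ^ n :: complex)" by (cases "even n") simp_all
    finally show ?thesis .
  qed
  have "rho (2 * n + 1) (real (n + 1)) = 0 + 2 * K" by (simp add: rho_def field_simps)
  then have am_mid: "am (rho (2 * n + 1) (real (n + 1))) = pi"
    by (simp only: am_plus_2K am_0)
  have "B (n + 1) = (if even n then z else - inverse z)"
  proof (cases "even n")
    case True
    then have "am (sigma (2 * n + 1) (n + 1)) = 2 * pi" using am_mid by (simp add: am_sigma)
    then show ?thesis using True by (simp add: B_def blaschke_num_def blaschke_den_def)
  next
    case False
    then have "am (sigma (2 * n + 1) (n + 1)) = pi" using am_mid by (simp add: am_sigma)
    then show ?thesis using False z0 by (simp add: B_def blaschke_num_def blaschke_den_def divide_simps)
  qed
  moreover have "s = (-1) ^ n * (\<Prod>j=1..2 * n + 1. B j)"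
    unfolding s_def opt_quotient powi B_def ..
  moreover have "(\<Prod>j=1..2 * n + 1. B j) = P * B (n + 1)"
    unfolding P_def by (rule prod_mirror)
  ultimately have "s = P * (if even n then z else inverse z)"
    by (simp only:) simp
  then show ?thesis using r z0 by simp
qed

definition sqrt_err :: "nat \<Rightarrow> real \<Rightarrow> real" where
  "sqrt_err n t = (-1) ^ (n + 1) * phase_err (2 * n + 1) t"

lemma sqrt_quotient_arc:
  "poly (sqrt_num n) (cis (2 * angle t)) / poly (sqrt_den n) (cis (2 * angle t)) = cis (angle t) * cis (sqrt_err n t)"
proof -
  have "(cis (angle t))\<^sup>2 = cis (2 * angle t)" by (simp add: power2_eq_square cis_mult)
  then show ?thesis
    using sqrt_quotient[of "cis (angle t)" n] opt_right_arc[of "2 * n + 1" t]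
    by (simp add: sqrt_err_def)
qed

lemma r_opt_class: "r_opt n \<Theta> \<in> ratfuns n n" "unimodular_on_circle (r_opt n \<Theta>)"
  unfolding r_opt_Fract
  using conj_reciprocal_pair_unimodular[OF sqrt_pair _ sqrt_den_circle_nonzero] by auto

lemma csqrt_cis: assumes "x \<in> {- 2 * \<Theta>..2 * \<Theta>}" shows "csqrt (cis x) = cis (x / 2)"
proof -
  have "0 < cos (x / 2)" using assms Theta_less by (intro cos_gt_zero_pi) auto
  moreover have "(cis (x / 2))\<^sup>2 = cis x" by (simp add: power2_eq_square cis_mult)
  ultimately show ?thesis using csqrt_square[of "cis (x / 2)"] by simp
qed

lemma double_angle_mem: assumes "t \<in> {-K..K}" shows "2 * angle t \<in> {- 2 * \<Theta>..2 * \<Theta>}"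
  using angle_bounds[OF assms] by auto

lemma S_arc_cases:
  assumes "x \<in> {- 2 * \<Theta>..2 * \<Theta>}" obtains t where "t \<in> {-K..K}" "x = 2 * angle t"
proof -
  have "x / 2 \<in> {-\<Theta>..\<Theta>}" using assms by auto
  then obtain t where t: "t \<in> {-K..K}" "angle t = x / 2" using angle_surj_Theta by blast
  then have "x = 2 * angle t" by simp
  with t(1) show ?thesis by (rule that)
qed

lemma sqrt_phase_error_r_opt: "sqrt_phase_error \<Theta> (r_opt n \<Theta>) = \<bar>phase_err (2 * n + 1) K\<bar>"
proof -
  have Arg: "\<bar>Arg (ratfun_eval (r_opt n \<Theta>) (cis (2 * angle t)) / csqrt (cis (2 * angle t)))\<bar> = \<bar>phase_err (2 * n + 1) t\<bar>"
    if t: "t \<in> {-K..K}" for t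
  proof -
    have "ratfun_eval (r_opt n \<Theta>) (cis (2 * angle t)) = cis (angle t) * cis (sqrt_err n t)"
      using sqrt_den_circle_nonzero[of "cis (2 * angle t)" n] sqrt_quotient_arc[of n t]
      by (simp add: r_opt_Fract ratfun_eval_Fract)
    moreover have "csqrt (cis (2 * angle t)) = cis (angle t)"
      using csqrt_cis[OF double_angle_mem[OF t]] by simp
    ultimately have "ratfun_eval (r_opt n \<Theta>) (cis (2 * angle t)) / csqrt (cis (2 * angle t)) = cis (sqrt_err n t)"
      by simp
    then show ?thesis
      using Arg_cis_err[of "2 * n + 1" t] by (cases "even n") (simp_all add: sqrt_err_def del: cis_inverse)
  qed
  have K: "K \<in> {-K..K}" using K_pos by simp
  show ?thesis
    unfolding sqrt_phase_error_def
  proof (rule SUP_abs_Arg_eq[where ?z0.0 = "cis (2 * angle K)"])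
    show "\<bar>Arg (ratfun_eval (r_opt n \<Theta>) (cis (2 * angle K)) / csqrt (cis (2 * angle K)))\<bar> = \<bar>phase_err (2 * n + 1) K\<bar>"
      by (rule Arg[OF K])
    show "cis (2 * angle K) \<in> S_arc \<Theta>"
      unfolding S_arc_def by (rule imageI[OF double_angle_mem[OF K]])
    fix z assume "z \<in> S_arc \<Theta>"
    then obtain x where x: "z = cis x" "x \<in> {- 2 * \<Theta>..2 * \<Theta>}" unfolding S_arc_def by blast
    obtain t where t: "t \<in> {-K..K}" "x = 2 * angle t" using S_arc_cases[OF x(2)] .
    show "\<bar>Arg (ratfun_eval (r_opt n \<Theta>) z / csqrt z)\<bar> \<le> \<bar>phase_err (2 * n + 1) K\<bar>"
      unfolding x(1) t(2) Arg[OF t(1)] by (rule abs_err_le)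
  qed
qed

text \<open>
  One connected arc, hence one sign of the half phase and a single solution. The \<open>2 n + 2\<close>
  points come from the right arc of the sign problem of degree \<open>2 n + 1\<close> by doubling the
  angle.
\<close>

lemma sqrt_problem_unique:
  assumes r: "r \<in> ratfuns n n" "unimodular_on_circle r"
    and le: "sqrt_phase_error \<Theta> r \<le> \<bar>phase_err (2 * n + 1) K\<bar>"
  shows "r = r_opt n \<Theta>"
proof -
  define m where "m = 2 * n + 1"
  define E where "E = \<bar>phase_err m K\<bar>"
  have E: "E < pi" using phase_err_K_less by (simp add: E_def)
  define p q where "p = sqrt_num n" and "q = sqrt_den n"
  have pq: "conj_reciprocal_pair n (1\<^sup>2) p q" "cmod 1 = 1"
    using sqrt_pair by (simp_all add: p_def q_def)
  \<comment> \<open>The point \<open>-1\<close> lies outside the arc, as \<open>2 * \<Theta> < pi\<close>.\<close>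
  obtain p' q' g' where pq': "conj_reciprocal_pair n (g'\<^sup>2) p' q'" "cmod g' = 1"
    and r_eq: "r = Fract p' q'" "q' \<noteq> 0"
    and q'_nz: "\<And>z. cmod z = 1 \<Longrightarrow> z \<noteq> -1 \<Longrightarrow> poly q' z \<noteq> 0"
    using unimodular_ratfun_pair_sqrt[OF r, of "-1"] by (metis norm_minus_cancel norm_one)
  have q_nz: "poly q (cis x) \<noteq> 0" for x by (simp add: q_def sqrt_den_circle_nonzero)
  have r_le: "\<bar>Arg (ratfun_eval r z / csqrt z)\<bar> \<le> E" if "z \<in> S_arc \<Theta>" for z
    using abs_Arg_le_SUP[OF that, of "\<lambda>z. ratfun_eval r z / csqrt z"] le
    by (simp add: E_def m_def sqrt_phase_error_def)
  obtain e0 where e0: "continuous_on {-\<Theta>..\<Theta>} e0" "\<And>t. t \<in> {-K..K} \<Longrightarrow> e0 (angle t) = phase_err m t"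
    using continuous_arc_error by metis
  define e where "e = (\<lambda>x. (-1) ^ (n + 1) * e0 (x / 2))"
  have e: "e (2 * angle t) = sqrt_err n t" if "t \<in> {-K..K}" for t
    using e0(2)[OF that] by (simp add: e_def sqrt_err_def m_def)
  define V where "V = (\<lambda>x. half_phase (g' / 1) q q' (cis x))"
  obtain \<epsilon> e' where \<epsilon>: "\<bar>\<epsilon>\<bar> = 1" and e': "\<And>x. x \<in> {- 2 * \<Theta>..2 * \<Theta>} \<Longrightarrow> \<bar>e' x\<bar> \<le> E"
    and V: "\<And>x. x \<in> {- 2 * \<Theta>..2 * \<Theta>} \<Longrightarrow> V x = of_real (\<epsilon> * cmod (V x)) * cis ((e' x - e x) / 2)"
  proof (rule half_phase_of_error[OF pq pq', of "- 2 * \<Theta>" "2 * \<Theta>" "\<lambda>x. cis (x / 2)" e E])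
    show "continuous_on {- 2 * \<Theta>..2 * \<Theta>} e"
      unfolding e_def by (intro continuous_intros continuous_on_compose2[OF e0(1)]) auto
    show "continuous_on {- 2 * \<Theta>..2 * \<Theta>} (\<lambda>x. cis (x / 2))"
      by (intro continuous_intros) auto
    fix x assume x: "x \<in> {- 2 * \<Theta>..2 * \<Theta>}"
    show "poly q (cis x) \<noteq> 0" by (rule q_nz)
    have "-1 < cos (x)"
    proof -
      have "0 < cos (x / 2)" using x Theta_less by (intro cos_gt_zero_pi) auto
      then have "0 < (cos (x / 2))\<^sup>2" by simp
      then show ?thesis using cos_double_cos[of "x / 2"] by simp
    qed
    then show "poly q' (cis x) \<noteq> 0" by (intro q'_nz) (auto simp: complex_eq_iff)
    obtain t where t: "t \<in> {-K..K}" "x = 2 * angle t" using S_arc_cases[OF x] .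
    have half: "2 * angle t / 2 = angle t" by simp
    show "poly p (cis x) / poly q (cis x) = cis (x / 2) * cis (e x)"
      unfolding p_def q_def t(2) half e[OF t(1)] by (rule sqrt_quotient_arc)
    have "cis x \<in> S_arc \<Theta>" unfolding S_arc_def using x by (rule imageI)
    from r_le[OF this] show "\<bar>Arg (ratfun_eval (Fract p' q') (cis x) / cis (x / 2))\<bar> \<le> E"
      by (simp add: r_eq csqrt_cis[OF x])
  qed (use E in \<open>auto simp: V_def\<close>)
  define \<theta> where "\<theta> = (\<lambda>i. 2 * angle (node m i))"
  define \<tau> where "\<tau> = (if sqrt_err n (- K) \<ge> 0 then 1 else -1 :: real)"
  have \<tau>: "\<bar>\<tau>\<bar> = 1" "sqrt_err n (- K) = \<tau> * E"
    using abs_err_minus_K[of m] by (auto simp: \<tau>_def E_def sqrt_err_def m_def minus_one_power_iff)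
  have \<theta>_mem: "\<theta> i \<in> {- 2 * \<Theta>..2 * \<Theta>}" if "i \<le> 2 * n + 1" for i
    unfolding \<theta>_def using that by (intro double_angle_mem node_in_range) (simp add: m_def)
  have "p' * q = p * q'"
  proof (rule alternation_imp_same_ratio[OF pq pq', where \<theta> = \<theta> and \<epsilon> = \<epsilon> and e = "\<lambda>i. e (\<theta> i)"
        and e' = "\<lambda>i. e' (\<theta> i)" and \<tau> = \<tau> and E = E and w = "\<lambda>i. cmod (V (\<theta> i))"])
    show "\<theta> i < \<theta> j" if "i < j" "j \<le> 2 * n + 1" for i j
      using angle_node_less[of i j m] that by (simp add: \<theta>_def m_def)
    show "\<theta> (2 * n + 1) < \<theta> 0 + 2 * pi"
      using \<theta>_mem[of 0] \<theta>_mem[of "2 * n + 1"] Theta_less by auto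
    fix i assume i: "i \<le> 2 * n + 1"
    show "half_phase (g' / 1) q q' (cis (\<theta> i)) = of_real (\<epsilon> * cmod (V (\<theta> i))) * cis ((e' (\<theta> i) - e (\<theta> i)) / 2)"
      using V[OF \<theta>_mem[OF i]] unfolding V_def .
    show "\<bar>e' (\<theta> i)\<bar> \<le> E" by (rule e'[OF \<theta>_mem[OF i]])
    have "e (\<theta> i) = sqrt_err n (node m i)"
      unfolding \<theta>_def using i by (intro e node_in_range) (simp add: m_def)
    also have "\<dots> = (-1) ^ i * sqrt_err n (- K)"
      using phase_err_node[of i m] i by (simp add: sqrt_err_def m_def)
    finally show "e (\<theta> i) = \<tau> * (-1) ^ i * E" by (simp add: \<tau>(2))
  qed (use \<epsilon> \<tau>(1) E in auto)
  moreover have "q \<noteq> 0" using q_nz[of 0] by auto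
  ultimately show ?thesis
    using r_eq by (simp add: r_opt_Fract eq_fract p_def q_def)
qed

lemma sqrt_problem_solution:
  "{r. is_arg_min (sqrt_phase_error \<Theta>) (\<lambda>r. r \<in> ratfuns n n \<and> unimodular_on_circle r) r} = {r_opt n \<Theta>}"
  by (rule arg_min_set_eqI[where E = "\<bar>phase_err (2 * n + 1) K\<bar>"])
     (use r_opt_class sqrt_phase_error_r_opt sqrt_problem_unique in auto)

end

theorem theorem2p1:
  fixes m n :: nat and \<Theta> :: real
  assumes "0 < \<Theta>" and "\<Theta> < pi / 2"
  shows "{r. is_arg_min (sqrt_phase_error \<Theta>)
              (\<lambda>r. r \<in> ratfuns n n \<and> unimodular_on_circle r) r} = {r_opt n \<Theta>}
    \<and> {r. is_arg_min (sign_phase_error \<Theta>)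
              (\<lambda>r. r \<in> ratfuns m m \<and> unimodular_on_circle r) r} = {s_opt m \<Theta>, inverse (s_opt m \<Theta>)}
    \<and> s_opt m \<Theta> \<noteq> inverse (s_opt m \<Theta>)"
proof -
  interpret arc \<Theta> by unfold_locales (fact assms)+
  show ?thesis
    using sqrt_problem_solution[of n] sign_problem_solutions[of m] s_opt_neq_inverse[of m] by blast
qed

end
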